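(* Consider the generalized equation $0\in\Phi x=Fx+Tx$ in the expectation setting $Fx=\mathbb{E}_\xi[\mathbf F(x,\xi)]$ under the standing assumptions of the context, with $L\rho<1$. Let $\hat L>L$ with $\hat L\rho<1$, $\bar\beta:=\frac{\lambda(4-\hat L\lambda)-4\rho}{4(1-\rho\hat L)}$, $\Lambda:=\frac{\hat L-L}{L\hat L}$, and $$2\rho\le\lambda<\tfrac{2(1+\sqrt{1-\hat L\rho})}{\hat L},\quad 0<\mu<\tfrac23,\quad \nu:=\tfrac\mu2,\quad 0<\beta\le\tfrac{(2-\mu)\bar\beta}{2+\mu},\quad t_k:=\mu(k+r),\quad \eta_k:=\tfrac{2\beta(t_k-1)}{t_k-\nu},\quad r>3+\tfrac1\mu .$$ For $x^\star\in\mathrm{zer}(\Phi)$ let $\Psi_0^2:=\mu^2r^2\,\mathbb{E}[\|G_\lambda x^0\|^2]+\frac{2r-1}{4\beta^2(\mu r-1)}\|x^0-x^\star\|^2$. Let $\{(x^k,z^k)\}$ be generated by the VFOSA$_+$ iteration (see context) where $\widetilde F^k$ is the L-SARAH estimator with mega-batches (see context) with $$b_k=b:=\Big\lfloor\frac{c_b}{\epsilon}\Big\rfloor,\qquad n_k=n:=\Big\lfloor\frac{c_n}{\epsilon^3}\Big\rfloor,\qquad \mathbf p_k:=\epsilon+\frac{2\mu}{\mu(k+r-1)-1},$$ where $\epsilon\in\big(0,\frac{\mu(r-3)-1}{\mu(r-1)-1}\big]$, $c_b:=\frac{5\beta}{\mu\Lambda}$, and $c_n:=24\sigma^2\max\big\{\frac{\sqrt2\,\Psi_0}{\mu^2},\frac1{\mu\beta}\big\}$.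 Then the expected total number $\bar{\mathcal T}_K$ of oracle calls $\mathbf F(\cdot,\xi)$ and evaluations of $J_{\lambda T}$ to obtain $x^K$ such that $\mathbb{E}[\|G_\lambda x^K\|^2]\le\epsilon^2$ is at most $\bar{\mathcal T}_K=\mathcal O\big(\epsilon^{-2}+\epsilon^{-3}+\epsilon^{-3}\ln(\epsilon^{-1})\big)$ (with constants independent of $\epsilon$).
   Context: Problem: $F:\mathbb{R}^p\to\mathbb{R}^p$ is single-valued with $Fx=\mathbb{E}_\xi[\mathbf F(x,\xi)]$ for a random variable $\xi$ (unbiased stochastic oracle), $T:\mathbb{R}^p\rightrightarrows2^{\mathbb{R}^p}$ is possibly multi-valued, $\Phi:=F+T$, $\mathrm{zer}(\Phi):=\{x:0\in\Phi x\}$, $\mathrm{dom}(\Phi)=\{x:\Phi x\neq\emptyset\}$. Standing assumptions. $\mathrm{zer}(\Phi)\neq\emptyset$. There is $\sigma\ge0$ with $\mathbb{E}_\xi[\|\mathbf F(x,\xi)-Fx\|^2]\le\sigma^2$ for all $x\in\mathrm{dom}(F)$. $T$ is maximally $\rho$-co-hypomonotone for some $\rho\ge0$: $\langle u-v,x-y\rangle\ge-\rho\|u-v\|^2$ for all $(x,u),(y,v)$ in the graph of $T$, and the graph is not properly contained in that of another such operator. There is $L>0$ with $\langle Fx-Fy,x-y\rangle\ge\frac1L\mathbb{E}_\xi[\|\mathbf F(x,\xi)-\mathbf F(y,\xi)\|^2]$ for all $x,y\in\mathrm{dom}(F)$. Operators: for $\lambda>0$, $J_{\lambda T}x:=\{w:x\in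 w+\lambda Tw\}$ and $G_\lambda x:=\frac1\lambda\big(x-J_{\lambda T}(x-\lambda Fx)\big)$. VFOSA$_+$ iteration: given $x^0\in\mathrm{dom}(\Phi)$, $z^0:=x^0$, for $k\ge0$: $y^k:=\frac{t_k-1}{t_k}x^k+\frac1{t_k}z^k$; $x^{k+1}:=y^k-\eta_k\widetilde G_\lambda^k$; $z^{k+1}:=z^k+\nu(x^{k+1}-y^k)$, where $\widetilde G_\lambda^k:=\frac1\lambda\big(x^k-J_{\lambda T}(x^k-\lambda\widetilde F^k)\big)$ and $\widetilde F^k$ is a stochastic estimator of $Fx^k$. L-SARAH (loopless SARAH) estimator with mega-batches: $\widetilde F^0:=\bar Fx^0$; for $k\ge1$, with an i.i.d. mini-batch $\mathcal S_k$ of $\xi$ of size $b_k$, $\widetilde F^k:=\widetilde F^{k-1}+\frac1{b_k}\sum_{\xi_i\in\mathcal S_k}(\mathbf F(x^k,\xi_i)-\mathbf F(x^{k-1},\xi_i))$ with probability $1-\mathbf p_k$, and $\widetilde F^k:=\bar Fx^k$ with probability $\mathbf p_k$; here $\bar Fx^k:=\frac1{n_k}\sum_{\xi\in\bar{\mathcal S}_k}\mathbf F(x^k,\xi)$ with an i.i.d. mega-batch $\bar{\mathcal S}_k$ of size $n_k$, an unbiased estimator of $Fx^k$ with variance at most $\sigma^2/n_k$. *)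

theory Defs
  imports "HOL-Probability.Probability"
begin

text \<open>A multi-valued operator on \<open>\<real>\<^sup>p\<close> is a function \<open>T\<close> from points to sets of points;
  its graph is \<open>{(x, u). u \<in> T x}\<close>.\<close>

definition op_graph :: "('a \<Rightarrow> 'a set) \<Rightarrow> ('a \<times> 'a) set" where
  "op_graph T = {(x, u). u \<in> T x}"

definition op_dom :: "('a \<Rightarrow> 'a set) \<Rightarrow> 'a set" where
  "op_dom T = {x. T x \<noteq> {}}"

definition zer :: "('a::zero \<Rightarrow> 'a set) \<Rightarrow> 'a set" where
  "zer T = {x. 0 \<in> T x}"

definition op_plus :: "('a::plus \<Rightarrow> 'a) \<Rightarrow> ('a \<Rightarrow> 'a set) \<Rightarrow> 'a \<Rightarrow> 'a set" where
  "op_plus F T x = {F x + u | u. u \<in> T x}"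

definition cohypomonotone :: "real \<Rightarrow> ('a::real_inner \<Rightarrow> 'a set) \<Rightarrow> bool" where
  "cohypomonotone \<rho> T \<longleftrightarrow>
     (\<forall>(x, u) \<in> op_graph T. \<forall>(y, v) \<in> op_graph T.
        (u - v) \<bullet> (x - y) \<ge> - \<rho> * (norm (u - v))\<^sup>2)"

definition maximally_cohypomonotone :: "real \<Rightarrow> ('a::real_inner \<Rightarrow> 'a set) \<Rightarrow> bool" where
  "maximally_cohypomonotone \<rho> T \<longleftrightarrow>
     cohypomonotone \<rho> T \<and> (\<nexists>S. cohypomonotone \<rho> S \<and> op_graph T \<subset> op_graph S)"

definition resolvent :: "real \<Rightarrow> ('a::real_vector \<Rightarrow> 'a set) \<Rightarrow> 'a \<Rightarrow> 'a set" where
  "resolvent lam T x = {w. \<exists>u \<in> T w. x = w + lam *\<^sub>R u}"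

text \<open>The residual \<open>(x - J (x - lam d)) / lam\<close> at a point \<open>x\<close>, where \<open>d\<close> is the exact value
  \<open>F x\<close> or an estimate of it, and \<open>J\<close> is the resolvent of \<open>T\<close>.  The resolvent of a maximally
  \<open>\<rho>\<close>-co-hypomonotone operator is single-valued with full domain for \<open>lam > \<rho>\<close>, so that
  \<open>the_elem\<close> selects its only value.\<close>

definition fb_residual ::
  "real \<Rightarrow> ('a::real_vector \<Rightarrow> 'a set) \<Rightarrow> 'a \<Rightarrow> 'a \<Rightarrow> 'a" where
  "fb_residual lam T d x = (1 / lam) *\<^sub>R (x - the_elem (resolvent lam T (x - lam *\<^sub>R d)))"

definition G_op ::
  "real \<Rightarrow> ('a::real_vector \<Rightarrow> 'a) \<Rightarrow> ('a \<Rightarrow> 'a set) \<Rightarrow> 'a \<Rightarrow> 'a" where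
  "G_op lam F T x = fb_residual lam T (F x) x"

text \<open>All randomness of a run: the switching coins, the mini-batch draws and the mega-batch
  draws.  \<open>Mini k j\<close> and \<open>Mega k j\<close> index the \<open>j\<close>-th draw of the batch of iteration \<open>k\<close>.
  The family is mutually independent; since its members have different codomains, this is
  expressed by independence of the events they generate, exactly as \<open>indep_vars\<close> does.
  Iteration 0 always uses a mega-batch, hence has neither a coin nor a mini-batch.\<close>

datatype draw = Coin nat | Mini nat nat | Mega nat nat

definition draw_index :: "(nat \<Rightarrow> nat) \<Rightarrow> (nat \<Rightarrow> nat) \<Rightarrow> draw set" where
  "draw_index b n =
     {Coin k | k. 1 \<le> k} \<union> {Mini k j | k j. 1 \<le> k \<and> j < b k} \<union> {Mega k j | k j. j < n k}"

primrec draw_events ::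
  "'w measure \<Rightarrow> 's measure \<Rightarrow> (nat \<Rightarrow> 'w \<Rightarrow> bool) \<Rightarrow> (nat \<Rightarrow> nat \<Rightarrow> 'w \<Rightarrow> 's) \<Rightarrow>
     (nat \<Rightarrow> nat \<Rightarrow> 'w \<Rightarrow> 's) \<Rightarrow> draw \<Rightarrow> 'w set set" where
  "draw_events M D coin mini mega (Coin k) = {coin k -` A \<inter> space M | A. A \<in> sets (count_space UNIV)}"
| "draw_events M D coin mini mega (Mini k j) = {mini k j -` A \<inter> space M | A. A \<in> sets D}"
| "draw_events M D coin mini mega (Mega k j) = {mega k j -` A \<inter> space M | A. A \<in> sets D}"

definition lsarah_sampling ::
  "'w measure \<Rightarrow> 's measure \<Rightarrow> (nat \<Rightarrow> nat) \<Rightarrow> (nat \<Rightarrow> nat) \<Rightarrow> (nat \<Rightarrow> real) \<Rightarrow>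
     (nat \<Rightarrow> 'w \<Rightarrow> bool) \<Rightarrow> (nat \<Rightarrow> nat \<Rightarrow> 'w \<Rightarrow> 's) \<Rightarrow> (nat \<Rightarrow> nat \<Rightarrow> 'w \<Rightarrow> 's) \<Rightarrow> bool" where
  "lsarah_sampling M D b n p coin mini mega \<longleftrightarrow>
     prob_space M \<and>
     (\<forall>k\<ge>1. coin k \<in> measurable M (count_space UNIV) \<and>
              measure M {\<omega> \<in> space M. coin k \<omega>} = p k) \<and>
     (\<forall>k\<ge>1. \<forall>j < b k. mini k j \<in> measurable M D \<and> distr M D (mini k j) = D) \<and>
     (\<forall>k. \<forall>j < n k. mega k j \<in> measurable M D \<and> distr M D (mega k j) = D) \<and>
     prob_space.indep_sets M (draw_events M D coin mini mega) (draw_index b n)"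

definition batch_mean :: "nat \<Rightarrow> (nat \<Rightarrow> 'a) \<Rightarrow> 'a::real_vector" where
  "batch_mean m g = (1 / real m) *\<^sub>R (\<Sum>j<m. g j)"

definition lsarah_estimator ::
  "'w measure \<Rightarrow> ('a \<Rightarrow> 's \<Rightarrow> 'a) \<Rightarrow> (nat \<Rightarrow> nat) \<Rightarrow> (nat \<Rightarrow> nat) \<Rightarrow>
     (nat \<Rightarrow> 'w \<Rightarrow> bool) \<Rightarrow> (nat \<Rightarrow> nat \<Rightarrow> 'w \<Rightarrow> 's) \<Rightarrow> (nat \<Rightarrow> nat \<Rightarrow> 'w \<Rightarrow> 's) \<Rightarrow>
     (nat \<Rightarrow> 'w \<Rightarrow> 'a) \<Rightarrow> (nat \<Rightarrow> 'w \<Rightarrow> 'a::real_vector) \<Rightarrow> bool" where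
  "lsarah_estimator M FF b n coin mini mega x Ft \<longleftrightarrow>
     (\<forall>\<omega> \<in> space M.
        Ft 0 \<omega> = batch_mean (n 0) (\<lambda>j. FF (x 0 \<omega>) (mega 0 j \<omega>)) \<and>
        (\<forall>k\<ge>1. Ft k \<omega> =
           (if coin k \<omega> then batch_mean (n k) (\<lambda>j. FF (x k \<omega>) (mega k j \<omega>))
            else Ft (k - 1) \<omega> +
              batch_mean (b k) (\<lambda>j. FF (x k \<omega>) (mini k j \<omega>) - FF (x (k - 1) \<omega>) (mini k j \<omega>)))))"

definition vfosa_plus_iteration ::
  "'w measure \<Rightarrow> real \<Rightarrow> ('a \<Rightarrow> 'a set) \<Rightarrow> (nat \<Rightarrow> real) \<Rightarrow> (nat \<Rightarrow> real) \<Rightarrow> real \<Rightarrow> 'a \<Rightarrow>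
     (nat \<Rightarrow> 'w \<Rightarrow> 'a) \<Rightarrow> (nat \<Rightarrow> 'w \<Rightarrow> 'a) \<Rightarrow> (nat \<Rightarrow> 'w \<Rightarrow> 'a::real_vector) \<Rightarrow> bool" where
  "vfosa_plus_iteration M lam T t \<eta> \<nu> x0 Ft x z \<longleftrightarrow>
     (\<forall>\<omega> \<in> space M.
        x 0 \<omega> = x0 \<and> z 0 \<omega> = x0 \<and>
        (\<forall>k. let y = ((t k - 1) / t k) *\<^sub>R x k \<omega> + (1 / t k) *\<^sub>R z k \<omega>;
                 Gt = fb_residual lam T (Ft k \<omega>) (x k \<omega>)
             in x (Suc k) \<omega> = y - \<eta> k *\<^sub>R Gt \<and>
                z (Suc k) \<omega> = z k \<omega> + \<nu> *\<^sub>R (x (Suc k) \<omega> - y)))"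

text \<open>Cost of computing \<open>x\<^sup>K\<close>, that is, of the iterations \<open>0, \<dots>, K - 1\<close>: the calls of the
  stochastic oracle, plus one resolvent evaluation per iteration.  A mini-batch step calls the
  oracle twice per draw, at the current and at the previous iterate.\<close>

definition oracle_calls ::
  "(nat \<Rightarrow> nat) \<Rightarrow> (nat \<Rightarrow> nat) \<Rightarrow> (nat \<Rightarrow> 'w \<Rightarrow> bool) \<Rightarrow> nat \<Rightarrow> 'w \<Rightarrow> nat" where
  "oracle_calls b n coin k \<omega> = (if k = 0 \<or> coin k \<omega> then n k else 2 * b k)"

definition expected_total_cost ::
  "'w measure \<Rightarrow> (nat \<Rightarrow> nat) \<Rightarrow> (nat \<Rightarrow> nat) \<Rightarrow> (nat \<Rightarrow> 'w \<Rightarrow> bool) \<Rightarrow> nat \<Rightarrow> real" where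
  "expected_total_cost M b n coin K =
     (\<integral>\<omega>. real (\<Sum>k<K. oracle_calls b n coin k \<omega> + 1) \<partial>M)"

end

theory Submission
  imports Defs
begin

text \<open>The residual \<open>G = G_op lam F T\<close> inherits from the two hypotheses on \<open>T\<close> and \<open>F\<close> a strong form of
cocoercivity (\<open>residual_cocoercive\<close>): \<open>(G x - G y) \<bullet> (x - y)\<close> dominates \<open>\<beta>bar |G x - G y|\<^sup>2\<close> plus \<open>\<Lambda>\<close>
times the mean squared increment \<open>E |FF x \<xi> - FF y \<xi>|\<^sup>2\<close> of the oracle.  The second summand is what a
variance-reduced estimator has to pay for a step, so that the geometry of the problem pays for the
estimation error.

Write \<open>v = z - x\<close> and let \<open>xs\<close> be a solution.  Along a run, the function
\<open>lyapunov\<close>, of the form \<open>\<beta> t\<^sup>2 |G x|\<^sup>2 - t (G x \<bullet> v) + \<kappa> |v|\<^sup>2 + c |z - xs|\<^sup>2\<close> up to lower order terms, decreases in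
each step except for an error term \<open>5 \<beta> / (2 \<mu>) * t (t - 1) * |err|\<^sup>2\<close>, and it
releases the gain \<open>\<Lambda> t (t - 1) * E |FF x' \<xi> - FF x \<xi>|\<^sup>2\<close> (\<open>lyapunov_step\<close>).  The summand \<open>\<kappa> |v|\<^sup>2\<close>
contracts in each step and thereby admits a factor \<open>c\<close> so large that the function stays above
\<open>2/3 \<beta> (t - \<mu>)\<^sup>2 |G x|\<^sup>2\<close> (\<open>lyapunov_lower_bound\<close>), uniformly in \<open>\<mu> < 2/3\<close>; the errors
multiplied by \<open>z - xs\<close> are absorbed because \<open>c\<close> decreases in \<open>t\<close>.

The expected squared error of the estimator obeys the recursion
\<open>\<Delta>' \<le> (1 - p) (\<Delta> + E |FF x' \<xi> - FF x \<xi>|\<^sup>2 / b) + p \<sigma>\<^sup>2 / n\<close> (\<open>error_recursion\<close>), because the draws of an iteration are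
independent of everything that happened before.  The part of \<open>p\<close> that decays like \<open>2 / k\<close> offsets the growth of the weights
\<open>t (t - 1)\<close>, the constant part \<open>\<epsilon>\<close> offsets the error term of the Lyapunov function, and with
\<open>\<Lambda> b \<epsilon> \<ge> 5 \<beta> / (2 \<mu>)\<close> the released gains pay for the increments (\<open>weighted_error_sum\<close>).  What is left of the
error is \<open>\<sigma>\<^sup>2 / n\<close> per unit of weight, which gives
\<open>E |G x|\<^sup>2 \<le> 3/2 \<Psi>0\<^sup>2 / \<tau>\<^sup>2 + 5 / (4 \<mu>\<^sup>2) * (\<sigma>\<^sup>2 / n) * \<tau>\<close> after \<open>K\<close> steps, where \<open>\<tau> = \<mu> (K + r - 1)\<close>.  Choosing
\<open>\<tau>\<close> of the order \<open>\<Psi>0 / \<epsilon>\<close> makes both terms small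
multiples of \<open>\<epsilon>\<^sup>2\<close>; the rounding of \<open>b\<close> and \<open>n\<close> costs at most a factor 2, which the constants
absorb.  Hence \<open>K = O(1/\<epsilon>)\<close>, and since the probabilities \<open>p\<close> of the first \<open>K\<close> steps sum to \<open>O(1 + ln (1/\<epsilon>))\<close>, the cost is
of the stated order.

The resolvent is single-valued on the whole space by Minty's theorem, which is proved here in finite
dimension through a convex duality argument (\<open>monotone_extension_finite\<close>) and compactness.\<close>

section \<open>The resolvent of a co-hypomonotone operator\<close>

text \<open>The condition belonging to \<open>(w, a)\<close> reads \<open>|y|\<^sup>2 - y \<bullet> (w + x - a) + (x - a) \<bullet> w \<le> 0\<close>.  The
dual of minimising the largest of these left-hand sides is to maximise \<open>c - |w + a|\<^sup>2 / 4\<close> over the convex hull of the points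
\<open>(w, x - a, (x - a) \<bullet> w)\<close>.  Monotonicity makes the dual nonpositive, and at a maximiser \<open>(W, A, C)\<close> the first order
conditions towards the vertices say that \<open>y = (W + A) / 2\<close> meets every condition.\<close>
lemma monotone_extension_finite:
  fixes P :: "('a::euclidean_space \<times> 'a) set" and x :: 'a
  assumes fin: "finite P"
    and mono: "\<And>w a w' a'. (w, a) \<in> P \<Longrightarrow> (w', a') \<in> P \<Longrightarrow> (a - a') \<bullet> (w - w') \<ge> 0"
  shows "\<exists>y. \<forall>(w, a) \<in> P. (x - y - a) \<bullet> (y - w) \<ge> 0"
proof (cases "P = {}")
  case False
  define \<tau> where "\<tau> = (\<lambda>(w::'a, a::'a). (w, x - a, (x - a) \<bullet> w))"
  define \<phi> where "\<phi> = (\<lambda>(w::'a, a::'a, c::real). c - (norm (w + a))\<^sup>2 / 4)"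
  define H where "H = convex hull (\<tau> ` P)"
  have "compact H" "H \<noteq> {}"
    unfolding H_def using fin False by (auto intro: finite_imp_compact_convex_hull)
  moreover have "continuous_on H \<phi>"
    unfolding \<phi>_def case_prod_unfold by (intro continuous_intros) auto
  ultimately obtain h where h: "h \<in> H" and hmax: "\<And>h'. h' \<in> H \<Longrightarrow> \<phi> h' \<le> \<phi> h"
    using continuous_attains_sup[of H \<phi>] by blast
  have nonpos: "\<phi> h' \<le> 0" if "h' \<in> H" for h'
  proof -
    have "h' \<in> {\<Sum>q\<in>\<tau> ` P. u q *\<^sub>R q |u. (\<forall>q\<in>\<tau> ` P. 0 \<le> u q) \<and> sum u (\<tau> ` P) = 1}"
      using that unfolding H_def convex_hull_finite[OF finite_imageI[OF fin]] by blast
    then obtain u where u: "\<And>q. q \<in> \<tau> ` P \<Longrightarrow> 0 \<le> u q" "sum u (\<tau> ` P) = 1"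
      and h': "(\<Sum>q\<in>\<tau> ` P. u q *\<^sub>R q) = h'" by blast
    let ?Q = "\<tau> ` P"
    let ?w = "\<lambda>q::'a \<times> 'a \<times> real. fst q" and ?a = "\<lambda>q::'a \<times> 'a \<times> real. fst (snd q)"
    define W A C where "W = (\<Sum>q\<in>?Q. u q *\<^sub>R ?w q)" and "A = (\<Sum>q\<in>?Q. u q *\<^sub>R ?a q)"
      and "C = (\<Sum>q\<in>?Q. u q * (?a q \<bullet> ?w q))"
    have snd: "snd (snd q) = ?a q \<bullet> ?w q" if "q \<in> ?Q" for q
      using that by (auto simp: \<tau>_def)
    have "fst h' = W" unfolding h'[symmetric] W_def by (simp add: fst_sum)
    moreover have "fst (snd h') = A" unfolding h'[symmetric] A_def by (simp add: fst_sum snd_sum)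
    moreover have "snd (snd h') = C"
      unfolding h'[symmetric] C_def snd_sum snd_scaleR by (rule sum.cong) (simp_all add: snd)
    ultimately have eq: "h' = (W, A, C)" by (simp add: prod_eq_iff)
    have "(\<Sum>q\<in>?Q. \<Sum>q'\<in>?Q. u q * u q' * ((?a q - ?a q') \<bullet> (?w q - ?w q'))) \<le> 0"
    proof (intro sum_nonpos mult_nonneg_nonpos mult_nonneg_nonneg u)
      fix q q' assume "q \<in> ?Q" "q' \<in> ?Q"
      then obtain w1 a1 w2 a2 where P: "(w1, a1) \<in> P" "(w2, a2) \<in> P"
        and q: "q = \<tau> (w1, a1)" "q' = \<tau> (w2, a2)" by auto
      from mono[OF P] show "(?a q - ?a q') \<bullet> (?w q - ?w q') \<le> 0"
        unfolding q \<tau>_def by (simp add: inner_diff_left inner_diff_right)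
    qed
    also have "(\<Sum>q\<in>?Q. \<Sum>q'\<in>?Q. u q * u q' * ((?a q - ?a q') \<bullet> (?w q - ?w q')))
        = 2 * C - 2 * (A \<bullet> W)"
    proof -
      have 1: "(\<Sum>q\<in>?Q. \<Sum>q'\<in>?Q. u q * u q' * (?a q \<bullet> ?w q)) = C"
        unfolding C_def by (simp add: sum_distrib_left[symmetric] sum_distrib_right[symmetric]
          mult.assoc mult.commute[of "u _" "_ \<bullet> _"] mult.left_commute u)
      have 2: "(\<Sum>q\<in>?Q. \<Sum>q'\<in>?Q. u q * u q' * (?a q' \<bullet> ?w q')) = C"
        by (subst sum.swap) (use 1 in \<open>simp add: mult.commute\<close>)
      have 3: "(\<Sum>q\<in>?Q. \<Sum>q'\<in>?Q. u q * u q' * (?a q \<bullet> ?w q')) = A \<bullet> W"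
        unfolding A_def inner_sum_left unfolding W_def inner_sum_right
        by (simp add: mult_ac)
      have 4: "(\<Sum>q\<in>?Q. \<Sum>q'\<in>?Q. u q * u q' * (?a q' \<bullet> ?w q)) = A \<bullet> W"
        by (subst sum.swap) (use 3 in \<open>simp add: mult.commute\<close>)
      show ?thesis using 1 2 3 4
        by (simp add: inner_diff_left inner_diff_right right_diff_distrib distrib_left
            sum_subtractf sum.distrib)
    qed
    finally have "C \<le> A \<bullet> W" by simp
    also have "\<dots> \<le> (norm (W + A))\<^sup>2 / 4"
    proof -
      have "0 \<le> (norm (W - A))\<^sup>2" by simp
      then show ?thesis by (simp add: power2_norm_eq_inner algebra_simps inner_commute)
    qed
    finally show ?thesis by (simp add: eq \<phi>_def)
  qed
  obtain W A C where hW: "h = (W, A, C)" by (cases h) auto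
  define y where "y = (1/2) *\<^sub>R (W + A)"
  have "(x - y - a) \<bullet> (y - w) \<ge> 0" if wa: "(w, a) \<in> P" for w a
  proof -
    define \<alpha> where "\<alpha> = x - a"
    define d where "d = \<alpha> \<bullet> w - C - y \<bullet> (w + \<alpha> - 2 *\<^sub>R y)"
    have tauH: "(w, \<alpha>, \<alpha> \<bullet> w) \<in> H"
    proof -
      have "(w, \<alpha>, \<alpha> \<bullet> w) = \<tau> (w, a)" by (simp add: \<tau>_def \<alpha>_def)
      then show ?thesis unfolding H_def using wa by (metis hull_inc imageI)
    qed
    have quad: "s * d \<le> s\<^sup>2 * ((norm (w + \<alpha> - 2 *\<^sub>R y))\<^sup>2 / 4)" if s: "0 \<le> s" "s \<le> 1" for s
    proof -
      have "(1 - s) *\<^sub>R h + s *\<^sub>R (w, \<alpha>, \<alpha> \<bullet> w) \<in> H"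
        using h tauH s unfolding H_def by (intro convexD_alt convex_convex_hull)
      from hmax[OF this] have "(1 - s) * C + s * (\<alpha> \<bullet> w)
          - (norm ((1 - s) *\<^sub>R W + s *\<^sub>R w + ((1 - s) *\<^sub>R A + s *\<^sub>R \<alpha>)))\<^sup>2 / 4
          \<le> C - (norm (W + A))\<^sup>2 / 4"
        by (simp add: hW \<phi>_def)
      moreover have "(1 - s) *\<^sub>R W + s *\<^sub>R w + ((1 - s) *\<^sub>R A + s *\<^sub>R \<alpha>)
          = 2 *\<^sub>R y + s *\<^sub>R (w + \<alpha> - 2 *\<^sub>R y)"
        by (simp add: y_def algebra_simps)
      moreover have "W + A = 2 *\<^sub>R y" by (simp add: y_def)
      moreover have "(norm (2 *\<^sub>R y + s *\<^sub>R (w + \<alpha> - 2 *\<^sub>R y)))\<^sup>2 = (norm (2 *\<^sub>R y))\<^sup>2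
          + 4 * s * (y \<bullet> (w + \<alpha> - 2 *\<^sub>R y)) + s\<^sup>2 * (norm (w + \<alpha> - 2 *\<^sub>R y))\<^sup>2"
      proof -
        have "(norm (p + s *\<^sub>R v))\<^sup>2 = (norm p)\<^sup>2 + 2 * s * (p \<bullet> v) + s\<^sup>2 * (norm v)\<^sup>2" for p v :: 'a
          unfolding power2_norm_eq_inner
          by (simp add: inner_add_left inner_add_right inner_commute power2_eq_square)
        from this[of "2 *\<^sub>R y" "w + \<alpha> - 2 *\<^sub>R y"] show ?thesis by simp
      qed
      ultimately have "(1 - s) * C + s * (\<alpha> \<bullet> w) - ((norm (2 *\<^sub>R y))\<^sup>2
          + 4 * s * (y \<bullet> (w + \<alpha> - 2 *\<^sub>R y)) + s\<^sup>2 * (norm (w + \<alpha> - 2 *\<^sub>R y))\<^sup>2) / 4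
          \<le> C - (norm (2 *\<^sub>R y))\<^sup>2 / 4" by (simp only:)
      then have 1: "(C - s * C) + s * (\<alpha> \<bullet> w) - ((norm (2 *\<^sub>R y))\<^sup>2
          + 4 * (s * (y \<bullet> (w + \<alpha> - 2 *\<^sub>R y))) + s\<^sup>2 * (norm (w + \<alpha> - 2 *\<^sub>R y))\<^sup>2) / 4
          \<le> C - (norm (2 *\<^sub>R y))\<^sup>2 / 4"
        by (simp only: mult.assoc left_diff_distrib mult_1_left)
      have "e - m - k \<le> q / 4" if "(c - k) + e - (M + 4 * m + q) / 4 \<le> c - M / 4"
        for e m k q c M :: real using that by (simp add: field_simps)
      from this[OF 1] have "s * (\<alpha> \<bullet> w) - s * (y \<bullet> (w + \<alpha> - 2 *\<^sub>R y)) - s * C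
          \<le> s\<^sup>2 * (norm (w + \<alpha> - 2 *\<^sub>R y))\<^sup>2 / 4" .
      moreover have "s * d = s * (\<alpha> \<bullet> w) - s * (y \<bullet> (w + \<alpha> - 2 *\<^sub>R y)) - s * C"
        unfolding d_def right_diff_distrib by simp
      ultimately show ?thesis by (simp only: times_divide_eq_right)
    qed
    have "d \<le> 0"
    proof (rule ccontr)
      assume "\<not> d \<le> 0"
      then have d: "d > 0" by simp
      define N where "N = (norm (w + \<alpha> - 2 *\<^sub>R y))\<^sup>2 / 4"
      have N: "N \<ge> 0" by (simp add: N_def)
      \<comment> \<open>a step length below \<open>d / N\<close>, so that the linear gain beats the quadratic loss\<close>
      define s where "s = d / (d + N + d)"
      have s: "0 < s" "s \<le> 1" using d N by (auto simp: s_def field_simps)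
      from quad[of s] s have "s * d \<le> s * (s * N)" by (simp add: N_def power2_eq_square mult.assoc)
      then have "d \<le> s * N" using s by simp
      also have "\<dots> \<le> d * N / (d + N + d)" by (simp add: s_def)
      also have "\<dots> < d" using d N by (simp add: field_simps)
      finally show False by simp
    qed
    moreover have "C - y \<bullet> y \<le> 0"
      using nonpos[OF h] by (simp add: hW \<phi>_def y_def power2_norm_eq_inner[symmetric] power_mult_distrib)
        (simp add: power2_norm_eq_inner field_simps)
    ultimately show ?thesis
      unfolding d_def \<alpha>_def
      by (simp add: inner_diff_left inner_diff_right inner_add_left inner_add_right inner_commute
          algebra_simps)
  qed
  then show ?thesis by auto
qed auto


text \<open>Each condition describes a closed ball of points \<open>y\<close>, so compactness passes from finitely many pairs
to all of them.\<close>
lemma monotone_extension: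
  fixes P :: "('a::euclidean_space \<times> 'a) set" and x :: 'a
  assumes mono: "\<And>w a w' a'. (w, a) \<in> P \<Longrightarrow> (w', a') \<in> P \<Longrightarrow> (a - a') \<bullet> (w - w') \<ge> 0"
  shows "\<exists>y. \<forall>(w, a) \<in> P. (x - y - a) \<bullet> (y - w) \<ge> 0"
proof (cases "P = {}")
  case False
  define B where "B = (\<lambda>(w::'a, a::'a). {y. (x - y - a) \<bullet> (y - w) \<ge> 0})"
  from False obtain q where q: "q \<in> P" by blast
  obtain w0 a0 where q_eq: "q = (w0, a0)" by (cases q)
  have cl: "closed (B r)" for r
    unfolding B_def case_prod_unfold by (intro closed_Collect_le continuous_intros)
  have "B q \<subseteq> cball w0 (norm (x - a0 - w0))"
  proof
    fix y assume "y \<in> B q"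
    then have "0 \<le> (x - a0 - w0 - (y - w0)) \<bullet> (y - w0)"
      by (simp add: B_def q_eq algebra_simps)
    then have "norm (y - w0) * norm (y - w0) \<le> (x - a0 - w0) \<bullet> (y - w0)"
      by (simp only: inner_diff_left[of "x - a0 - w0"]) (simp add: power2_norm_eq_inner[symmetric] power2_eq_square)
    also have "\<dots> \<le> norm (x - a0 - w0) * norm (y - w0)" by (rule norm_cauchy_schwarz)
    finally have "norm (y - w0) \<le> norm (x - a0 - w0)"
      by (cases "norm (y - w0) = 0") (auto simp: mult_right_le_imp_le)
    then show "y \<in> cball w0 (norm (x - a0 - w0))" by (simp add: dist_norm norm_minus_commute)
  qed
  then have "compact (B q)"
    using cl bounded_subset[OF bounded_cball] by (auto simp: compact_eq_bounded_closed)
  then have "B q \<inter> (\<Inter>r\<in>P. B r) \<noteq> {}"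
  proof (rule compact_imp_fip_image)
    fix I' assume I': "finite I'" "I' \<subseteq> P"
    have "\<exists>y. \<forall>(w, a) \<in> insert q I'. (x - y - a) \<bullet> (y - w) \<ge> 0"
    proof (rule monotone_extension_finite)
      fix w a w' a' assume "(w, a) \<in> insert q I'" "(w', a') \<in> insert q I'"
      then have "(w, a) \<in> P" "(w', a') \<in> P" using q I' by auto
      then show "(a - a') \<bullet> (w - w') \<ge> 0" by (rule mono)
    qed (use I' in simp)
    then obtain y where y: "\<forall>(w, a) \<in> insert q I'. (x - y - a) \<bullet> (y - w) \<ge> 0" ..
    have "y \<in> B r" if "r \<in> insert q I'" for r
      using bspec[OF y that] by (simp add: B_def case_prod_unfold)
    then have "y \<in> B q \<inter> (\<Inter>r\<in>I'. B r)" by simp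
    then show "B q \<inter> (\<Inter>r\<in>I'. B r) \<noteq> {}" by blast
  qed (rule cl)
  then obtain y where "\<And>r. r \<in> P \<Longrightarrow> y \<in> B r" by blast
  then have "\<forall>r\<in>P. case r of (w, a) \<Rightarrow> (x - y - a) \<bullet> (y - w) \<ge> 0"
    by (simp add: B_def case_prod_unfold)
  then show ?thesis by blast
qed auto

text \<open>Minty's theorem.  Co-hypomonotonicity says that \<open>T\<inverse> + \<rho> I\<close> is monotone: the pairs
\<open>(w + \<rho> u, (lam - \<rho>) u)\<close> form a monotone set.  A point that extends this set at \<open>x\<close> yields a pair that can be
added to the graph of \<open>T\<close>, hence lies in it already by maximality, and its first component solves the resolvent equation at \<open>x\<close>.\<close>
lemma resolvent_nonempty:
  fixes T :: "'a::euclidean_space \<Rightarrow> 'a set"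
  assumes T: "maximally_cohypomonotone \<rho> T" and lam: "\<rho> < lam"
  shows "\<exists>w. w \<in> resolvent lam T x"
proof -
  define \<theta> where "\<theta> = lam - \<rho>"
  have \<theta>: "\<theta> > 0" using lam by (simp add: \<theta>_def)
  from T have co: "cohypomonotone \<rho> T" by (simp add: maximally_cohypomonotone_def)
  have co': "(u - v) \<bullet> (w - w') \<ge> - \<rho> * (norm (u - v))\<^sup>2" if "u \<in> T w" "v \<in> T w'" for u v w w'
    using co that unfolding cohypomonotone_def op_graph_def by fastforce
  define P where "P = {(w + \<rho> *\<^sub>R u, \<theta> *\<^sub>R u) | w u. u \<in> T w}"
  have "\<exists>y. \<forall>(w, a) \<in> P. (x - y - a) \<bullet> (y - w) \<ge> 0"
  proof (rule monotone_extension)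
    fix w a w' a' assume "(w, a) \<in> P" "(w', a') \<in> P"
    then obtain v u v' u' where u: "u \<in> T v" "u' \<in> T v'"
      and eq: "w = v + \<rho> *\<^sub>R u" "a = \<theta> *\<^sub>R u" "w' = v' + \<rho> *\<^sub>R u'" "a' = \<theta> *\<^sub>R u'"
      unfolding P_def by blast
    have "(a - a') \<bullet> (w - w') = \<theta> * ((u - u') \<bullet> (v - v') + \<rho> * (norm (u - u'))\<^sup>2)"
      unfolding eq power2_norm_eq_inner by (simp add: algebra_simps)
    with co'[OF u] \<theta> show "(a - a') \<bullet> (w - w') \<ge> 0" by simp
  qed
  then obtain y where y: "\<And>w a. (w, a) \<in> P \<Longrightarrow> (x - y - a) \<bullet> (y - w) \<ge> 0" by fast
  define u where "u = (1 / \<theta>) *\<^sub>R (x - y)"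
  define w where "w = y - \<rho> *\<^sub>R u"
  have xy: "x - y = \<theta> *\<^sub>R u" using \<theta> by (simp add: u_def)
  have new: "(u - v) \<bullet> (w - w') \<ge> - \<rho> * (norm (u - v))\<^sup>2" if v: "v \<in> T w'" for v w'
  proof -
    have "(w' + \<rho> *\<^sub>R v, \<theta> *\<^sub>R v) \<in> P" using v by (auto simp: P_def)
    from y[OF this] have "0 \<le> \<theta> * ((u - v) \<bullet> (w - w') + \<rho> * (norm (u - v))\<^sup>2)"
      unfolding xy w_def power2_norm_eq_inner by (simp add: algebra_simps)
    then show ?thesis using \<theta> by (simp add: zero_le_mult_iff)
  qed
  define S where "S = T(w := insert u (T w))"
  have "cohypomonotone \<rho> S"
    unfolding cohypomonotone_def op_graph_def
  proof safe
    fix w1 u1 w2 u2 assume 1: "u1 \<in> S w1" and 2: "u2 \<in> S w2"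
    from 1 have d1: "w1 = w \<and> u1 = u \<or> u1 \<in> T w1" by (auto simp: S_def split: if_splits)
    from 2 have d2: "w2 = w \<and> u2 = u \<or> u2 \<in> T w2" by (auto simp: S_def split: if_splits)
    have sym: "(u2 - u1) \<bullet> (w2 - w1) = (u1 - u2) \<bullet> (w1 - w2)" "norm (u2 - u1) = norm (u1 - u2)"
      by (simp_all add: algebra_simps norm_minus_commute)
    show "- \<rho> * (norm (u1 - u2))\<^sup>2 \<le> (u1 - u2) \<bullet> (w1 - w2)"
      using d1 d2 co'[of u1 w1 u2 w2] new[of u2 w2] new[of u1 w1] sym by auto
  qed
  moreover have "op_graph T \<subseteq> op_graph S" by (auto simp: op_graph_def S_def)
  ultimately have "op_graph T = op_graph S"
    using T unfolding maximally_cohypomonotone_def by blast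
  moreover have "(w, u) \<in> op_graph S" by (simp add: op_graph_def S_def)
  ultimately have "(w, u) \<in> op_graph T" by simp
  then have "u \<in> T w" by (simp add: op_graph_def)
  moreover have "x = w + lam *\<^sub>R u"
  proof -
    have "x = y + \<theta> *\<^sub>R u" using xy by (metis add.commute diff_add_cancel)
    then show ?thesis by (simp add: w_def \<theta>_def algebra_simps)
  qed
  ultimately show ?thesis by (auto simp: resolvent_def)
qed

text \<open>With \<open>d\<close> the difference of the two elements of \<open>T\<close>, expanding \<open>|x - x'|\<^sup>2\<close> leaves the excess
\<open>lam (lam - 2 \<rho>) |d|\<^sup>2\<close> over \<open>|w - w'|\<^sup>2\<close>; this is where \<open>lam \<ge> 2 \<rho>\<close> enters.\<close>
lemma resolvent_nonexpansive:
  fixes T :: "'a::real_inner \<Rightarrow> 'a set"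
  assumes T: "cohypomonotone \<rho> T" and lam: "0 < lam" "2 * \<rho> \<le> lam"
    and w: "w \<in> resolvent lam T x" "w' \<in> resolvent lam T x'"
  shows "norm (w - w') \<le> norm (x - x')"
proof -
  from w obtain u u' where u: "u \<in> T w" "u' \<in> T w'" and x: "x = w + lam *\<^sub>R u" "x' = w' + lam *\<^sub>R u'"
    by (auto simp: resolvent_def)
  have co: "(u - u') \<bullet> (w - w') \<ge> - \<rho> * (norm (u - u'))\<^sup>2"
    using T u unfolding cohypomonotone_def op_graph_def by fastforce
  have "(norm (x - x'))\<^sup>2 = (norm (w - w'))\<^sup>2 + 2 * lam * ((u - u') \<bullet> (w - w'))
      + lam\<^sup>2 * (norm (u - u'))\<^sup>2"
    unfolding x power2_norm_eq_inner by (simp add: algebra_simps inner_commute power2_eq_square)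
  moreover have "2 * lam * ((u - u') \<bullet> (w - w')) \<ge> 2 * lam * (- \<rho> * (norm (u - u'))\<^sup>2)"
    using co lam by (intro mult_left_mono) auto
  moreover have "lam * (lam - 2 * \<rho>) * (norm (u - u'))\<^sup>2 \<ge> 0"
    using lam by simp
  ultimately have "(norm (w - w'))\<^sup>2 \<le> (norm (x - x'))\<^sup>2"
    by (simp add: algebra_simps power2_eq_square)
  then show ?thesis by (rule power2_le_imp_le) simp
qed

locale resolvent_setting =
  fixes \<rho> lam :: real and T :: "'a::euclidean_space \<Rightarrow> 'a set"
  assumes max_cohypo: "maximally_cohypomonotone \<rho> T"
    and rho_nonneg: "0 \<le> \<rho>" and lam_pos: "0 < lam" and two_rho_le: "2 * \<rho> \<le> lam"
begin

definition J :: "'a \<Rightarrow> 'a" where "J x = the_elem (resolvent lam T x)"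

lemma cohypo: "cohypomonotone \<rho> T"
  using max_cohypo by (simp add: maximally_cohypomonotone_def)

lemma cohypoD:
  assumes "u \<in> T x" "v \<in> T y" shows "(u - v) \<bullet> (x - y) \<ge> - \<rho> * (norm (u - v))\<^sup>2"
proof -
  have "(x, u) \<in> op_graph T" "(y, v) \<in> op_graph T" using assms by (simp_all add: op_graph_def)
  then show ?thesis using cohypo unfolding cohypomonotone_def by blast
qed

lemma resolvent_unique:
  assumes "w \<in> resolvent lam T x" shows "J x = w"
proof -
  have "resolvent lam T x = {w}"
    using resolvent_nonexpansive[OF cohypo lam_pos two_rho_le assms, of _ x] assms by fastforce
  then show ?thesis by (simp add: J_def)
qed

lemma J_in: "J x \<in> resolvent lam T x"
proof -
  have "\<rho> < lam" using rho_nonneg lam_pos two_rho_le by linarith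
  from resolvent_nonempty[OF max_cohypo this] obtain w where "w \<in> resolvent lam T x" by blast
  then show ?thesis using resolvent_unique by metis
qed

lemma J_nonexpansive: "norm (J x - J y) \<le> norm (x - y)"
  by (rule resolvent_nonexpansive[OF cohypo lam_pos two_rho_le J_in J_in])

lemma fb_residual_J: "fb_residual lam T d x = (1 / lam) *\<^sub>R (x - J (x - lam *\<^sub>R d))"
  by (simp add: fb_residual_def J_def)

lemma residual_in_T: "fb_residual lam T d x - d \<in> T (J (x - lam *\<^sub>R d))"
proof -
  obtain u where u: "u \<in> T (J (x - lam *\<^sub>R d))" and eq: "x - lam *\<^sub>R d = J (x - lam *\<^sub>R d) + lam *\<^sub>R u"
    using J_in[of "x - lam *\<^sub>R d"] by (auto simp: resolvent_def)
  have "x - J (x - lam *\<^sub>R d) = lam *\<^sub>R (u + d)" using eq by (simp add: algebra_simps)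
  then have "fb_residual lam T d x = u + d" using lam_pos by (simp add: fb_residual_J)
  then show ?thesis using u by simp
qed

text \<open>The residual grows at most linearly, which keeps the iterates square integrable; for equal points, its error is
at most the error of the estimator.\<close>
lemma residual_lipschitz:
  "norm (fb_residual lam T d x - fb_residual lam T d' x') \<le> (2 / lam) * norm (x - x') + norm (d - d')"
proof -
  have "norm (fb_residual lam T d x - fb_residual lam T d' x')
     = (1 / lam) * norm ((x - x') - (J (x - lam *\<^sub>R d) - J (x' - lam *\<^sub>R d')))"
    unfolding fb_residual_J scaleR_diff_right[symmetric] norm_scaleR
    using lam_pos by (simp add: algebra_simps)
  also have "\<dots> \<le> (1 / lam) * (norm (x - x') + norm (J (x - lam *\<^sub>R d) - J (x' - lam *\<^sub>R d')))"
    using lam_pos by (intro mult_left_mono norm_triangle_ineq4) auto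
  also have "\<dots> \<le> (1 / lam) * (norm (x - x') + norm ((x - lam *\<^sub>R d) - (x' - lam *\<^sub>R d')))"
    using lam_pos by (intro mult_left_mono add_left_mono J_nonexpansive) auto
  also have "\<dots> \<le> (1 / lam) * (norm (x - x') + (norm (x - x') + lam * norm (d - d')))"
  proof -
    have eq: "(x - lam *\<^sub>R d) - (x' - lam *\<^sub>R d') = (x - x') - lam *\<^sub>R (d - d')"
      by (simp add: algebra_simps)
    have "norm ((x - lam *\<^sub>R d) - (x' - lam *\<^sub>R d')) \<le> norm (x - x') + lam * norm (d - d')"
      unfolding eq using norm_triangle_ineq4[of "x - x'" "lam *\<^sub>R (d - d')"] lam_pos by simp
    then show ?thesis using lam_pos by (intro mult_left_mono add_left_mono) auto
  qed
  also have "\<dots> = (2 / lam) * norm (x - x') + norm (d - d')"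
    using lam_pos by (simp add: field_simps)
  finally show ?thesis .
qed

lemma residual_estimate: "norm (fb_residual lam T d x - fb_residual lam T d' x) \<le> norm (d - d')"
  using residual_lipschitz[of d x d' x] by simp

lemma continuous_residual: "continuous_on UNIV (\<lambda>(d, x). fb_residual lam T d x)"
proof -
  have "1-lipschitz_on UNIV J"
    by (rule lipschitz_onI) (auto simp: dist_norm J_nonexpansive)
  then have J: "continuous_on UNIV J" by (rule lipschitz_on_continuous_on)
  show ?thesis unfolding case_prod_unfold fb_residual_J
    by (intro continuous_intros continuous_on_compose2[OF J]) auto
qed

lemma residual_zero:
  assumes "xs \<in> zer (op_plus F T)" shows "G_op lam F T xs = 0"
proof -
  from assms obtain u where "u \<in> T xs" "F xs + u = 0" by (auto simp: zer_def op_plus_def)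
  then have "- F xs \<in> T xs" by (metis add.inverse_unique)
  then have "xs \<in> resolvent lam T (xs - lam *\<^sub>R F xs)"
    unfolding resolvent_def by (auto intro!: bexI[of _ "- F xs"])
  from resolvent_unique[OF this] show ?thesis by (simp add: G_op_def fb_residual_J)
qed

text \<open>The residual minus \<open>F\<close> is an element of \<open>T\<close> at the resolvent point, so co-hypomonotonicity bounds
\<open>(g - f) \<bullet> (d - lam g)\<close> from below, where \<open>g\<close>, \<open>f\<close>, \<open>d\<close> are the differences of \<open>G\<close>, \<open>F\<close> and the points.  The cocoercivity modulus
\<open>1 / L\<close> is split as \<open>1 / Lh + \<Lambda>\<close>: the first part completes the square in \<open>f\<close>, which produces the factor of
\<open>|g|\<^sup>2\<close>, and the second part is kept as a multiple of \<open>V\<close>.\<close>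
lemma residual_cocoercive:
  assumes L: "0 < L" "L < Lh" "\<rho> * Lh < 1"
    and coco: "V / L \<le> (F x - F y) \<bullet> (x - y)" and V: "(norm (F x - F y))\<^sup>2 \<le> V"
  shows "(lam * (4 - Lh * lam) - 4 * \<rho>) / (4 * (1 - \<rho> * Lh)) * (norm (G_op lam F T x - G_op lam F T y))\<^sup>2
      + (Lh - L) / (L * Lh) * V
    \<le> (G_op lam F T x - G_op lam F T y) \<bullet> (x - y)"
proof -
  define g f d where "g = G_op lam F T x - G_op lam F T y" and "f = F x - F y" and "d = x - y"
  have Jx: "J (x - lam *\<^sub>R F x) = x - lam *\<^sub>R G_op lam F T x" for x
    using lam_pos by (simp add: G_op_def fb_residual_J)
  have "(g - f) \<bullet> (d - lam *\<^sub>R g) \<ge> - \<rho> * (norm (g - f))\<^sup>2"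
  proof -
    have "((G_op lam F T x - F x) - (G_op lam F T y - F y)) \<bullet> (J (x - lam *\<^sub>R F x) - J (y - lam *\<^sub>R F y))
        \<ge> - \<rho> * (norm ((G_op lam F T x - F x) - (G_op lam F T y - F y)))\<^sup>2"
      unfolding G_op_def by (rule cohypoD[OF residual_in_T residual_in_T])
    moreover have "J (x - lam *\<^sub>R F x) - J (y - lam *\<^sub>R F y) = d - lam *\<^sub>R g"
      unfolding Jx by (simp add: d_def g_def algebra_simps)
    moreover have "(G_op lam F T x - F x) - (G_op lam F T y - F y) = g - f"
      by (simp add: g_def f_def)
    ultimately show ?thesis by simp
  qed
  then have 1: "g \<bullet> d \<ge> f \<bullet> d + (lam - \<rho>) * (norm g)\<^sup>2 - (lam - 2 * \<rho>) * (f \<bullet> g) - \<rho> * (norm f)\<^sup>2"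
    unfolding power2_norm_eq_inner by (simp add: algebra_simps inner_commute)
  have Vdec: "V / L = V / Lh + (Lh - L) / (L * Lh) * V"
    using L by (simp add: field_simps)
  have "(norm f)\<^sup>2 / Lh \<le> V / Lh" using V L unfolding f_def by (intro divide_right_mono) auto
  with coco Vdec have 2: "f \<bullet> d \<ge> (norm f)\<^sup>2 / Lh + (Lh - L) / (L * Lh) * V"
    unfolding f_def d_def by linarith
  define a where "a = 1 / Lh - \<rho>"
  have a: "a > 0" using L by (simp add: a_def field_simps)
  have "0 \<le> a * (norm (f - ((lam - 2 * \<rho>) / (2 * a)) *\<^sub>R g))\<^sup>2" using a by simp
  also have "\<dots> = a * (norm f)\<^sup>2 - (lam - 2 * \<rho>) * (f \<bullet> g) + (lam - 2 * \<rho>)\<^sup>2 / (4 * a) * (norm g)\<^sup>2"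
    unfolding power2_norm_eq_inner using a
    by (simp add: inner_diff_left inner_diff_right inner_commute field_simps power2_eq_square)
  finally have 3: "a * (norm f)\<^sup>2 - (lam - 2 * \<rho>) * (f \<bullet> g) \<ge> - ((lam - 2 * \<rho>)\<^sup>2 / (4 * a)) * (norm g)\<^sup>2"
    by simp
  have a_eq: "a = (1 - \<rho> * Lh) / Lh" using L by (simp add: a_def field_simps)
  have 4: "(lam - \<rho>) - (lam - 2 * \<rho>)\<^sup>2 / (4 * a) = (lam * (4 - Lh * lam) - 4 * \<rho>) / (4 * (1 - \<rho> * Lh))"
  proof -
    define D where "D = 1 - \<rho> * Lh"
    have D: "D > 0" using L by (simp add: D_def)
    have "(lam - 2 * \<rho>)\<^sup>2 / (4 * a) = Lh * (lam - 2 * \<rho>)\<^sup>2 / (4 * D)"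
      unfolding a_eq D_def[symmetric] using L by simp
    then have "(lam - \<rho>) - (lam - 2 * \<rho>)\<^sup>2 / (4 * a)
        = ((lam - \<rho>) * (4 * D) - Lh * (lam - 2 * \<rho>)\<^sup>2) / (4 * D)"
      using D by (simp add: diff_divide_distrib)
    also have "(lam - \<rho>) * (4 * D) - Lh * (lam - 2 * \<rho>)\<^sup>2 = lam * (4 - Lh * lam) - 4 * \<rho>"
      unfolding D_def by (simp add: power2_eq_square algebra_simps)
    finally show ?thesis unfolding D_def .
  qed
  have "g \<bullet> d \<ge> (Lh - L) / (L * Lh) * V + ((lam - \<rho>) - (lam - 2 * \<rho>)\<^sup>2 / (4 * a)) * (norm g)\<^sup>2"
  proof -
    have "a * (norm f)\<^sup>2 = (norm f)\<^sup>2 / Lh - \<rho> * (norm f)\<^sup>2" by (simp add: a_def algebra_simps)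
    moreover have "((lam - \<rho>) - (lam - 2 * \<rho>)\<^sup>2 / (4 * a)) * (norm g)\<^sup>2
        = (lam - \<rho>) * (norm g)\<^sup>2 - ((lam - 2 * \<rho>)\<^sup>2 / (4 * a)) * (norm g)\<^sup>2"
      by (rule left_diff_distrib)
    ultimately show ?thesis using 1 2 3 by linarith
  qed
  then show ?thesis unfolding 4 g_def d_def by simp
qed

end

section \<open>A Lyapunov function for the accelerated iteration\<close>

lemma young_inner:
  fixes x y :: "'a::real_inner"
  assumes "a > 0"
  shows "s * (x \<bullet> y) \<le> a * (norm x)\<^sup>2 + s\<^sup>2 / (4 * a) * (norm y)\<^sup>2"
proof -
  have "0 \<le> a * (norm (x - (s / (2 * a)) *\<^sub>R y))\<^sup>2" using assms by simp
  also have "\<dots> = a * (norm x)\<^sup>2 - s * (x \<bullet> y) + s\<^sup>2 / (4 * a) * (norm y)\<^sup>2"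
    unfolding power2_norm_eq_inner using assms
    by (simp add: inner_diff_left inner_diff_right inner_commute field_simps power2_eq_square)
  finally show ?thesis by simp
qed

lemma norm_scaled_add_squared:
  fixes v g w :: "'a::real_inner"
  shows "(norm (a *\<^sub>R v + e *\<^sub>R (g + w)))\<^sup>2
    = a\<^sup>2 * (norm v)\<^sup>2 + 2 * (a * e) * (g \<bullet> v + v \<bullet> w) + e\<^sup>2 * ((norm g)\<^sup>2 + 2 * (g \<bullet> w) + (norm w)\<^sup>2)"
  unfolding power2_norm_eq_inner
  by (simp add: inner_add_left inner_add_right inner_commute power2_eq_square algebra_simps)

text \<open>Here \<open>\<nu> = \<mu> / 2\<close>, so that \<open>t - 2 \<nu>\<close> is the value of \<open>t\<close> one step earlier; \<open>g\<close> is the residual, \<open>v = z - x\<close> and \<open>Z = z - xs\<close>.  With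
\<open>\<eta> = 2 \<beta> (t - 1) / (t - \<nu>)\<close>, the last coefficient is \<open>c = 1 / (2 \<nu> \<eta>)\<close> and that of
\<open>|v|\<^sup>2\<close> is \<open>\<kappa> = \<nu> / ((1 - \<nu>) (1 - 1/t) \<eta>)\<close>.  With these two values, the products \<open>g \<bullet> v\<close> and \<open>g \<bullet> Z\<close> that
arise in a step combine to the change of \<open>- (t - 2 \<nu>) (g \<bullet> v)\<close> and the single product
\<open>- g \<bullet> (Z - v) = - g \<bullet> (x - xs)\<close>, which cocoercivity makes nonpositive.  Both coefficients decrease in \<open>t\<close>.\<close>
definition lyapunov :: "real \<Rightarrow> real \<Rightarrow> real \<Rightarrow> 'a::real_inner \<Rightarrow> 'a \<Rightarrow> 'a \<Rightarrow> real" where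
  "lyapunov \<beta> \<nu> t g v Z =
     \<beta> * (t - 2 * \<nu>) * (t - 2 * \<nu> - 1) * (norm g)\<^sup>2 - (t - 2 * \<nu>) * (g \<bullet> v)
     + \<nu> * t * (t - \<nu>) / (2 * \<beta> * (1 - \<nu>) * (t - 1)\<^sup>2) * (norm v)\<^sup>2
     + (t - \<nu>) / (4 * \<beta> * \<nu> * (t - 1)) * (norm Z)\<^sup>2"

text \<open>The left-hand side collects the factors of \<open>|g|\<^sup>2\<close> in one step.  It is \<open>- \<beta> (2 - 6 \<nu>) t\<close> plus bounded terms, so
\<open>3 \<nu> < 1\<close> makes it negative; the remaining \<open>- \<beta>\<close> later absorbs the product of \<open>g\<close> with the estimation error.\<close>
lemma lyapunov_gradient_coefficient:
  fixes t \<nu> \<beta> bb \<eta> :: real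
  assumes \<nu>: "0 < \<nu>" "3 * \<nu> < 1" and t: "t \<ge> 1 + 6 * \<nu>" and \<beta>: "0 < \<beta>" "\<beta> * (1 + \<nu>) \<le> bb * (1 - \<nu>)"
    and \<eta>: "\<eta> * (t - \<nu>) = 2 * \<beta> * (t - 1)"
  shows "- \<beta> * (t * (t - 1)) + t * (t - 1) * \<eta> - \<beta> * (t - 2 * \<nu>) * (t - 2 * \<nu> - 1) - bb
    + 2 * \<beta> * \<nu> * (1 - \<nu>) * t / (t - \<nu>) + \<nu> * \<eta> / 2 \<le> - \<beta>"
proof -
  \<comment> \<open>in terms of \<open>h\<close> every fraction becomes a polynomial, by \<open>t h = 1 + \<nu> h\<close>\<close>
  define h where "h = 1 / (t - \<nu>)"
  have pos: "t - \<nu> \<ge> 1" "t - \<nu> > 0" using t \<nu> by linarith+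
  have h: "0 < h" "h \<le> 1" using pos by (auto simp: h_def)
  have th: "t * h = 1 + \<nu> * h" using pos by (simp add: h_def field_simps)
  have \<eta>h: "\<eta> = 2 * \<beta> * (1 - (1 - \<nu>) * h)"
  proof -
    have "\<eta> = 2 * \<beta> * (t - 1) * h" using \<eta> pos by (simp add: h_def field_simps)
    also have "\<dots> = 2 * \<beta> * (t * h - h)" by (simp add: algebra_simps)
    finally show ?thesis unfolding th by (simp add: algebra_simps)
  qed
  have t\<eta>: "t * \<eta> = 2 * \<beta> * (t - 1 + \<nu> - \<nu> * (1 - \<nu>) * h)"
  proof -
    have "t * \<eta> = 2 * \<beta> * (t - (1 - \<nu>) * (t * h))" by (simp add: \<eta>h algebra_simps)
    then show ?thesis unfolding th by (simp add: algebra_simps)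
  qed
  have tt\<eta>: "t * (t - 1) * \<eta> = 2 * \<beta> * ((t - 1) * (t - 1 + \<nu>) - \<nu> * (1 - \<nu>) * (1 - (1 - \<nu>) * h))"
  proof -
    have "t * (t - 1) * \<eta> = (t - 1) * (t * \<eta>)" by simp
    also have "\<dots> = 2 * \<beta> * ((t - 1) * (t - 1 + \<nu>) - \<nu> * (1 - \<nu>) * (t * h - h))"
      unfolding t\<eta> by (simp add: algebra_simps)
    finally show ?thesis unfolding th by (simp add: algebra_simps)
  qed
  have ps: "2 * \<beta> * \<nu> * (1 - \<nu>) * t / (t - \<nu>) = 2 * \<beta> * \<nu> * (1 - \<nu>) * (1 + \<nu> * h)"
    unfolding th[symmetric] by (simp add: h_def)
  have bb: "bb \<ge> \<beta> * (1 + 2 * \<nu> + 2 * \<nu>\<^sup>2)"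
  proof -
    have "(1 + 2 * \<nu> + 2 * \<nu>\<^sup>2) * (1 - \<nu>) = 1 + \<nu> - 2 * \<nu>^3"
      by (simp add: algebra_simps power2_eq_square power3_eq_cube)
    also have "\<dots> \<le> 1 + \<nu>" using \<nu> by simp
    finally have "\<beta> * ((1 + 2 * \<nu> + 2 * \<nu>\<^sup>2) * (1 - \<nu>)) \<le> bb * (1 - \<nu>)"
      using \<beta> by (meson mult_left_mono order_trans less_imp_le)
    then have "(\<beta> * (1 + 2 * \<nu> + 2 * \<nu>\<^sup>2)) * (1 - \<nu>) \<le> bb * (1 - \<nu>)" by (simp add: mult.assoc)
    then show ?thesis using \<nu> by (simp add: mult_le_cancel_right)
  qed
  have "- (2 - 6 * \<nu>) * t + 2 - 3 * \<nu> - 4 * \<nu>\<^sup>2 + \<nu> * (1 - \<nu>) * h - (1 + 2 * \<nu> + 2 * \<nu>\<^sup>2) \<le> - 1"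
  proof -
    have 1: "(2 - 6 * \<nu>) * (t - (1 + 6 * \<nu>)) \<ge> 0" using \<nu> t by (intro mult_nonneg_nonneg) auto
    have 2: "\<nu> * (1 - \<nu>) * h \<le> \<nu> * (1 - \<nu>)" using \<nu> h by (simp add: mult_left_le)
    have 3: "\<nu> * (1 - 3 * \<nu>) \<ge> 0" using \<nu> by simp
    have "2 * t - 6 * (\<nu> * t) - 2 - 6 * \<nu> + 36 * \<nu>\<^sup>2 \<ge> 0" "\<nu> * h - \<nu>\<^sup>2 * h \<le> \<nu> - \<nu>\<^sup>2" "3 * \<nu>\<^sup>2 \<le> \<nu>"
      using 1 2 3 by (simp_all add: algebra_simps power2_eq_square)
    moreover have "- (2 - 6 * \<nu>) * t + 2 - 3 * \<nu> - 4 * \<nu>\<^sup>2 + \<nu> * (1 - \<nu>) * h - (1 + 2 * \<nu> + 2 * \<nu>\<^sup>2)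
        = - (2 * t) + 6 * (\<nu> * t) + 1 - 5 * \<nu> - 6 * \<nu>\<^sup>2 + (\<nu> * h - \<nu>\<^sup>2 * h)"
      by (simp add: algebra_simps power2_eq_square)
    ultimately show ?thesis using \<nu> by linarith
  qed
  then have "\<beta> * (- (2 - 6 * \<nu>) * t + 2 - 3 * \<nu> - 4 * \<nu>\<^sup>2 + \<nu> * (1 - \<nu>) * h - (1 + 2 * \<nu> + 2 * \<nu>\<^sup>2))
      \<le> \<beta> * (- 1)"
    using \<beta> by (intro mult_left_mono) auto
  moreover have "- \<beta> * (t * (t - 1)) + t * (t - 1) * \<eta> - \<beta> * (t - 2 * \<nu>) * (t - 2 * \<nu> - 1)
      + 2 * \<beta> * \<nu> * (1 - \<nu>) * t / (t - \<nu>) + \<nu> * \<eta> / 2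
     = \<beta> * (- (2 - 6 * \<nu>) * t + 2 - 3 * \<nu> - 4 * \<nu>\<^sup>2 + \<nu> * (1 - \<nu>) * h)"
  proof -
    have "\<nu> * \<eta> / 2 = \<beta> * \<nu> * (1 - (1 - \<nu>) * h)" by (simp add: \<eta>h)
    then show ?thesis unfolding tt\<eta> ps by (simp add: algebra_simps power2_eq_square)
  qed
  ultimately show ?thesis using bb by (simp add: algebra_simps)
qed

text \<open>The summands are the factors of \<open>|w|\<^sup>2\<close> that Young's inequality leaves for the products of the error \<open>w\<close> with,
in this order, the increment of the residual, the residual, \<open>z - xs\<close> and, last, \<open>v\<close>; the fourth summand stems from the
squared step.  The first dominates for small \<open>\<nu>\<close>, being then close to \<open>\<beta> / (2 \<nu>) * t (t - 1)\<close>.\<close>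
lemma lyapunov_noise_coefficient:
  fixes t \<nu> \<beta> \<eta> :: real
  assumes \<nu>: "0 < \<nu>" "3 * \<nu> < 1" and t: "t \<ge> 1 + 6 * \<nu>" and \<beta>: "0 < \<beta>"
  shows "\<beta> * (1 - \<nu>) / (2 * \<nu>) * (t * (t - 1)) + \<beta> * (1 - \<nu>)\<^sup>2 * (t * (t - 1))
    + \<beta> / (2 * (1 - \<nu>)) * ((t - 1) * (t - 1 + 2 * \<nu>))
    + 2 * \<beta> * \<nu> * (1 - \<nu>) * t / (t - \<nu>)
    + 2 * \<beta> * \<nu> * (1 - \<nu>) * t * (t - 1)\<^sup>2 / ((t - \<nu>) * (2 * t - 1))
    \<le> 5 * \<beta> / (4 * \<nu>) * (t * (t - 1))"
proof -
  define S where "S = t * (t - 1)"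
  have pos: "t - \<nu> \<ge> 1" "t > 1" "t - 1 \<ge> 6 * \<nu>" "1 - \<nu> > 0" using t \<nu> by linarith+
  have S: "S > 0" using pos by (simp add: S_def)
  have 1: "\<beta> * (1 - \<nu>)\<^sup>2 * S \<le> \<beta> * S"
  proof -
    have "(1 - \<nu>)\<^sup>2 \<le> 1" using \<nu> by (simp add: power_le_one)
    then have "(1 - \<nu>)\<^sup>2 * (\<beta> * S) \<le> 1 * (\<beta> * S)" using \<beta> S by (intro mult_right_mono) auto
    then show ?thesis by (simp add: mult_ac)
  qed
  have 2: "\<beta> / (2 * (1 - \<nu>)) * ((t - 1) * (t - 1 + 2 * \<nu>)) \<le> 3 * \<beta> / 4 * S"
  proof (rule mult_mono)
    show "\<beta> / (2 * (1 - \<nu>)) \<le> 3 * \<beta> / 4" using \<nu> \<beta> by (simp add: field_simps)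
    have "(t - 1) * (t - 1 + 2 * \<nu>) \<le> (t - 1) * t" using pos \<nu> by (intro mult_left_mono) auto
    then show "(t - 1) * (t - 1 + 2 * \<nu>) \<le> S" by (simp add: S_def mult.commute)
  qed (use \<beta> pos \<nu> in auto)
  have 3: "2 * \<beta> * \<nu> * (1 - \<nu>) * t / (t - \<nu>) \<le> \<beta> / 3 * S"
  proof -
    have "2 * \<beta> * \<nu> * (1 - \<nu>) * t / (t - \<nu>) \<le> 2 * \<beta> * \<nu> * (1 - \<nu>) * t / 1"
      using pos \<nu> \<beta> by (intro divide_left_mono) auto
    also have "\<dots> \<le> 2 * \<beta> * \<nu> * 1 * t" using pos \<nu> \<beta> by (auto intro!: mult_mono)
    also have "\<dots> = \<beta> / 3 * (t * (6 * \<nu>))" by simp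
    also have "\<dots> \<le> \<beta> / 3 * S" unfolding S_def using pos \<beta> by (intro mult_left_mono) auto
    finally show ?thesis .
  qed
  have 4: "2 * \<beta> * \<nu> * (1 - \<nu>) * t * (t - 1)\<^sup>2 / ((t - \<nu>) * (2 * t - 1)) \<le> \<beta> / 2 * S"
  proof -
    have d: "(t - 1) * (t - 1) \<le> (t - 1) * ((t - \<nu>) * (2 * t - 1))"
      using pos \<nu> mult_mono[of 1 "t - \<nu>" "t - 1" "2 * t - 1"] by (intro mult_left_mono) auto
    have n4: "2 * \<nu> * (1 - \<nu>) \<le> 1 / 2"
      using zero_le_power2[of "2 * \<nu> - 1"] by (simp add: power2_eq_square algebra_simps)
    have D: "(t - \<nu>) * (2 * t - 1) > 0" using pos by (intro mult_pos_pos) auto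
    have "2 * \<beta> * \<nu> * (1 - \<nu>) * t * (t - 1)\<^sup>2 / ((t - \<nu>) * (2 * t - 1))
        = (2 * \<nu> * (1 - \<nu>)) * (\<beta> * t) * ((t - 1) * (t - 1) / ((t - \<nu>) * (2 * t - 1)))"
      by (simp add: power2_eq_square)
    also have "\<dots> \<le> (1 / 2) * (\<beta> * t) * (t - 1)"
    proof (rule mult_mono)
      show "(t - 1) * (t - 1) / ((t - \<nu>) * (2 * t - 1)) \<le> t - 1"
        using d D by (simp add: pos_divide_le_eq)
      show "2 * \<nu> * (1 - \<nu>) * (\<beta> * t) \<le> 1 / 2 * (\<beta> * t)"
        using n4 \<beta> pos by (intro mult_right_mono) auto
      show "0 \<le> (t - 1) * (t - 1) / ((t - \<nu>) * (2 * t - 1))" using D by simp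
    qed (use \<beta> pos in auto)
    also have "\<dots> = \<beta> / 2 * S" by (simp add: S_def)
    finally show ?thesis .
  qed
  have 5: "\<beta> * (1 - \<nu>) / (2 * \<nu>) * S = \<beta> * S / (2 * \<nu>) - \<beta> * S / 2"
    using \<nu> by (simp add: field_simps)
  have 6: "5 * \<beta> / (4 * \<nu>) * S = \<beta> * S / (2 * \<nu>) + 3 * (\<beta> * S) / (4 * \<nu>)"
    using \<nu> by (simp add: field_simps)
  have 7: "3 * (\<beta> * S) / (4 * \<nu>) \<ge> 9 / 4 * (\<beta> * S)"
  proof -
    have "9 / 4 * (\<beta> * S) * (4 * \<nu>) = (3 * \<nu>) * (3 * (\<beta> * S))" by simp
    also have "\<dots> \<le> 1 * (3 * (\<beta> * S))" using \<nu> \<beta> S by (intro mult_right_mono) auto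
    finally show ?thesis using \<nu> by (simp add: pos_le_divide_eq)
  qed
  have "\<beta> * S > 0" using \<beta> S by simp
  with 1 2 3 4 5 6 7 show ?thesis unfolding S_def[symmetric] by linarith
qed

text \<open>\<open>Q\<close> is the gain of the cocoercivity inequality between consecutive iterates.  Multiplied by \<open>t (t - 1)\<close>, that
inequality turns \<open>g \<bullet> v\<close> into \<open>gp \<bullet> vp\<close> and \<open>|g|\<^sup>2\<close> into \<open>|gp|\<^sup>2\<close>.  The slack \<open>bb - \<beta>\<close>, the coefficient \<open>- \<beta>\<close> of
\<open>|g|\<^sup>2\<close>, the contraction of \<open>v\<close> by \<open>1 - 1/t\<close> and the decrease of \<open>c\<close> each absorb one product with the error \<open>w\<close>.\<close>
lemma lyapunov_step:
  fixes g gp w v Z :: "'a::real_inner" and t \<nu> \<beta> bb \<eta> Q :: real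
  assumes \<nu>: "0 < \<nu>" "3 * \<nu> < 1" and t: "t \<ge> 1 + 6 * \<nu>" and \<beta>: "0 < \<beta>" "\<beta> * (1 + \<nu>) \<le> bb * (1 - \<nu>)"
    and \<eta>: "\<eta> = 2 * \<beta> * (t - 1) / (t - \<nu>)"
    and vp: "vp = (1 - 1 / t) *\<^sub>R v + ((1 - \<nu>) * \<eta>) *\<^sub>R (g + w)"
    and Zp: "Zp = Z - (\<nu> * \<eta>) *\<^sub>R (g + w)"
    and mono_step: "bb * (norm (gp - g))\<^sup>2 + Q \<le> (gp - g) \<bullet> ((1 / t) *\<^sub>R v - \<eta> *\<^sub>R (g + w))"
    and mono_sol: "bb * (norm g)\<^sup>2 \<le> g \<bullet> (Z - v)"
  shows "lyapunov \<beta> \<nu> (t + 2 * \<nu>) gp vp Zp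
    \<le> lyapunov \<beta> \<nu> t g v Z + 5 * \<beta> / (4 * \<nu>) * (t * (t - 1)) * (norm w)\<^sup>2 - t * (t - 1) * Q"
proof -
  define S where "S = t * (t - 1)"
  have pos: "t - \<nu> \<ge> 1" "t > 1" "t - 1 \<ge> 6 * \<nu>" "1 - \<nu> > 0" "t - \<nu> > 0" "t - 1 > 0"
    using t \<nu> by linarith+
  have S: "S > 0" using pos by (simp add: S_def)
  have \<eta>t: "\<eta> * (t - \<nu>) = 2 * \<beta> * (t - 1)" using \<eta> pos by simp
  have \<eta>_pos: "\<eta> > 0" using \<eta> pos \<beta> by simp
  define GG GP NN WW VV ZP gw uw gv gZ vw where "GG = (norm g)\<^sup>2" and "GP = (norm gp)\<^sup>2"
    and "NN = (norm (gp - g))\<^sup>2" and "WW = (norm w)\<^sup>2" and "VV = (norm v)\<^sup>2" and "ZP = (norm Zp)\<^sup>2"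
    and "gw = g \<bullet> w" and "uw = (gp - g) \<bullet> w" and "gv = g \<bullet> v" and "gZ = g \<bullet> Z" and "vw = v \<bullet> w"
  note defs = GG_def GP_def NN_def WW_def VV_def ZP_def gw_def uw_def gv_def gZ_def vw_def
  define \<kappa> \<kappa>' c c' where "\<kappa> = \<nu> * t * (t - \<nu>) / (2 * \<beta> * (1 - \<nu>) * (t - 1)\<^sup>2)"
    and "\<kappa>' = \<nu> * (t + 2 * \<nu>) * (t + \<nu>) / (2 * \<beta> * (1 - \<nu>) * (t + 2 * \<nu> - 1)\<^sup>2)"
    and "c = (t - \<nu>) / (4 * \<beta> * \<nu> * (t - 1))"
    and "c' = (t + \<nu>) / (4 * \<beta> * \<nu> * (t + 2 * \<nu> - 1))"
  define \<psi> where "\<psi> = 2 * \<beta> * \<nu> * (1 - \<nu>) * t / (t - \<nu>)"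
  have \<kappa>_pos: "\<kappa> > 0" unfolding \<kappa>_def using \<nu> \<beta> pos by simp
  have \<kappa>1: "\<kappa> * (1 - 1 / t) * ((1 - \<nu>) * \<eta>) = \<nu>"
    unfolding \<kappa>_def \<eta> using pos \<beta> by (simp add: divide_simps power2_eq_square)
  have \<kappa>2: "\<kappa> * ((1 - \<nu>) * \<eta>)\<^sup>2 = \<psi>"
    unfolding \<kappa>_def \<eta> \<psi>_def using pos \<beta> by (simp add: divide_simps power2_eq_square)
  have c1: "2 * c * \<nu> * \<eta> = 1"
    unfolding c_def \<eta> using pos \<beta> \<nu> by (simp add: divide_simps) (simp add: algebra_simps)
  have lyap_eq: "lyapunov \<beta> \<nu> t g v Z = \<beta> * (t - 2 * \<nu>) * (t - 2 * \<nu> - 1) * GG - (t - 2 * \<nu>) * gv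
      + \<kappa> * VV + c * (norm Z)\<^sup>2"
    unfolding lyapunov_def defs \<kappa>_def c_def by simp
  have lyapp_eq: "lyapunov \<beta> \<nu> (t + 2 * \<nu>) gp vp Zp = \<beta> * S * GP - t * (gp \<bullet> vp)
      + \<kappa>' * (norm vp)\<^sup>2 + c' * ZP"
    unfolding lyapunov_def defs \<kappa>'_def c'_def S_def by (simp add: add.commute[of _ t] add_diff_eq)
  \<comment> \<open>the cocoercivity inequality multiplied by \<open>t (t - 1)\<close>\<close>
  have A: "- (t * (gp \<bullet> vp)) \<le> - ((t - 1) * gv) - \<beta> * S * GP - \<beta> * S * GG + \<beta> * S * NN
      - 2 * \<beta> * S * uw - (2 * \<beta> * S - S * \<eta>) * gw + S * \<eta> * GG - S * bb * NN - S * Q"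
  proof -
    define X1 X2 X3 where "X1 = gp \<bullet> (g + w)" and "X2 = g \<bullet> (g + w)"
      and "X3 = (gp - g) \<bullet> ((1 / t) *\<^sub>R v - \<eta> *\<^sub>R (g + w))"
    have "t * (gp \<bullet> vp) = t * (1 - 1 / t) * (gp \<bullet> v) + t * (1 - \<nu>) * \<eta> * X1"
      unfolding vp X1_def inner_add_right[of gp "_ *\<^sub>R v"] inner_scaleR_right by (simp only: ring_distribs mult_ac)
    moreover have "t * (1 - 1 / t) = t - 1" using pos by (simp add: field_simps)
    ultimately have f1: "t * (gp \<bullet> vp) = (t - 1) * (gp \<bullet> v) + t * (1 - \<nu>) * \<eta> * X1" by simp
    have "S * X3 = S * (1 / t) * (gp \<bullet> v) - S * (1 / t) * gv - S * \<eta> * X1 + S * \<eta> * X2"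
      unfolding X1_def X2_def X3_def gv_def inner_diff_left inner_diff_right[of _ "_ *\<^sub>R v"] inner_scaleR_right
      by (simp only: ring_distribs mult_ac)
    moreover have "S * (1 / t) = t - 1" using pos by (simp add: S_def)
    ultimately have f2: "S * X3 = (t - 1) * (gp \<bullet> v) - (t - 1) * gv - S * \<eta> * X1 + S * \<eta> * X2"
      by (simp only:)
    have "t * (1 - \<nu>) * \<eta> + S * \<eta> = t * (\<eta> * (t - \<nu>))" by (simp add: S_def algebra_simps)
    also have "\<dots> = 2 * \<beta> * S" unfolding \<eta>t S_def by simp
    finally have "t * (1 - \<nu>) * \<eta> * X1 + S * \<eta> * X1 = 2 * \<beta> * S * X1" by (metis distrib_right)
    then have f3: "t * (1 - \<nu>) * \<eta> * X1 = 2 * \<beta> * S * X1 - S * \<eta> * X1" by simp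
    have "S * (bb * NN + Q) \<le> S * X3"
      using mono_step S unfolding NN_def X3_def by (intro mult_left_mono) auto
    then have f4: "S * bb * NN + S * Q \<le> S * X3" by (simp add: algebra_simps)
    have "X1 = (GP + GG - NN) / 2 + uw + gw"
      unfolding X1_def defs power2_norm_eq_inner by (simp add: algebra_simps inner_commute)
    then have "2 * X1 = GP + GG - NN + 2 * uw + 2 * gw" by simp
    then have "\<beta> * S * (2 * X1) = \<beta> * S * (GP + GG - NN + 2 * uw + 2 * gw)" by (rule arg_cong)
    then have f5: "2 * \<beta> * S * X1 = \<beta> * S * GP + \<beta> * S * GG - \<beta> * S * NN + 2 * \<beta> * S * uw + 2 * \<beta> * S * gw"
      by (simp add: algebra_simps)
    have "X2 = GG + gw"
      unfolding X2_def defs power2_norm_eq_inner by (simp add: algebra_simps)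
    then have f6: "S * \<eta> * X2 = S * \<eta> * GG + S * \<eta> * gw" by (simp add: algebra_simps)
    have "(2 * \<beta> * S - S * \<eta>) * gw = 2 * \<beta> * S * gw - S * \<eta> * gw" by (rule left_diff_distrib)
    with f1 f2 f3 f4 f5 f6 show ?thesis by linarith
  qed
  have B: "\<kappa>' * (norm vp)\<^sup>2 \<le> \<kappa> * (1 - 1 / t)\<^sup>2 * VV + 2 * \<nu> * (gv + vw) + \<psi> * (GG + 2 * gw + WW)"
  proof -
    have "\<kappa>' \<le> \<kappa>"
    proof -
      have a: "(t + \<nu>) / (t + 2 * \<nu> - 1) \<le> (t - \<nu>) / (t - 1)"
        using pos \<nu> by (simp add: divide_simps) (simp add: algebra_simps)
      have b: "(t + 2 * \<nu>) / (t + 2 * \<nu> - 1) \<le> t / (t - 1)"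
        using pos \<nu> by (simp add: divide_simps) (simp add: algebra_simps)
      have "(t + 2 * \<nu>) / (t + 2 * \<nu> - 1) * ((t + \<nu>) / (t + 2 * \<nu> - 1)) \<le> t / (t - 1) * ((t - \<nu>) / (t - 1))"
        using a b pos \<nu> by (intro mult_mono) auto
      then have "\<nu> / (2 * \<beta> * (1 - \<nu>)) * ((t + 2 * \<nu>) / (t + 2 * \<nu> - 1) * ((t + \<nu>) / (t + 2 * \<nu> - 1)))
          \<le> \<nu> / (2 * \<beta> * (1 - \<nu>)) * (t / (t - 1) * ((t - \<nu>) / (t - 1)))"
        using \<beta> \<nu> by (intro mult_left_mono) auto
      then show ?thesis unfolding \<kappa>_def \<kappa>'_def by (simp add: power2_eq_square mult_ac)
    qed
    then have 1: "\<kappa>' * (norm vp)\<^sup>2 \<le> \<kappa> * (norm vp)\<^sup>2" by (intro mult_right_mono) auto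
    have 2: "(norm vp)\<^sup>2 = (1 - 1 / t)\<^sup>2 * VV + 2 * ((1 - 1 / t) * ((1 - \<nu>) * \<eta>)) * (gv + vw)
        + ((1 - \<nu>) * \<eta>)\<^sup>2 * (GG + 2 * gw + WW)"
      unfolding vp by (simp add: norm_scaled_add_squared defs)
    have "\<kappa> * (norm vp)\<^sup>2 = \<kappa> * (1 - 1 / t)\<^sup>2 * VV + 2 * (\<kappa> * (1 - 1 / t) * ((1 - \<nu>) * \<eta>)) * (gv + vw)
        + \<kappa> * ((1 - \<nu>) * \<eta>)\<^sup>2 * (GG + 2 * gw + WW)"
      unfolding 2 by (simp only: distrib_left mult_ac)
    with 1 show ?thesis unfolding \<kappa>1 \<kappa>2 by (rule ord_le_eq_trans)
  qed
  \<comment> \<open>the product of the error is taken with the new \<open>Zp\<close>: then the quadratic error term has a negative sign\<close>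
  have C: "c * ZP = c * (norm Z)\<^sup>2 - gZ - w \<bullet> Zp + \<nu> * \<eta> / 2 * GG - \<nu> * \<eta> / 2 * WW"
  proof -
    define e where "e = \<nu> * \<eta>"
    have e: "2 * c * e = 1" using c1 by (simp add: e_def mult_ac)
    have "c * ZP = c * (norm Z)\<^sup>2 - (2 * c * e) * (gZ + w \<bullet> Z) + (2 * c * e) * e / 2 * (GG + 2 * gw + WW)"
      unfolding Zp e_def[symmetric] defs power2_norm_eq_inner
      by (simp add: inner_diff_left inner_diff_right inner_add_left inner_add_right inner_commute algebra_simps)
    moreover have "w \<bullet> Zp = w \<bullet> Z - e * gw - e * WW"
      unfolding Zp e_def[symmetric] defs power2_norm_eq_inner
      by (simp add: inner_diff_right inner_add_right inner_commute algebra_simps)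
    ultimately show ?thesis unfolding e e_def[symmetric] by (simp add: algebra_simps)
  qed
  have D: "bb * GG \<le> gZ - gv" using mono_sol by (simp add: defs inner_diff_right)
  \<comment> \<open>the slack of \<open>bb\<close> over \<open>\<beta>\<close>, at least \<open>2 \<nu> \<beta> / (1 - \<nu>)\<close>, absorbs the error along the increment of the residual\<close>
  have Y1: "- 2 * \<beta> * S * uw \<le> (bb - \<beta>) * S * NN + \<beta> * (1 - \<nu>) / (2 * \<nu>) * S * WW"
  proof -
    define a where "a = 2 * \<nu> * \<beta> / (1 - \<nu>)"
    have a: "a > 0" using \<nu> \<beta> by (simp add: a_def)
    have "a * (1 - \<nu>) = 2 * \<nu> * \<beta>" using \<nu> by (simp add: a_def)
    also have "\<dots> \<le> (bb - \<beta>) * (1 - \<nu>)" using \<beta> by (simp add: algebra_simps)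
    finally have "a * (1 - \<nu>) \<le> (bb - \<beta>) * (1 - \<nu>)" .
    then have abb: "a \<le> bb - \<beta>" using \<nu> by (simp add: mult_le_cancel_right)
    have "(- 2 * \<beta>) * uw \<le> a * NN + (- 2 * \<beta>)\<^sup>2 / (4 * a) * WW"
      unfolding defs using a by (rule young_inner)
    also have "\<dots> \<le> (bb - \<beta>) * NN + (- 2 * \<beta>)\<^sup>2 / (4 * a) * WW"
      using abb by (intro add_right_mono mult_right_mono) (auto simp: NN_def)
    also have "(- 2 * \<beta>)\<^sup>2 / (4 * a) = \<beta> * (1 - \<nu>) / (2 * \<nu>)"
      using \<nu> \<beta> by (simp add: a_def field_simps power2_eq_square)
    finally have "S * ((- 2 * \<beta>) * uw) \<le> S * ((bb - \<beta>) * NN + \<beta> * (1 - \<nu>) / (2 * \<nu>) * WW)"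
      using S by (intro mult_left_mono) auto
    then show ?thesis by (simp add: algebra_simps)
  qed
  have Y2: "- (2 * \<beta> * S - S * \<eta>) * gw + 2 * \<psi> * gw \<le> \<beta> * GG + \<beta> * (1 - \<nu>)\<^sup>2 * S * WW"
  proof -
    define m where "m = 2 * \<beta> * (1 - \<nu>) * t * (t - 1 - 2 * \<nu>) / (t - \<nu>)"
    have m_eq: "2 * \<beta> * S - S * \<eta> - 2 * \<psi> = m"
      unfolding m_def \<psi>_def \<eta> S_def using pos by (simp add: divide_simps) (simp add: algebra_simps)
    have "m\<^sup>2 \<le> (2 * \<beta> * (1 - \<nu>))\<^sup>2 * S"
    proof -
      have "(t * (t - 1 - 2 * \<nu>) / (t - \<nu>))\<^sup>2 \<le> S"
      proof -
        have "(t * (t - 1 - 2 * \<nu>) / (t - \<nu>))\<^sup>2 \<le> (t * (t - 1) / (t - \<nu>))\<^sup>2"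
          using pos \<nu> by (intro power_mono divide_right_mono mult_left_mono) auto
        also have "\<dots> = S * (S / (t - \<nu>)\<^sup>2)" by (simp add: S_def power2_eq_square)
        also have "\<dots> \<le> S * 1"
        proof (intro mult_left_mono)
          have "0 \<le> t * (1 - 2 * \<nu>) + \<nu>\<^sup>2" using pos \<nu> by (intro add_nonneg_nonneg mult_nonneg_nonneg) auto
          then have "S \<le> (t - \<nu>)\<^sup>2" by (simp add: S_def power2_eq_square algebra_simps)
          then show "S / (t - \<nu>)\<^sup>2 \<le> 1" using pos by simp
        qed (use S in auto)
        finally show ?thesis by simp
      qed
      then have "(2 * \<beta> * (1 - \<nu>))\<^sup>2 * (t * (t - 1 - 2 * \<nu>) / (t - \<nu>))\<^sup>2 \<le> (2 * \<beta> * (1 - \<nu>))\<^sup>2 * S"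
        by (intro mult_left_mono) auto
      moreover have "m = (2 * \<beta> * (1 - \<nu>)) * (t * (t - 1 - 2 * \<nu>) / (t - \<nu>))" by (simp add: m_def)
      ultimately show ?thesis by (simp only: power_mult_distrib)
    qed
    then have "m\<^sup>2 / (4 * \<beta>) \<le> (2 * \<beta> * (1 - \<nu>))\<^sup>2 * S / (4 * \<beta>)"
      using \<beta> by (intro divide_right_mono) auto
    also have "\<dots> = \<beta> * (1 - \<nu>)\<^sup>2 * S" using \<beta> by (simp add: power2_eq_square)
    finally have mm: "(- m)\<^sup>2 / (4 * \<beta>) * WW \<le> \<beta> * (1 - \<nu>)\<^sup>2 * S * WW"
      by (intro mult_right_mono) (auto simp: WW_def)
    have "(- m) * gw \<le> \<beta> * GG + (- m)\<^sup>2 / (4 * \<beta>) * WW"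
      unfolding defs using \<beta>(1) by (rule young_inner)
    with mm have "(- m) * gw \<le> \<beta> * GG + \<beta> * (1 - \<nu>)\<^sup>2 * S * WW" by linarith
    then show ?thesis unfolding m_eq[symmetric] by (simp add: algebra_simps)
  qed
  \<comment> \<open>the decrease \<open>c - c'\<close> is of order \<open>1 / t\<^sup>2\<close>, which suffices for an error weighted by \<open>t\<^sup>2\<close>\<close>
  have Y3: "c' * ZP - w \<bullet> Zp \<le> c * ZP + \<beta> / (2 * (1 - \<nu>)) * ((t - 1) * (t - 1 + 2 * \<nu>)) * WW"
  proof -
    define a where "a = c - c'"
    have a_eq: "a = (1 - \<nu>) / (2 * \<beta> * ((t - 1) * (t - 1 + 2 * \<nu>)))"
    proof -
      have "a = ((t - \<nu>) / (t - 1) - (t + \<nu>) / (t - 1 + 2 * \<nu>)) / (4 * \<beta> * \<nu>)"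
        unfolding a_def c_def c'_def by (simp add: diff_divide_distrib mult_ac add_diff_eq add.commute diff_add_eq)
      also have "(t - \<nu>) / (t - 1) - (t + \<nu>) / (t - 1 + 2 * \<nu>)
          = ((t - \<nu>) * (t - 1 + 2 * \<nu>) - (t + \<nu>) * (t - 1)) / ((t - 1) * (t - 1 + 2 * \<nu>))"
        using pos \<nu> by (subst diff_frac_eq) auto
      also have "(t - \<nu>) * (t - 1 + 2 * \<nu>) - (t + \<nu>) * (t - 1) = 2 * \<nu> * (1 - \<nu>)"
        by (simp add: algebra_simps)
      also have "2 * \<nu> * (1 - \<nu>) / ((t - 1) * (t - 1 + 2 * \<nu>)) / (4 * \<beta> * \<nu>)
          = (1 - \<nu>) / (2 * \<beta> * ((t - 1) * (t - 1 + 2 * \<nu>)))"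
        using \<nu> \<beta> pos by (simp add: divide_simps) (simp add: algebra_simps)
      finally show ?thesis .
    qed
    have a: "a > 0" unfolding a_eq using pos \<nu> \<beta> by simp
    have "(- 1) * (Zp \<bullet> w) \<le> a * ZP + (- 1)\<^sup>2 / (4 * a) * WW"
      unfolding defs using a by (rule young_inner)
    moreover have "(- 1)\<^sup>2 / (4 * a) = \<beta> / (2 * (1 - \<nu>)) * ((t - 1) * (t - 1 + 2 * \<nu>))"
      unfolding a_eq using pos \<nu> \<beta> by (simp add: field_simps)
    ultimately have "(- 1) * (Zp \<bullet> w) \<le> a * ZP + \<beta> / (2 * (1 - \<nu>)) * ((t - 1) * (t - 1 + 2 * \<nu>)) * WW"
      by (simp only:)
    then have "- (w \<bullet> Zp) \<le> a * ZP + \<beta> / (2 * (1 - \<nu>)) * ((t - 1) * (t - 1 + 2 * \<nu>)) * WW"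
      by (simp add: inner_commute)
    then show ?thesis unfolding a_def by (simp add: algebra_simps)
  qed
  have Y4: "\<kappa> * (1 - 1 / t)\<^sup>2 * VV + 2 * \<nu> * vw
      \<le> \<kappa> * VV + 2 * \<beta> * \<nu> * (1 - \<nu>) * t * (t - 1)\<^sup>2 / ((t - \<nu>) * (2 * t - 1)) * WW"
  proof -
    define a where "a = \<kappa> * ((2 * t - 1) / t\<^sup>2)"
    have a: "a > 0" unfolding a_def using \<kappa>_pos pos by simp
    have a1: "\<kappa> * (1 - 1 / t)\<^sup>2 = \<kappa> - a"
    proof -
      have "(1 - 1 / t)\<^sup>2 = 1 - (2 * t - 1) / t\<^sup>2"
        using pos by (simp add: power2_eq_square field_simps)
      then show ?thesis by (simp add: a_def right_diff_distrib)
    qed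
    have a2: "(2 * \<nu>)\<^sup>2 / (4 * a) = 2 * \<beta> * \<nu> * (1 - \<nu>) * t * (t - 1)\<^sup>2 / ((t - \<nu>) * (2 * t - 1))"
      unfolding a_def \<kappa>_def using pos \<nu> \<beta> by (simp add: divide_simps power2_eq_square)
    have "2 * \<nu> * vw \<le> a * VV + (2 * \<nu>)\<^sup>2 / (4 * a) * WW"
      unfolding defs using a by (rule young_inner)
    then show ?thesis unfolding a2 a1 by (simp add: algebra_simps)
  qed
  have GGc: "(- \<beta> * S + S * \<eta> - \<beta> * (t - 2 * \<nu>) * (t - 2 * \<nu> - 1) - bb + \<psi> + \<nu> * \<eta> / 2) * GG \<le> - \<beta> * GG"
    unfolding S_def \<psi>_def
    by (intro mult_right_mono lyapunov_gradient_coefficient) (use \<nu> t \<beta> \<eta>t in \<open>auto simp: GG_def\<close>)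
  have WWc: "(\<beta> * (1 - \<nu>) / (2 * \<nu>) * S + \<beta> * (1 - \<nu>)\<^sup>2 * S
      + \<beta> / (2 * (1 - \<nu>)) * ((t - 1) * (t - 1 + 2 * \<nu>)) + \<psi>
      + 2 * \<beta> * \<nu> * (1 - \<nu>) * t * (t - 1)\<^sup>2 / ((t - \<nu>) * (2 * t - 1))) * WW
      \<le> 5 * \<beta> / (4 * \<nu>) * S * WW"
    unfolding S_def \<psi>_def
    by (intro mult_right_mono lyapunov_noise_coefficient) (use \<nu> t \<beta> in \<open>auto simp: WW_def\<close>)
  have pos_rest: "0 \<le> \<nu> * \<eta> / 2 * WW" using \<nu> \<eta>_pos by (simp add: WW_def)
  define k1 k2 k3 k5 k6 cA e where "k1 = \<beta> * (1 - \<nu>) / (2 * \<nu>) * S" and "k2 = \<beta> * (1 - \<nu>)\<^sup>2 * S"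
    and "k3 = \<beta> / (2 * (1 - \<nu>)) * ((t - 1) * (t - 1 + 2 * \<nu>))"
    and "k5 = 2 * \<beta> * \<nu> * (1 - \<nu>) * t * (t - 1)\<^sup>2 / ((t - \<nu>) * (2 * t - 1))"
    and "k6 = 5 * \<beta> / (4 * \<nu>) * S" and "cA = \<beta> * (t - 2 * \<nu>) * (t - 2 * \<nu> - 1)"
    and "e = \<nu> * \<eta> / 2"
  note folds = k1_def[symmetric] k2_def[symmetric] k3_def[symmetric] k5_def[symmetric] k6_def[symmetric]
    cA_def[symmetric] e_def[symmetric]
  have W1: "k1 * WW + k2 * WW + k3 * WW + \<psi> * WW + k5 * WW \<le> k6 * WW"
    using WWc unfolding folds by (simp only: distrib_right)
  have G1: "S * \<eta> * GG + \<psi> * GG + e * GG \<le> \<beta> * S * GG + cA * GG + bb * GG - \<beta> * GG"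
    using GGc unfolding folds by (simp add: distrib_right left_diff_distrib)
  have P1: "- 2 * \<beta> * S * uw \<le> bb * S * NN - \<beta> * S * NN + k1 * WW"
    using Y1 unfolding folds by (simp only: left_diff_distrib)
  have P2: "2 * (\<psi> * gw) - (2 * \<beta> * S * gw - S * \<eta> * gw) \<le> \<beta> * GG + k2 * WW"
    using Y2 unfolding folds by (simp add: left_diff_distrib)
  have P3: "c' * ZP - w \<bullet> Zp \<le> c * ZP + k3 * WW" using Y3 unfolding folds .
  have P4: "\<kappa> * (1 - 1 / t)\<^sup>2 * VV + 2 * \<nu> * vw \<le> \<kappa> * VV + k5 * WW" using Y4 unfolding folds .
  have A1: "- (t * (gp \<bullet> vp)) \<le> - (t * gv) + gv - \<beta> * S * GP - \<beta> * S * GG + \<beta> * S * NN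
      - 2 * \<beta> * S * uw - (2 * \<beta> * S * gw - S * \<eta> * gw) + S * \<eta> * GG - bb * S * NN - S * Q"
  proof -
    have "(t - 1) * gv = t * gv - gv" "S * bb * NN = bb * S * NN"
      "(2 * \<beta> * S - S * \<eta>) * gw = 2 * \<beta> * S * gw - S * \<eta> * gw" by (simp_all add: left_diff_distrib)
    with A show ?thesis by linarith
  qed
  have B1: "\<kappa>' * (norm vp)\<^sup>2 \<le> \<kappa> * (1 - 1 / t)\<^sup>2 * VV + 2 * \<nu> * gv + 2 * \<nu> * vw
      + \<psi> * GG + 2 * (\<psi> * gw) + \<psi> * WW"
    using B by (simp add: distrib_left)
  have C1: "c * ZP = c * (norm Z)\<^sup>2 - gZ - w \<bullet> Zp + e * GG - e * WW" using C unfolding folds .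
  have "\<beta> * S * GP - t * (gp \<bullet> vp) + \<kappa>' * (norm vp)\<^sup>2 + c' * ZP
      \<le> cA * GG - (t * gv - 2 * \<nu> * gv) + \<kappa> * VV + c * (norm Z)\<^sup>2 + k6 * WW - S * Q"
    using A1 B1 C1 D W1 G1 P1 P2 P3 P4 pos_rest[unfolded folds] by linarith
  then show ?thesis
    unfolding lyap_eq lyapp_eq S_def[symmetric] WW_def[symmetric] folds
    by (simp only: left_diff_distrib)
qed

text \<open>Since \<open>c \<ge> 1 / (4 \<beta> \<nu>)\<close>, completing the square in \<open>Z\<close> costs at most \<open>\<nu> \<beta> (t - 2 \<nu>)\<^sup>2 |g|\<^sup>2\<close>, and \<open>\<nu> < 1/3\<close>.\<close>
lemma lyapunov_lower_bound:
  fixes g v Z :: "'a::real_inner"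
  assumes \<nu>: "0 < \<nu>" "3 * \<nu> < 1" and t: "t \<ge> 1 + 6 * \<nu>" and \<beta>: "0 < \<beta>" "\<beta> \<le> bb"
    and mono_sol: "bb * (norm g)\<^sup>2 \<le> g \<bullet> (Z - v)"
  shows "2 / 3 * \<beta> * (t - 2 * \<nu>)\<^sup>2 * (norm g)\<^sup>2 \<le> lyapunov \<beta> \<nu> t g v Z"
proof -
  define \<tau> where "\<tau> = t - 2 * \<nu>"
  have pos: "\<tau> > 0" "t > 1" "t - \<nu> > t - 1" "t - \<nu> > 0" using t \<nu> by (auto simp: \<tau>_def)
  have "0 \<le> \<nu> * t * (t - \<nu>) / (2 * \<beta> * (1 - \<nu>) * (t - 1)\<^sup>2) * (norm v)\<^sup>2"
    using pos \<nu> \<beta> by simp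
  moreover have "1 / (4 * \<beta> * \<nu>) * (norm Z)\<^sup>2 \<le> (t - \<nu>) / (4 * \<beta> * \<nu> * (t - 1)) * (norm Z)\<^sup>2"
  proof (intro mult_right_mono)
    show "1 / (4 * \<beta> * \<nu>) \<le> (t - \<nu>) / (4 * \<beta> * \<nu> * (t - 1))"
      using pos \<nu> \<beta> by (simp add: divide_simps)
  qed simp
  moreover have "\<tau> * (\<beta> * (norm g)\<^sup>2) \<le> \<tau> * (g \<bullet> Z - g \<bullet> v)"
  proof (intro mult_left_mono)
    have "\<beta> * (norm g)\<^sup>2 \<le> bb * (norm g)\<^sup>2" using \<beta> by (intro mult_right_mono) auto
    then show "\<beta> * (norm g)\<^sup>2 \<le> g \<bullet> Z - g \<bullet> v" using mono_sol by (simp add: inner_diff_right)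
  qed (use pos in auto)
  moreover have "\<tau> * (Z \<bullet> g) \<le> 1 / (4 * \<beta> * \<nu>) * (norm Z)\<^sup>2 + \<tau>\<^sup>2 / (4 * (1 / (4 * \<beta> * \<nu>))) * (norm g)\<^sup>2"
    using \<beta> \<nu> by (intro young_inner) auto
  moreover have "\<tau>\<^sup>2 / (4 * (1 / (4 * \<beta> * \<nu>))) * (norm g)\<^sup>2 \<le> 1 / 3 * (\<beta> * \<tau>\<^sup>2 * (norm g)\<^sup>2)"
  proof -
    have "\<tau>\<^sup>2 / (4 * (1 / (4 * \<beta> * \<nu>))) * (norm g)\<^sup>2 = \<nu> * (\<beta> * \<tau>\<^sup>2 * (norm g)\<^sup>2)" by simp
    also have "\<dots> \<le> 1 / 3 * (\<beta> * \<tau>\<^sup>2 * (norm g)\<^sup>2)" using \<nu> \<beta> by (intro mult_right_mono) auto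
    finally show ?thesis .
  qed
  moreover have "\<beta> * \<tau> * (\<tau> - 1) * (norm g)\<^sup>2 = \<beta> * \<tau>\<^sup>2 * (norm g)\<^sup>2 - \<tau> * (\<beta> * (norm g)\<^sup>2)"
    by (simp add: algebra_simps power2_eq_square)
  ultimately show ?thesis
    unfolding lyapunov_def \<tau>_def[symmetric]
    by (simp add: inner_commute right_diff_distrib)
qed

section \<open>Second moments of batches of independent draws\<close>

text \<open>Fubini's theorem for the joint law of \<open>X\<close> and an independent \<open>S\<close>: the expectation may first be taken over
\<open>S\<close> with \<open>X\<close> held fixed.  Independence is stated as a product law, because \<open>X\<close> and \<open>S\<close> take values in different types.\<close>
lemma (in prob_space) freeze_independent:
  fixes f :: "'b \<times> 'c \<Rightarrow> real"
  assumes X: "X \<in> measurable M B" and S: "S \<in> measurable M D"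
    and joint: "distr M (B \<Otimes>\<^sub>M D) (\<lambda>\<omega>. (X \<omega>, S \<omega>)) = distr M B X \<Otimes>\<^sub>M D" and D: "prob_space D"
    and f: "f \<in> borel_measurable (B \<Otimes>\<^sub>M D)"
    and int: "\<And>x. x \<in> space B \<Longrightarrow> integrable D (\<lambda>s. f (x, s))"
    and int_norm: "integrable M (\<lambda>\<omega>. \<integral>s. norm (f (X \<omega>, s)) \<partial>D)"
  shows "integrable M (\<lambda>\<omega>. f (X \<omega>, S \<omega>))"
    and "(\<integral>\<omega>. f (X \<omega>, S \<omega>) \<partial>M) = (\<integral>\<omega>. (\<integral>s. f (X \<omega>, s) \<partial>D) \<partial>M)"
proof -
  note [measurable] = X S f
  interpret DX: prob_space "distr M B X" by (rule prob_space_distr) fact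
  interpret D: prob_space D by fact
  interpret pair_sigma_finite "distr M B X" D ..
  have fm: "f \<in> borel_measurable (distr M B X \<Otimes>\<^sub>M D)" by simp
  have "integrable (distr M B X) (\<lambda>x. \<integral>s. norm (f (x, s)) \<partial>D)"
    by (subst integrable_distr_eq) (use int_norm in auto)
  then have int_pair: "integrable (distr M B X \<Otimes>\<^sub>M D) f"
    using fm int by (intro Fubini_integrable) auto
  then show "integrable M (\<lambda>\<omega>. f (X \<omega>, S \<omega>))"
    unfolding joint[symmetric] by (subst (asm) integrable_distr_eq) auto
  have "(\<integral>\<omega>. f (X \<omega>, S \<omega>) \<partial>M) = integral\<^sup>L (distr M B X \<Otimes>\<^sub>M D) f"
    unfolding joint[symmetric] by (subst integral_distr) auto
  also have "\<dots> = (\<integral>x. (\<integral>s. f (x, s) \<partial>D) \<partial>distr M B X)"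
    using integral_fst'[OF int_pair] by simp
  also have "\<dots> = (\<integral>\<omega>. (\<integral>s. f (X \<omega>, s) \<partial>D) \<partial>M)"
    by (subst integral_distr) auto
  finally show "(\<integral>\<omega>. f (X \<omega>, S \<omega>) \<partial>M) = (\<integral>\<omega>. (\<integral>s. f (X \<omega>, s) \<partial>D) \<partial>M)" .
qed

lemma (in prob_space) second_moment_shift:
  fixes h :: "'a \<Rightarrow> 'b::euclidean_space"
  assumes h: "integrable M h" "(\<integral>s. h s \<partial>M) = 0" and h2: "integrable M (\<lambda>s. (norm (h s))\<^sup>2)"
  shows "integrable M (\<lambda>s. (norm (u + h s))\<^sup>2)"
    and "(\<integral>s. (norm (u + h s))\<^sup>2 \<partial>M) = (norm u)\<^sup>2 + (\<integral>s. (norm (h s))\<^sup>2 \<partial>M)"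
proof -
  have eq: "(norm (u + h s))\<^sup>2 = (norm u)\<^sup>2 + 2 * (u \<bullet> h s) + (norm (h s))\<^sup>2" for s
    unfolding power2_norm_eq_inner by (simp add: inner_add_left inner_add_right inner_commute)
  show "integrable M (\<lambda>s. (norm (u + h s))\<^sup>2)"
    unfolding eq using h h2 by (intro Bochner_Integration.integrable_add integrable_mult_right integrable_inner_right) auto
  have "(\<integral>s. u \<bullet> h s \<partial>M) = 0" using h by simp
  then show "(\<integral>s. (norm (u + h s))\<^sup>2 \<partial>M) = (norm u)\<^sup>2 + (\<integral>s. (norm (h s))\<^sup>2 \<partial>M)"
    unfolding eq using h h2 by (simp add: prob_space)
qed

text \<open>For frozen \<open>X\<close> the increment \<open>h X S\<close> has mean zero, so its product with \<open>u X\<close> vanishes in expectation.\<close>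
lemma (in prob_space) indep_zero_mean_second_moment:
  fixes u :: "'b \<Rightarrow> 'd::euclidean_space" and h :: "'b \<Rightarrow> 'c \<Rightarrow> 'd"
  assumes X: "X \<in> measurable M B" and S: "S \<in> measurable M D"
    and joint: "distr M (B \<Otimes>\<^sub>M D) (\<lambda>\<omega>. (X \<omega>, S \<omega>)) = distr M B X \<Otimes>\<^sub>M D" and D: "prob_space D"
    and u: "u \<in> borel_measurable B" and h: "case_prod h \<in> borel_measurable (B \<Otimes>\<^sub>M D)"
    and h_int: "\<And>x. x \<in> space B \<Longrightarrow> integrable D (h x)"
    and mean: "\<And>x. x \<in> space B \<Longrightarrow> (\<integral>s. h x s \<partial>D) = 0"
    and h2: "\<And>x. x \<in> space B \<Longrightarrow> integrable D (\<lambda>s. (norm (h x s))\<^sup>2)"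
    and u2: "integrable M (\<lambda>\<omega>. (norm (u (X \<omega>)))\<^sup>2)"
    and Eh2: "integrable M (\<lambda>\<omega>. \<integral>s. (norm (h (X \<omega>) s))\<^sup>2 \<partial>D)"
  shows "integrable M (\<lambda>\<omega>. (norm (u (X \<omega>) + h (X \<omega>) (S \<omega>)))\<^sup>2)"
    and "(\<integral>\<omega>. (norm (u (X \<omega>) + h (X \<omega>) (S \<omega>)))\<^sup>2 \<partial>M)
       = (\<integral>\<omega>. (norm (u (X \<omega>)))\<^sup>2 \<partial>M) + (\<integral>\<omega>. (\<integral>s. (norm (h (X \<omega>) s))\<^sup>2 \<partial>D) \<partial>M)"
proof -
  interpret D: prob_space D by fact
  note [measurable] = u h
  define f where "f = (\<lambda>(x, s). (norm (u x + h x s))\<^sup>2)"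
  have f: "f \<in> borel_measurable (B \<Otimes>\<^sub>M D)" unfolding f_def by measurable
  note shift = D.second_moment_shift[OF h_int mean h2]
  have Xs: "X \<omega> \<in> space B" if "\<omega> \<in> space M" for \<omega> using measurable_space[OF X that] .
  have int: "integrable D (\<lambda>s. f (x, s))" if "x \<in> space B" for x
    unfolding f_def using shift(1)[OF that that that] by simp
  have val: "(\<integral>s. f (X \<omega>, s) \<partial>D) = (norm (u (X \<omega>)))\<^sup>2 + (\<integral>s. (norm (h (X \<omega>) s))\<^sup>2 \<partial>D)"
    if "\<omega> \<in> space M" for \<omega>
    unfolding f_def using shift(2)[OF Xs Xs Xs, OF that that that] by simp
  have nf: "norm (f y) = f y" for y unfolding f_def by (simp add: case_prod_unfold)
  have int_norm: "integrable M (\<lambda>\<omega>. \<integral>s. norm (f (X \<omega>, s)) \<partial>D)"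
    unfolding nf
    by (subst Bochner_Integration.integrable_cong[OF refl val]) (use u2 Eh2 in auto)
  note fr = freeze_independent[OF X S joint D f int int_norm]
  from fr(1) show "integrable M (\<lambda>\<omega>. (norm (u (X \<omega>) + h (X \<omega>) (S \<omega>)))\<^sup>2)"
    by (simp add: f_def)
  have "(\<integral>\<omega>. (norm (u (X \<omega>) + h (X \<omega>) (S \<omega>)))\<^sup>2 \<partial>M) = (\<integral>\<omega>. f (X \<omega>, S \<omega>) \<partial>M)"
    by (simp add: f_def)
  also have "\<dots> = (\<integral>\<omega>. (\<integral>s. f (X \<omega>, s) \<partial>D) \<partial>M)" by (rule fr(2))
  also have "\<dots> = (\<integral>\<omega>. (norm (u (X \<omega>)))\<^sup>2 + (\<integral>s. (norm (h (X \<omega>) s))\<^sup>2 \<partial>D) \<partial>M)"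
    by (rule Bochner_Integration.integral_cong[OF refl val])
  also have "\<dots> = (\<integral>\<omega>. (norm (u (X \<omega>)))\<^sup>2 \<partial>M) + (\<integral>\<omega>. (\<integral>s. (norm (h (X \<omega>) s))\<^sup>2 \<partial>D) \<partial>M)"
    using u2 Eh2 by (rule Bochner_Integration.integral_add)
  finally show "(\<integral>\<omega>. (norm (u (X \<omega>) + h (X \<omega>) (S \<omega>)))\<^sup>2 \<partial>M)
       = (\<integral>\<omega>. (norm (u (X \<omega>)))\<^sup>2 \<partial>M) + (\<integral>\<omega>. (\<integral>s. (norm (h (X \<omega>) s))\<^sup>2 \<partial>D) \<partial>M)" .
qed

locale lsarah_draws = prob_space M + D: prob_space D
  for M :: "'w measure" and D :: "'s measure" +
  fixes b n :: "nat \<Rightarrow> nat" and p :: "nat \<Rightarrow> real" and coin :: "nat \<Rightarrow> 'w \<Rightarrow> bool"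
    and mini mega :: "nat \<Rightarrow> nat \<Rightarrow> 'w \<Rightarrow> 's"
  assumes sampling: "lsarah_sampling M D b n p coin mini mega"
begin

abbreviation "evts \<equiv> draw_events M D coin mini mega"
abbreviation "index \<equiv> draw_index b n"

lemma index_simps [simp]:
  "Coin k \<in> index \<longleftrightarrow> 1 \<le> k"
  "Mini k j \<in> index \<longleftrightarrow> 1 \<le> k \<and> j < b k"
  "Mega k j \<in> index \<longleftrightarrow> j < n k"
  by (auto simp: draw_index_def)

lemma coin_rv: "1 \<le> k \<Longrightarrow> coin k \<in> measurable M (count_space UNIV)"
  and coin_prob: "1 \<le> k \<Longrightarrow> prob {\<omega> \<in> space M. coin k \<omega>} = p k"
  and mini_rv: "1 \<le> k \<Longrightarrow> j < b k \<Longrightarrow> mini k j \<in> measurable M D"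
  and mini_law: "1 \<le> k \<Longrightarrow> j < b k \<Longrightarrow> distr M D (mini k j) = D"
  and mega_rv: "j < n k \<Longrightarrow> mega k j \<in> measurable M D"
  and mega_law: "j < n k \<Longrightarrow> distr M D (mega k j) = D"
  and indep_draws: "indep_sets evts index"
  using sampling unfolding lsarah_sampling_def by blast+

lemma evts_subset_Pow: "evts d \<subseteq> Pow (space M)"
  by (cases d) auto

lemma evts_subset_events: "d \<in> index \<Longrightarrow> evts d \<subseteq> events"
  using indep_draws unfolding indep_sets_def by blast

lemma evts_Int_stable: "Int_stable (evts d)"
proof -
  have st: "Int_stable {X -` A \<inter> space M | A. A \<in> sets N}" for X :: "'w \<Rightarrow> 'z" and N :: "'z measure"
    unfolding Int_stable_def
  proof safe
    fix A B assume "A \<in> sets N" "B \<in> sets N"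
    then show "\<exists>C. (X -` A \<inter> space M) \<inter> (X -` B \<inter> space M) = X -` C \<inter> space M \<and> C \<in> sets N"
      by (intro exI[of _ "A \<inter> B"]) auto
  qed
  show ?thesis by (cases d) (simp_all only: draw_events.simps st)
qed

text \<open>The \<open>\<sigma>\<close>-algebra generated by the draws in \<open>A\<close>.\<close>
definition gen :: "draw set \<Rightarrow> 'w measure" where
  "gen A = sigma (space M) (\<Union>d\<in>A. evts d)"

lemma space_gen [simp]: "space (gen A) = space M"
  unfolding gen_def using evts_subset_Pow by (subst space_measure_of) auto

lemma sets_gen: "sets (gen A) = sigma_sets (space M) (\<Union>d\<in>A. evts d)"
  unfolding gen_def using evts_subset_Pow by (subst sets_measure_of) auto

lemma gen_mono: "A \<subseteq> A' \<Longrightarrow> X \<in> measurable (gen A) N \<Longrightarrow> X \<in> measurable (gen A') N"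
proof -
  assume "A \<subseteq> A'" and X: "X \<in> measurable (gen A) N"
  then have "sets (gen A) \<subseteq> sets (gen A')"
    unfolding sets_gen by (intro sigma_sets_mono') auto
  with X show ?thesis by (auto simp: measurable_def)
qed

lemma gen_rv: "A \<subseteq> index \<Longrightarrow> X \<in> measurable (gen A) N \<Longrightarrow> X \<in> measurable M N"
proof -
  assume "A \<subseteq> index" and X: "X \<in> measurable (gen A) N"
  then have "(\<Union>d\<in>A. evts d) \<subseteq> events" using evts_subset_events by blast
  then have "sets (gen A) \<subseteq> events" unfolding sets_gen by (rule sets.sigma_sets_subset)
  with X show ?thesis by (auto simp: measurable_def)
qed

lemma draw_gen_measurable:
  assumes S: "S \<in> measurable M N" and ev: "evts d = {S -` A \<inter> space M | A. A \<in> sets N}" and d: "d \<in> A"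
  shows "S \<in> measurable (gen A) N"
proof (rule measurableI)
  show "S x \<in> space N" if "x \<in> space (gen A)" for x
    using measurable_space[OF S] that by simp
  fix Y assume "Y \<in> sets N"
  then have "S -` Y \<inter> space M \<in> evts d" unfolding ev by blast
  then show "S -` Y \<inter> space (gen A) \<in> sets (gen A)"
    unfolding sets_gen space_gen using d by (intro sigma_sets.Basic) blast
qed

lemma coin_gen: "1 \<le> k \<Longrightarrow> Coin k \<in> A \<Longrightarrow> coin k \<in> measurable (gen A) (count_space UNIV)"
  by (rule draw_gen_measurable[OF coin_rv]) simp_all

lemma mini_gen: "1 \<le> k \<Longrightarrow> j < b k \<Longrightarrow> Mini k j \<in> A \<Longrightarrow> mini k j \<in> measurable (gen A) D"
  by (rule draw_gen_measurable[OF mini_rv]) simp_all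

lemma mega_gen: "j < n k \<Longrightarrow> Mega k j \<in> A \<Longrightarrow> mega k j \<in> measurable (gen A) D"
  by (rule draw_gen_measurable[OF mega_rv]) simp_all

text \<open>A draw outside \<open>A\<close> is independent of everything that is measurable with respect to the draws in
\<open>A\<close>: group the independent family into \<open>A\<close> and the single draw.\<close>
lemma indep_fresh_draw:
  assumes A: "A \<subseteq> index" and d: "d \<in> index" "d \<notin> A"
    and X: "X \<in> measurable (gen A) B"
    and S: "S \<in> measurable M N" and ev: "evts d = {S -` Y \<inter> space M | Y. Y \<in> sets N}"
  shows "distr M (B \<Otimes>\<^sub>M N) (\<lambda>\<omega>. (X \<omega>, S \<omega>)) = distr M B X \<Otimes>\<^sub>M distr M N S"
proof -
  define I where "I = case_bool A {d}"
  have "indep_sets evts (\<Union>j\<in>UNIV. I j)"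
    by (rule indep_sets_mono_index[OF _ indep_draws]) (use A d in \<open>auto simp: I_def split: bool.splits\<close>)
  then have "indep_sets (\<lambda>j. sigma_sets (space M) (\<Union>i\<in>I j. evts i)) UNIV"
    by (rule indep_sets_collect_sigma)
      (use d in \<open>auto simp: evts_Int_stable disjoint_family_on_def I_def split: bool.splits\<close>)
  then have "indep_set (sigma_sets (space M) {X -` Y \<inter> space M | Y. Y \<in> sets B})
      (sigma_sets (space M) {S -` Y \<inter> space M | Y. Y \<in> sets N})"
    unfolding indep_set_def
  proof (rule indep_sets_mono_sets)
    fix j
    have "{X -` Y \<inter> space M | Y. Y \<in> sets B} \<subseteq> sigma_sets (space M) (\<Union>i\<in>A. evts i)"
      using measurable_sets[OF X] unfolding sets_gen by auto
    then have "sigma_sets (space M) {X -` Y \<inter> space M | Y. Y \<in> sets B}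
        \<subseteq> sigma_sets (space M) (\<Union>i\<in>A. evts i)"
      by (rule sigma_sets_mono)
    then show "(case j of True \<Rightarrow> sigma_sets (space M) {X -` Y \<inter> space M | Y. Y \<in> sets B}
        | False \<Rightarrow> sigma_sets (space M) {S -` Y \<inter> space M | Y. Y \<in> sets N})
        \<subseteq> sigma_sets (space M) (\<Union>i\<in>I j. evts i)"
      by (cases j) (auto simp: I_def ev)
  qed
  then have indep: "prob (a \<inter> c) = prob a * prob c"
    if "a \<in> {X -` Y \<inter> space M | Y. Y \<in> sets B}" "c \<in> {S -` Y \<inter> space M | Y. Y \<in> sets N}" for a c
    using that unfolding indep_sets2_eq by blast
  have X': "X \<in> measurable M B" by (rule gen_rv[OF A X])
  note [measurable] = X' S
  interpret DX: prob_space "distr M B X" by (rule prob_space_distr) fact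
  interpret DS: prob_space "distr M N S" by (rule prob_space_distr) fact
  have "distr M B X \<Otimes>\<^sub>M distr M N S = distr M (B \<Otimes>\<^sub>M N) (\<lambda>\<omega>. (X \<omega>, S \<omega>))"
  proof (rule pair_measure_eqI)
    fix Y Z assume "Y \<in> sets (distr M B X)" "Z \<in> sets (distr M N S)"
    then have YZ: "Y \<in> sets B" "Z \<in> sets N" by simp_all
    have "(\<lambda>\<omega>. (X \<omega>, S \<omega>)) -` (Y \<times> Z) \<inter> space M = (X -` Y \<inter> space M) \<inter> (S -` Z \<inter> space M)" by auto
    moreover have "prob ((X -` Y \<inter> space M) \<inter> (S -` Z \<inter> space M))
        = prob (X -` Y \<inter> space M) * prob (S -` Z \<inter> space M)"
      using YZ by (intro indep) auto
    ultimately show "emeasure (distr M B X) Y * emeasure (distr M N S) Z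
        = emeasure (distr M (B \<Otimes>\<^sub>M N) (\<lambda>\<omega>. (X \<omega>, S \<omega>))) (Y \<times> Z)"
      using YZ by (simp add: emeasure_distr emeasure_eq_measure ennreal_mult'')
  qed (auto intro: DX.sigma_finite_measure_axioms DS.sigma_finite_measure_axioms)
  then show ?thesis ..
qed

lemma coin_factor:
  fixes f :: "'w \<Rightarrow> real"
  assumes A: "A \<subseteq> index" and k: "1 \<le> k" "Coin k \<notin> A"
    and f: "f \<in> borel_measurable (gen A)" "integrable M f"
  shows "integrable M (\<lambda>\<omega>. of_bool (coin k \<omega> = c) * f \<omega>)"
    and "(\<integral>\<omega>. of_bool (coin k \<omega> = c) * f \<omega> \<partial>M) = (if c then p k else 1 - p k) * (\<integral>\<omega>. f \<omega> \<partial>M)"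
proof -
  have cm [measurable]: "coin k \<in> measurable M (count_space UNIV)" using coin_rv k by simp
  have fm [measurable]: "f \<in> borel_measurable M" using f(2) by simp
  define N where "N = distr M (count_space UNIV) (coin k)"
  interpret N: prob_space N unfolding N_def by (rule prob_space_distr) fact
  have setsN [measurable_cong]: "sets N = sets (count_space UNIV)" by (simp add: N_def)
  have "distr M (borel \<Otimes>\<^sub>M count_space UNIV) (\<lambda>\<omega>. (f \<omega>, coin k \<omega>)) = distr M borel f \<Otimes>\<^sub>M N"
    unfolding N_def by (rule indep_fresh_draw[OF A _ k(2) f(1) cm]) (use k in auto)
  moreover have "distr M (borel \<Otimes>\<^sub>M count_space UNIV) (\<lambda>\<omega>. (f \<omega>, coin k \<omega>))
      = distr M (borel \<Otimes>\<^sub>M N) (\<lambda>\<omega>. (f \<omega>, coin k \<omega>))"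
    by (rule distr_cong[OF refl sets_pair_measure_cong[OF refl setsN[symmetric]] refl])
  ultimately have joint: "distr M (borel \<Otimes>\<^sub>M N) (\<lambda>\<omega>. (f \<omega>, coin k \<omega>)) = distr M borel f \<Otimes>\<^sub>M N" by simp
  have cN: "coin k \<in> measurable M N" by measurable
  define g where "g = (\<lambda>(x::real, s). of_bool (s = c) * x)"
  have g: "g \<in> borel_measurable (borel \<Otimes>\<^sub>M N)" unfolding g_def by measurable
  have int1: "integrable N (\<lambda>s. of_bool (s = c) :: real)"
    by (rule N.integrable_const_bound[of _ 1]) auto
  have Ncase: "(\<integral>s. of_bool (s = c) \<partial>N) = (if c then p k else 1 - p k)"
  proof -
    have "(\<integral>s. of_bool (s = c) \<partial>N) = (\<integral>\<omega>. (of_bool (coin k \<omega> = c) :: real) \<partial>M)"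
      unfolding N_def by (subst integral_distr) auto
    also have "\<dots> = (\<integral>\<omega>. indicator {\<omega> \<in> space M. coin k \<omega> = c} \<omega> \<partial>M)"
      by (rule Bochner_Integration.integral_cong) (auto simp: indicator_def)
    also have "\<dots> = prob {\<omega> \<in> space M. coin k \<omega> = c}" by simp
    also have "\<dots> = (if c then p k else 1 - p k)"
      using coin_prob[OF k(1)] prob_neg[of "coin k"] by auto
    finally show ?thesis .
  qed
  have int_g: "integrable N (\<lambda>s. g (x, s))" for x unfolding g_def using int1 by simp
  have norm_g: "(\<integral>s. norm (g (x, s)) \<partial>N) = (if c then p k else 1 - p k) * \<bar>x\<bar>" for x
    unfolding g_def Ncase[symmetric] by (simp add: abs_mult)
  have val_g: "(\<integral>s. g (x, s) \<partial>N) = (if c then p k else 1 - p k) * x" for x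
    unfolding g_def Ncase[symmetric] by simp
  have intn: "integrable M (\<lambda>\<omega>. \<integral>s. norm (g (f \<omega>, s)) \<partial>N)"
    unfolding norm_g using f(2) by simp
  note fr = freeze_independent[OF fm cN joint N.prob_space_axioms g int_g intn]
  show "integrable M (\<lambda>\<omega>. of_bool (coin k \<omega> = c) * f \<omega>)"
    using fr(1) by (simp add: g_def)
  show "(\<integral>\<omega>. of_bool (coin k \<omega> = c) * f \<omega> \<partial>M) = (if c then p k else 1 - p k) * (\<integral>\<omega>. f \<omega> \<partial>M)"
    using fr(2) unfolding val_g by (simp add: g_def)
qed

lemma coin_mean:
  assumes "1 \<le> k" shows "(\<integral>\<omega>. of_bool (coin k \<omega>) \<partial>M) = p k"
proof -
  have "(\<integral>\<omega>. (of_bool (coin k \<omega>) :: real) \<partial>M) = (\<integral>\<omega>. indicator {\<omega> \<in> space M. coin k \<omega>} \<omega> \<partial>M)"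
    by (rule Bochner_Integration.integral_cong) (auto simp: indicator_def)
  also have "\<dots> = prob {\<omega> \<in> space M. coin k \<omega>}" using coin_rv[OF assms] by simp
  finally show ?thesis unfolding coin_prob[OF assms] .
qed

lemma p_bounds: "1 \<le> k \<Longrightarrow> 0 \<le> p k \<and> p k \<le> 1"
  using coin_prob[of k] by (metis measure_nonneg prob_le_1)

text \<open>The draws of a batch are added one at a time: each is independent of the history and of the earlier draws of the
batch, so the second moments add up, and the \<open>m\<close> summands carry the factor \<open>1 / m\<^sup>2\<close>.  The event
\<open>c\<close>, known from the draws in \<open>A\<close>, restricts the identity to one outcome of the coin.\<close>
lemma batch_second_moment:
  fixes Y :: "'w \<Rightarrow> 'y" and u :: "'w \<Rightarrow> 'd::euclidean_space" and h :: "'y \<Rightarrow> 's \<Rightarrow> 'd" and c :: "'w \<Rightarrow> bool"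
    and dr :: "nat \<Rightarrow> draw" and S :: "nat \<Rightarrow> 'w \<Rightarrow> 's"
  assumes A: "A \<subseteq> index"
    and dr: "\<And>j. j < m \<Longrightarrow> dr j \<in> index" "\<And>j. j < m \<Longrightarrow> dr j \<notin> A" "inj dr"
    and S: "\<And>j. j < m \<Longrightarrow> S j \<in> measurable M D" "\<And>j. j < m \<Longrightarrow> distr M D (S j) = D"
      "\<And>j. j < m \<Longrightarrow> evts (dr j) = {S j -` Y \<inter> space M | Y. Y \<in> sets D}"
    and Y: "Y \<in> measurable (gen A) B" and u: "u \<in> borel_measurable (gen A)"
    and c: "c \<in> measurable (gen A) (count_space UNIV)"
    and h: "case_prod h \<in> borel_measurable (B \<Otimes>\<^sub>M D)"
    and h_int: "\<And>y. y \<in> space B \<Longrightarrow> integrable D (h y)"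
    and mean: "\<And>y. y \<in> space B \<Longrightarrow> (\<integral>s. h y s \<partial>D) = 0"
    and h2: "\<And>y. y \<in> space B \<Longrightarrow> integrable D (\<lambda>s. (norm (h y s))\<^sup>2)"
    and u2: "integrable M (\<lambda>\<omega>. of_bool (c \<omega>) * (norm (u \<omega>))\<^sup>2)"
    and Eh2: "integrable M (\<lambda>\<omega>. of_bool (c \<omega>) * (\<integral>s. (norm (h (Y \<omega>) s))\<^sup>2 \<partial>D))"
  shows "integrable M (\<lambda>\<omega>. of_bool (c \<omega>) * (norm (u \<omega> + batch_mean m (\<lambda>j. h (Y \<omega>) (S j \<omega>))))\<^sup>2)"
    and "(\<integral>\<omega>. of_bool (c \<omega>) * (norm (u \<omega> + batch_mean m (\<lambda>j. h (Y \<omega>) (S j \<omega>))))\<^sup>2 \<partial>M)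
      = (\<integral>\<omega>. of_bool (c \<omega>) * (norm (u \<omega>))\<^sup>2 \<partial>M)
        + (\<integral>\<omega>. of_bool (c \<omega>) * (\<integral>s. (norm (h (Y \<omega>) s))\<^sup>2 \<partial>D) \<partial>M) / real m"
proof -
  define r where "r = 1 / real m"
  define U where "U i \<omega> = u \<omega> + r *\<^sub>R (\<Sum>j<i. h (Y \<omega>) (S j \<omega>))" for i \<omega>
  define E where "E = (\<integral>\<omega>. of_bool (c \<omega>) * (\<integral>s. (norm (h (Y \<omega>) s))\<^sup>2 \<partial>D) \<partial>M)"
  have main: "U i \<in> borel_measurable (gen (A \<union> dr ` {..<i})) \<and>
      integrable M (\<lambda>\<omega>. of_bool (c \<omega>) * (norm (U i \<omega>))\<^sup>2) \<and>
      (\<integral>\<omega>. of_bool (c \<omega>) * (norm (U i \<omega>))\<^sup>2 \<partial>M)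
        = (\<integral>\<omega>. of_bool (c \<omega>) * (norm (u \<omega>))\<^sup>2 \<partial>M) + real i * r\<^sup>2 * E" if "i \<le> m" for i
    using that
  proof (induction i)
    case 0
    then show ?case using u u2 by (simp add: U_def)
  next
    case (Suc i)
    then have i: "i < m" and IH1: "U i \<in> borel_measurable (gen (A \<union> dr ` {..<i}))"
      and IH2: "integrable M (\<lambda>\<omega>. of_bool (c \<omega>) * (norm (U i \<omega>))\<^sup>2)"
      and IH3: "(\<integral>\<omega>. of_bool (c \<omega>) * (norm (U i \<omega>))\<^sup>2 \<partial>M)
        = (\<integral>\<omega>. of_bool (c \<omega>) * (norm (u \<omega>))\<^sup>2 \<partial>M) + real i * r\<^sup>2 * E" by auto
    define A' where "A' = A \<union> dr ` {..<i}"
    define B' where "B' = (borel :: 'd measure) \<Otimes>\<^sub>M (count_space UNIV :: bool measure) \<Otimes>\<^sub>M B"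
    define X where "X \<omega> = (U i \<omega>, c \<omega>, Y \<omega>)" for \<omega>
    \<comment> \<open>the indicator of \<open>c\<close> is part of the frozen variable, so that the increment stays centred\<close>
    define h' where "h' x s = (case x of (_, c, y) \<Rightarrow> (r * of_bool c) *\<^sub>R h y s)" for x :: "'d \<times> bool \<times> 'y" and s
    define u' where "u' x = (case x of (a, c, _) \<Rightarrow> of_bool c *\<^sub>R a)" for x :: "'d \<times> bool \<times> 'y"
    have A': "A' \<subseteq> index" using A dr(1) i by (auto simp: A'_def)
    have fresh: "dr i \<notin> A'" using dr(2)[OF i] dr(3) by (auto simp: A'_def inj_def)
    note [measurable] = h
    have mX: "X \<in> measurable (gen A') B'"
      unfolding X_def B'_def
      by (intro measurable_Pair) (use IH1 gen_mono[OF _ c] gen_mono[OF _ Y] in \<open>auto simp: A'_def\<close>)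
    have mh': "case_prod h' \<in> borel_measurable (B' \<Otimes>\<^sub>M D)"
      unfolding h'_def B'_def case_prod_unfold by measurable
    have mu': "u' \<in> borel_measurable B'"
      unfolding u'_def B'_def case_prod_unfold by measurable
    have joint: "distr M (B' \<Otimes>\<^sub>M D) (\<lambda>\<omega>. (X \<omega>, S i \<omega>)) = distr M B' X \<Otimes>\<^sub>M D"
      using indep_fresh_draw[OF A' dr(1)[OF i] fresh mX S(1)[OF i] S(3)[OF i]] unfolding S(2)[OF i] .
    have norm_h': "(norm (h' (X \<omega>) s))\<^sup>2 = r\<^sup>2 * (of_bool (c \<omega>) * (norm (h (Y \<omega>) s))\<^sup>2)" for \<omega> s
      by (simp add: h'_def X_def power_mult_distrib)
    have norm_u': "(norm (u' (X \<omega>)))\<^sup>2 = of_bool (c \<omega>) * (norm (U i \<omega>))\<^sup>2" for \<omega>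
      by (simp add: u'_def X_def power_mult_distrib)
    have sum_eq: "(norm (u' (X \<omega>) + h' (X \<omega>) (S i \<omega>)))\<^sup>2 = of_bool (c \<omega>) * (norm (U (Suc i) \<omega>))\<^sup>2" for \<omega>
      by (simp add: u'_def h'_def X_def U_def algebra_simps)
    have hx: "integrable D (h' x) \<and> (\<integral>s. h' x s \<partial>D) = 0 \<and> integrable D (\<lambda>s. (norm (h' x s))\<^sup>2)"
      if "x \<in> space B'" for x
    proof -
      from that obtain a c' y where x: "x = (a, c', y)" and y: "y \<in> space B"
        by (auto simp: B'_def space_pair_measure)
      have "h' x = (\<lambda>s. (r * of_bool c') *\<^sub>R h y s)" by (simp add: h'_def x fun_eq_iff)
      then show ?thesis using h_int[OF y] mean[OF y] h2[OF y] by (simp add: power_mult_distrib)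
    qed
    have u2': "integrable M (\<lambda>\<omega>. (norm (u' (X \<omega>)))\<^sup>2)" unfolding norm_u' by (rule IH2)
    have Eh2': "integrable M (\<lambda>\<omega>. \<integral>s. (norm (h' (X \<omega>) s))\<^sup>2 \<partial>D)" unfolding norm_h' using Eh2 by simp
    note moments = indep_zero_mean_second_moment[OF gen_rv[OF A' mX] S(1)[OF i] joint D.prob_space_axioms
        mu' mh' conjunct1[OF hx] conjunct1[OF conjunct2[OF hx]] conjunct2[OF conjunct2[OF hx]] u2' Eh2']
    have "(\<integral>\<omega>. (\<integral>s. (norm (h' (X \<omega>) s))\<^sup>2 \<partial>D) \<partial>M) = r\<^sup>2 * E"
      unfolding norm_h' E_def by simp
    with moments(2) have eq: "(\<integral>\<omega>. of_bool (c \<omega>) * (norm (U (Suc i) \<omega>))\<^sup>2 \<partial>M)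
        = (\<integral>\<omega>. of_bool (c \<omega>) * (norm (u \<omega>))\<^sup>2 \<partial>M) + real (Suc i) * r\<^sup>2 * E"
      unfolding sum_eq norm_u' IH3 by (simp add: algebra_simps)
    have mU: "U (Suc i) \<in> borel_measurable (gen (A \<union> dr ` {..<Suc i}))"
    proof -
      have [measurable]: "U i \<in> borel_measurable (gen (A \<union> dr ` {..<Suc i}))"
        by (rule gen_mono[OF _ IH1]) auto
      have [measurable]: "Y \<in> measurable (gen (A \<union> dr ` {..<Suc i})) B" by (rule gen_mono[OF _ Y]) auto
      have [measurable]: "S i \<in> measurable (gen (A \<union> dr ` {..<Suc i})) D"
        by (rule draw_gen_measurable[OF S(1)[OF i] S(3)[OF i]]) auto
      have "U (Suc i) = (\<lambda>\<omega>. U i \<omega> + r *\<^sub>R h (Y \<omega>) (S i \<omega>))"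
        by (simp add: U_def fun_eq_iff algebra_simps)
      then show ?thesis by simp
    qed
    from mU moments(1) eq show ?case unfolding sum_eq by simp
  qed
  have Um: "U m \<omega> = u \<omega> + batch_mean m (\<lambda>j. h (Y \<omega>) (S j \<omega>))" for \<omega>
    by (simp add: U_def r_def batch_mean_def)
  have "real m * r\<^sup>2 = r" by (cases "m = 0") (simp_all add: r_def power2_eq_square)
  then show "integrable M (\<lambda>\<omega>. of_bool (c \<omega>) * (norm (u \<omega> + batch_mean m (\<lambda>j. h (Y \<omega>) (S j \<omega>))))\<^sup>2)"
    and "(\<integral>\<omega>. of_bool (c \<omega>) * (norm (u \<omega> + batch_mean m (\<lambda>j. h (Y \<omega>) (S j \<omega>))))\<^sup>2 \<partial>M)
      = (\<integral>\<omega>. of_bool (c \<omega>) * (norm (u \<omega>))\<^sup>2 \<partial>M)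
        + (\<integral>\<omega>. of_bool (c \<omega>) * (\<integral>s. (norm (h (Y \<omega>) s))\<^sup>2 \<partial>D) \<partial>M) / real m"
    using main[of m] unfolding Um E_def by (simp_all add: r_def)
qed

text \<open>A step calls the oracle \<open>n k\<close> times if the coin demands a mega-batch and at most \<open>2 b k\<close> times otherwise; the
indicator of the second event is bounded by 1.\<close>
lemma expected_total_cost_le:
  "expected_total_cost M b n coin K
    \<le> (\<Sum>k<K. (if k = 0 then real (n 0) else real (n k) * p k + 2 * real (b k)) + 1)"
proof -
  define g where "g k \<omega> = (if k = 0 then real (n 0) else real (n k) * of_bool (coin k \<omega>) + 2 * real (b k)) + 1" for k \<omega>
  have ci: "integrable M (\<lambda>\<omega>. of_bool (coin k \<omega>) :: real)" if "1 \<le> k" for k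
    by (rule integrable_const_bound[of _ 1]) (use coin_rv[OF that] in auto)
  have gi: "integrable M (g k)" for k
    by (cases "k = 0") (use ci[of k] in \<open>auto simp: g_def[abs_def]\<close>)
  have gint: "(\<integral>\<omega>. g k \<omega> \<partial>M) = (if k = 0 then real (n 0) else real (n k) * p k + 2 * real (b k)) + 1" for k
    by (cases "k = 0") (use ci[of k] coin_mean[of k] in \<open>auto simp: g_def[abs_def] prob_space\<close>)
  have "expected_total_cost M b n coin K \<le> (\<integral>\<omega>. (\<Sum>k<K. g k \<omega>) \<partial>M)"
    unfolding expected_total_cost_def
  proof (rule integral_mono')
    show "integrable M (\<lambda>\<omega>. \<Sum>k<K. g k \<omega>)" using gi by simp
    show "0 \<le> (\<Sum>k<K. g k \<omega>)" for \<omega> by (intro sum_nonneg) (simp add: g_def)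
    show "real (\<Sum>k<K. oracle_calls b n coin k \<omega> + 1) \<le> (\<Sum>k<K. g k \<omega>)" for \<omega>
      unfolding of_nat_sum by (intro sum_mono) (auto simp: g_def oracle_calls_def)
  qed
  also have "\<dots> = (\<Sum>k<K. (\<integral>\<omega>. g k \<omega> \<partial>M))" using gi by (intro Bochner_Integration.integral_sum) auto
  finally show ?thesis unfolding gint .
qed

end

section \<open>Integrability and estimation error of a run\<close>

lemma norm_diff_squared_le:
  fixes a b :: "'a::real_inner"
  shows "(norm (a - b))\<^sup>2 \<le> 2 * (norm a)\<^sup>2 + 2 * (norm b)\<^sup>2"
proof -
  have "0 \<le> (norm (a + b))\<^sup>2" by simp
  then show ?thesis unfolding power2_norm_eq_inner by (simp add: algebra_simps inner_commute)
qed

locale stochastic_inclusion = resolvent_setting \<rho> lam T + D: prob_space D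
  for \<rho> lam :: real and T :: "'a::euclidean_space \<Rightarrow> 'a set" and D :: "'s measure" +
  fixes FF :: "'a \<Rightarrow> 's \<Rightarrow> 'a" and F :: "'a \<Rightarrow> 'a" and \<sigma> L :: real
  assumes FF_meas: "case_prod FF \<in> borel_measurable (borel \<Otimes>\<^sub>M D)"
    and FF_int: "\<And>x. integrable D (FF x)"
    and F_eq: "\<And>x. F x = (\<integral>s. FF x s \<partial>D)"
    and var_int: "\<And>x. integrable D (\<lambda>s. (norm (FF x s - F x))\<^sup>2)"
    and var: "\<And>x. (\<integral>s. (norm (FF x s - F x))\<^sup>2 \<partial>D) \<le> \<sigma>\<^sup>2"
    and L_pos: "0 < L"
    and coco: "\<And>x y. 1 / L * (\<integral>s. (norm (FF x s - FF y s))\<^sup>2 \<partial>D) \<le> (F x - F y) \<bullet> (x - y)"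
begin

text \<open>The mean squared increment of the oracle between two points.\<close>
definition sq_incr :: "'a \<Rightarrow> 'a \<Rightarrow> real" where
  "sq_incr x y = (\<integral>s. (norm (FF x s - FF y s))\<^sup>2 \<partial>D)"

lemma sq_incr_nonneg: "0 \<le> sq_incr x y" by (simp add: sq_incr_def)

lemma FF_section_meas [measurable]: "FF x \<in> borel_measurable D"
  using FF_int by auto

lemma centered_diff:
  defines "h \<equiv> \<lambda>x y s. (FF x s - FF y s) - (F x - F y)"
  shows "integrable D (h x y)" "(\<integral>s. h x y s \<partial>D) = 0" "integrable D (\<lambda>s. (norm (h x y s))\<^sup>2)"
proof -
  show "integrable D (h x y)" unfolding h_def using FF_int by simp
  show "(\<integral>s. h x y s \<partial>D) = 0"
    unfolding h_def using FF_int by (simp add: F_eq D.prob_space)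
  show "integrable D (\<lambda>s. (norm (h x y s))\<^sup>2)"
  proof (rule Bochner_Integration.integrable_bound)
    show "integrable D (\<lambda>s. 2 * (norm (FF x s - F x))\<^sup>2 + 2 * (norm (FF y s - F y))\<^sup>2)"
      using var_int by simp
    show "(\<lambda>s. (norm (h x y s))\<^sup>2) \<in> borel_measurable D" unfolding h_def by measurable
    have "h x y s = (FF x s - F x) - (FF y s - F y)" for s by (simp add: h_def)
    then show "AE s in D. norm ((norm (h x y s))\<^sup>2)
        \<le> norm (2 * (norm (FF x s - F x))\<^sup>2 + 2 * (norm (FF y s - F y))\<^sup>2)"
      using norm_diff_squared_le by (intro AE_I2) simp
  qed
qed

text \<open>The mean square is the square of the mean plus the variance, so that both the increment of \<open>F\<close> and the variance of the
oracle increment are bounded by \<open>sq_incr\<close>.\<close>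
lemma sq_incr_decomp:
  "sq_incr x y = (norm (F x - F y))\<^sup>2 + (\<integral>s. (norm ((FF x s - FF y s) - (F x - F y)))\<^sup>2 \<partial>D)"
  using D.second_moment_shift(2)[OF centered_diff, of "F x - F y" x y] by (simp add: sq_incr_def)

lemma F_diff_squared_le: "(norm (F x - F y))\<^sup>2 \<le> sq_incr x y"
  unfolding sq_incr_decomp by simp

lemma centered_diff_le: "(\<integral>s. (norm ((FF x s - FF y s) - (F x - F y)))\<^sup>2 \<partial>D) \<le> sq_incr x y"
  unfolding sq_incr_decomp by simp

lemma sq_incr_le_inner: "sq_incr x y \<le> L * ((F x - F y) \<bullet> (x - y))"
  using coco[of x y] L_pos unfolding sq_incr_def by (simp add: field_simps)

text \<open>Cocoercivity bounds \<open>|F x - F y|\<^sup>2\<close> by \<open>L (F x - F y) \<bullet> (x - y)\<close>; Cauchy-Schwarz does the rest.\<close>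
lemma F_lipschitz: "norm (F x - F y) \<le> L * norm (x - y)"
proof -
  have "norm (F x - F y) * norm (F x - F y) \<le> L * ((F x - F y) \<bullet> (x - y))"
    using F_diff_squared_le[of x y] sq_incr_le_inner[of x y] by (simp add: power2_eq_square)
  also have "\<dots> \<le> L * (norm (F x - F y) * norm (x - y))"
    using L_pos by (intro mult_left_mono norm_cauchy_schwarz) auto
  finally have "norm (F x - F y) * norm (F x - F y) \<le> norm (F x - F y) * (L * norm (x - y))"
    by (simp add: mult_ac)
  then show ?thesis
    using L_pos by (cases "norm (F x - F y) = 0") (auto simp: mult_le_cancel_left)
qed

lemma sq_incr_le: "sq_incr x y \<le> L\<^sup>2 * (norm (x - y))\<^sup>2"
proof -
  have "(F x - F y) \<bullet> (x - y) \<le> norm (F x - F y) * norm (x - y)" by (rule norm_cauchy_schwarz)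
  also have "\<dots> \<le> (L * norm (x - y)) * norm (x - y)"
    by (intro mult_right_mono F_lipschitz) auto
  finally have "L * ((F x - F y) \<bullet> (x - y)) \<le> L * ((L * norm (x - y)) * norm (x - y))"
    using L_pos by (intro mult_left_mono) auto
  with sq_incr_le_inner[of x y] show ?thesis by (simp add: power2_eq_square mult_ac)
qed

lemma F_measurable [measurable]: "F \<in> borel_measurable borel"
proof -
  have "L-lipschitz_on UNIV F"
    by (rule lipschitz_onI) (use F_lipschitz L_pos in \<open>auto simp: dist_norm\<close>)
  then show ?thesis by (intro borel_measurable_continuous_onI lipschitz_on_continuous_on)
qed

lemma FF_measurable [measurable (raw)]:
  "X \<in> borel_measurable N \<Longrightarrow> S \<in> measurable N D \<Longrightarrow> (\<lambda>\<omega>. FF (X \<omega>) (S \<omega>)) \<in> borel_measurable N"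
  using measurable_compose[OF measurable_Pair FF_meas, of X N S] by simp

lemma residual_measurable [measurable (raw)]:
  assumes "d \<in> borel_measurable N" "X \<in> borel_measurable N"
  shows "(\<lambda>\<omega>. fb_residual lam T (d \<omega>) (X \<omega>)) \<in> borel_measurable N"
proof -
  have "(\<lambda>(d, x). fb_residual lam T d x) \<in> borel_measurable (borel \<Otimes>\<^sub>M borel)"
    unfolding borel_prod by (rule borel_measurable_continuous_onI[OF continuous_residual])
  from measurable_compose[OF measurable_Pair[OF assms] this] show ?thesis by simp
qed

lemma G_measurable [measurable (raw)]:
  "X \<in> borel_measurable N \<Longrightarrow> (\<lambda>\<omega>. G_op lam F T (X \<omega>)) \<in> borel_measurable N"
  unfolding G_op_def by measurable

lemma sq_incr_measurable [measurable (raw)]: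
  assumes [measurable]: "X \<in> borel_measurable N" "Y \<in> borel_measurable N"
  shows "(\<lambda>\<omega>. sq_incr (X \<omega>) (Y \<omega>)) \<in> borel_measurable N"
  unfolding sq_incr_def by measurable

end

lemma batch_mean_measurable:
  fixes g :: "nat \<Rightarrow> 'w \<Rightarrow> 'a::euclidean_space"
  assumes "\<And>j. j < m \<Longrightarrow> g j \<in> borel_measurable N"
  shows "(\<lambda>\<omega>. batch_mean m (\<lambda>j. g j \<omega>)) \<in> borel_measurable N"
  unfolding batch_mean_def
  by (intro borel_measurable_scaleR borel_measurable_const borel_measurable_sum assms) auto

lemma batch_mean_diff:
  fixes a :: "'a::real_vector"
  assumes "1 \<le> m"
  shows "batch_mean m (\<lambda>j. g j - a) = batch_mean m g - a"
proof -
  have "(1 / real m) *\<^sub>R (real m *\<^sub>R a) = a" using assms by simp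
  then show ?thesis
    by (simp add: batch_mean_def sum_subtractf scaleR_right_diff_distrib sum_constant_scaleR)
qed

definition sq_integrable :: "'w measure \<Rightarrow> ('w \<Rightarrow> 'a::euclidean_space) \<Rightarrow> bool" where
  "sq_integrable M X \<longleftrightarrow> X \<in> borel_measurable M \<and> integrable M (\<lambda>\<omega>. (norm (X \<omega>))\<^sup>2)"

lemma sq_integrable_bound:
  assumes M: "finite_measure M" and X: "X \<in> borel_measurable M"
    and Y: "sq_integrable M Y" and Z: "sq_integrable M Z"
    and le: "\<And>\<omega>. \<omega> \<in> space M \<Longrightarrow> norm (X \<omega>) \<le> c + a * norm (Y \<omega>) + d * norm (Z \<omega>)"
  shows "sq_integrable M X"
  unfolding sq_integrable_def
proof
  interpret finite_measure M by fact
  show "integrable M (\<lambda>\<omega>. (norm (X \<omega>))\<^sup>2)"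
  proof (rule Bochner_Integration.integrable_bound)
    show "integrable M (\<lambda>\<omega>. 3 * c\<^sup>2 + 3 * a\<^sup>2 * (norm (Y \<omega>))\<^sup>2 + 3 * d\<^sup>2 * (norm (Z \<omega>))\<^sup>2)"
      using Y Z unfolding sq_integrable_def by simp
    show "(\<lambda>\<omega>. (norm (X \<omega>))\<^sup>2) \<in> borel_measurable M" using X by measurable
    have "(norm (X \<omega>))\<^sup>2 \<le> 3 * c\<^sup>2 + 3 * a\<^sup>2 * (norm (Y \<omega>))\<^sup>2 + 3 * d\<^sup>2 * (norm (Z \<omega>))\<^sup>2"
      if "\<omega> \<in> space M" for \<omega>
    proof -
      have "(norm (X \<omega>))\<^sup>2 \<le> (c + a * norm (Y \<omega>) + d * norm (Z \<omega>))\<^sup>2"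
        using le[OF that] by (intro power_mono) auto
      also have "\<dots> \<le> 3 * c\<^sup>2 + 3 * (a * norm (Y \<omega>))\<^sup>2 + 3 * (d * norm (Z \<omega>))\<^sup>2"
      proof -
        have "3 * u\<^sup>2 + 3 * v\<^sup>2 + 3 * w\<^sup>2 - (u + v + w)\<^sup>2 = (u - v)\<^sup>2 + (u - w)\<^sup>2 + (v - w)\<^sup>2" for u v w :: real
          by (simp add: power2_eq_square algebra_simps)
        then have "0 \<le> 3 * u\<^sup>2 + 3 * v\<^sup>2 + 3 * w\<^sup>2 - (u + v + w)\<^sup>2" for u v w :: real by simp
        then show ?thesis by (simp only: le_diff_eq add_0)
      qed
      finally show ?thesis by (simp add: power_mult_distrib mult.assoc)
    qed
    then show "AE \<omega> in M. norm ((norm (X \<omega>))\<^sup>2)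
        \<le> norm (3 * c\<^sup>2 + 3 * a\<^sup>2 * (norm (Y \<omega>))\<^sup>2 + 3 * d\<^sup>2 * (norm (Z \<omega>))\<^sup>2)"
      by (intro AE_I2) simp
  qed
qed (rule X)

primrec draw_time :: "draw \<Rightarrow> nat" where
  "draw_time (Coin k) = k"
| "draw_time (Mini k j) = k"
| "draw_time (Mega k j) = k"

locale vfosa_run = stochastic_inclusion \<rho> lam T D FF F \<sigma> L
  + lsarah_draws M D "\<lambda>_. b" "\<lambda>_. n" p coin mini mega
  for \<rho> lam and T :: "'a::euclidean_space \<Rightarrow> 'a set" and D :: "'s measure" and FF F \<sigma> L
    and M :: "'w measure" and b n :: nat
    and p coin mini mega +
  fixes t \<eta> :: "nat \<Rightarrow> real" and \<nu> :: real and x0 :: 'a and Ft x z :: "nat \<Rightarrow> 'w \<Rightarrow> 'a"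
  assumes b1: "1 \<le> b" and n1: "1 \<le> n"
    and estimator: "lsarah_estimator M FF (\<lambda>_. b) (\<lambda>_. n) coin mini mega x Ft"
    and iteration: "vfosa_plus_iteration M lam T t \<eta> \<nu> x0 Ft x z"
begin

text \<open>The draws that determine the iterate \<open>x k\<close>, namely those of the iterations before \<open>k\<close>.\<close>
definition past :: "nat \<Rightarrow> draw set" where "past k = {d \<in> index. draw_time d < k}"

definition err :: "nat \<Rightarrow> 'w \<Rightarrow> 'a" where "err k \<omega> = Ft k \<omega> - F (x k \<omega>)"

definition Gest :: "nat \<Rightarrow> 'w \<Rightarrow> 'a" where "Gest k \<omega> = fb_residual lam T (Ft k \<omega>) (x k \<omega>)"

lemma past_index: "past k \<subseteq> index" by (auto simp: past_def)

lemma past_mono: "k \<le> k' \<Longrightarrow> past k \<subseteq> past k'" by (auto simp: past_def)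

context
  fixes \<omega> assumes \<omega>: "\<omega> \<in> space M"
begin

lemma x_0: "x 0 \<omega> = x0" and z_0: "z 0 \<omega> = x0"
  using iteration \<omega> unfolding vfosa_plus_iteration_def by blast+

lemma x_Suc: "x (Suc k) \<omega> = ((t k - 1) / t k) *\<^sub>R x k \<omega> + (1 / t k) *\<^sub>R z k \<omega> - \<eta> k *\<^sub>R Gest k \<omega>"
  and z_Suc: "z (Suc k) \<omega> = z k \<omega> + \<nu> *\<^sub>R (x (Suc k) \<omega> - (((t k - 1) / t k) *\<^sub>R x k \<omega> + (1 / t k) *\<^sub>R z k \<omega>))"
  using iteration \<omega> unfolding vfosa_plus_iteration_def Let_def Gest_def by blast+

lemma Ft_0: "Ft 0 \<omega> = batch_mean n (\<lambda>j. FF (x 0 \<omega>) (mega 0 j \<omega>))"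
  and Ft_Suc: "Ft (Suc k) \<omega> = (if coin (Suc k) \<omega> then batch_mean n (\<lambda>j. FF (x (Suc k) \<omega>) (mega (Suc k) j \<omega>))
    else Ft k \<omega> + batch_mean b (\<lambda>j. FF (x (Suc k) \<omega>) (mini (Suc k) j \<omega>) - FF (x k \<omega>) (mini (Suc k) j \<omega>)))"
  using estimator \<omega> unfolding lsarah_estimator_def by auto

end

lemma mega_past: "j < n \<Longrightarrow> mega k j \<in> measurable (gen (past (Suc k))) D"
  by (rule mega_gen) (auto simp: past_def)

lemma mini_past: "1 \<le> k \<Longrightarrow> j < b \<Longrightarrow> mini k j \<in> measurable (gen (past (Suc k))) D"
  by (rule mini_gen) (auto simp: past_def)

lemma coin_past: "1 \<le> k \<Longrightarrow> coin k \<in> measurable (gen (past (Suc k))) (count_space UNIV)"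
  by (rule coin_gen) (auto simp: past_def)

lemma past_Suc: "X \<in> measurable (gen (past k)) N \<Longrightarrow> X \<in> measurable (gen (past (Suc k))) N"
  by (rule gen_mono[OF past_mono]) auto

lemma next_iterate_adapted:
  assumes x: "x k \<in> borel_measurable (gen (past (Suc k)))" and z: "z k \<in> borel_measurable (gen (past (Suc k)))"
    and Ft: "Ft k \<in> borel_measurable (gen (past (Suc k)))"
  shows "x (Suc k) \<in> borel_measurable (gen (past (Suc k)))" "z (Suc k) \<in> borel_measurable (gen (past (Suc k)))"
proof -
  note [measurable] = x z Ft
  have [measurable]: "Gest k \<in> borel_measurable (gen (past (Suc k)))"
    unfolding Gest_def by measurable
  show x': "x (Suc k) \<in> borel_measurable (gen (past (Suc k)))"
    by (subst measurable_cong[OF x_Suc]) simp_all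
  note [measurable] = x'
  show "z (Suc k) \<in> borel_measurable (gen (past (Suc k)))"
    by (subst measurable_cong[OF z_Suc]) simp_all
qed

lemma adapted:
  "x k \<in> borel_measurable (gen (past k)) \<and> z k \<in> borel_measurable (gen (past k))
    \<and> Ft k \<in> borel_measurable (gen (past (Suc k)))"
proof (induction k)
  case 0
  have x: "x 0 \<in> borel_measurable (gen A)" "z 0 \<in> borel_measurable (gen A)" for A
    by (subst measurable_cong[of _ _ "\<lambda>_. x0"]; simp add: x_0 z_0)+
  note [measurable] = x
  have "Ft 0 \<in> borel_measurable (gen (past (Suc 0)))"
    by (subst measurable_cong[OF Ft_0])
      (auto intro!: batch_mean_measurable FF_measurable mega_past x)
  with x show ?case by simp
next
  case (Suc k)
  then have x: "x k \<in> borel_measurable (gen (past (Suc k)))" and z: "z k \<in> borel_measurable (gen (past (Suc k)))"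
    and Ft: "Ft k \<in> borel_measurable (gen (past (Suc k)))" by (auto intro: past_Suc)
  note nx = next_iterate_adapted[OF x z Ft]
  note up = past_Suc[OF x] past_Suc[OF nx(1)] past_Suc[OF Ft]
  have c: "{\<omega> \<in> space M. coin (Suc k) \<omega>} \<in> sets (gen (past (Suc (Suc k))))"
    using coin_past[of "Suc k"] by (simp add: pred_def)
  have "Ft (Suc k) \<in> borel_measurable (gen (past (Suc (Suc k))))"
    by (subst measurable_cong[OF Ft_Suc])
      (auto intro!: measurable_If borel_measurable_add borel_measurable_diff batch_mean_measurable FF_measurable
        mega_past mini_past up c)
  with nx show ?case by simp
qed

lemma x_adapted: "x k \<in> borel_measurable (gen (past k))" and z_adapted: "z k \<in> borel_measurable (gen (past k))"
  and Ft_adapted: "Ft k \<in> borel_measurable (gen (past (Suc k)))"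
  using adapted by auto

lemma err_adapted: "err k \<in> borel_measurable (gen (past (Suc k)))"
proof -
  note [measurable] = Ft_adapted past_Suc[OF x_adapted]
  show ?thesis unfolding err_def[abs_def] by measurable
qed

lemma x_meas [measurable]: "x k \<in> borel_measurable M" and z_meas [measurable]: "z k \<in> borel_measurable M"
  and Ft_meas [measurable]: "Ft k \<in> borel_measurable M" and err_meas [measurable]: "err k \<in> borel_measurable M"
  by (rule gen_rv[OF past_index], rule x_adapted z_adapted Ft_adapted err_adapted)+

text \<open>Freezing \<open>x k\<close>, the mega-batch is an average of \<open>n\<close> independent copies with variance at most \<open>\<sigma>\<^sup>2\<close>.  The event \<open>c\<close> is
the coin of the iteration, or the sure event for the first iteration.\<close>
lemma mega_moment:
  assumes A: "A \<subseteq> index" "\<And>j. Mega k j \<notin> A" and xk: "x k \<in> borel_measurable (gen A)"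
    and c: "c \<in> measurable (gen A) (count_space UNIV)"
  shows "integrable M (\<lambda>\<omega>. of_bool (c \<omega>) * (norm (batch_mean n (\<lambda>j. FF (x k \<omega>) (mega k j \<omega>)) - F (x k \<omega>)))\<^sup>2)"
    and "(\<integral>\<omega>. of_bool (c \<omega>) * (norm (batch_mean n (\<lambda>j. FF (x k \<omega>) (mega k j \<omega>)) - F (x k \<omega>)))\<^sup>2 \<partial>M)
      \<le> (\<integral>\<omega>. of_bool (c \<omega>) \<partial>M) * (\<sigma>\<^sup>2 / real n)"
proof -
  define h where "h y s = FF y s - F y" for y s
  have [measurable]: "case_prod h \<in> borel_measurable (borel \<Otimes>\<^sub>M D)" unfolding h_def by measurable
  have cm [measurable]: "c \<in> measurable M (count_space UNIV)" by (rule gen_rv[OF A(1) c])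
  have vm [measurable]: "(\<lambda>\<omega>. \<integral>s. (norm (h (x k \<omega>) s))\<^sup>2 \<partial>D) \<in> borel_measurable M" by measurable
  have v: "(\<integral>s. (norm (h y s))\<^sup>2 \<partial>D) \<le> \<sigma>\<^sup>2" for y unfolding h_def by (rule var)
  have vi: "integrable M (\<lambda>\<omega>. of_bool (c \<omega>) * (\<integral>s. (norm (h (x k \<omega>) s))\<^sup>2 \<partial>D))"
    by (rule integrable_const_bound[of _ "\<sigma>\<^sup>2"]) (use v in \<open>auto simp: of_bool_def\<close>)
  have ci: "integrable M (\<lambda>\<omega>. of_bool (c \<omega>) :: real)"
    by (rule integrable_const_bound[of _ 1]) auto
  have hi: "integrable D (h y)" "(\<integral>s. h y s \<partial>D) = 0" "integrable D (\<lambda>s. (norm (h y s))\<^sup>2)" for y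
    unfolding h_def[abs_def] using FF_int var_int by (simp_all add: F_eq D.prob_space)
  note mom = batch_second_moment[where A = A and m = n and dr = "Mega k" and S = "mega k" and Y = "x k"
      and B = borel and u = "\<lambda>_. 0" and c = c and h = h]
  have eq: "0 + batch_mean n (\<lambda>j. h (x k \<omega>) (mega k j \<omega>)) = batch_mean n (\<lambda>j. FF (x k \<omega>) (mega k j \<omega>)) - F (x k \<omega>)" for \<omega>
    unfolding h_def using batch_mean_diff[OF n1] by simp
  show "integrable M (\<lambda>\<omega>. of_bool (c \<omega>) * (norm (batch_mean n (\<lambda>j. FF (x k \<omega>) (mega k j \<omega>)) - F (x k \<omega>)))\<^sup>2)"
    unfolding eq[symmetric]
    by (rule mom(1)) (use A xk c hi vi mega_rv mega_law in \<open>auto simp: inj_def\<close>)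
  have "(\<integral>\<omega>. of_bool (c \<omega>) * (norm (batch_mean n (\<lambda>j. FF (x k \<omega>) (mega k j \<omega>)) - F (x k \<omega>)))\<^sup>2 \<partial>M)
    = (\<integral>\<omega>. of_bool (c \<omega>) * (norm (0::'a))\<^sup>2 \<partial>M) + (\<integral>\<omega>. of_bool (c \<omega>) * (\<integral>s. (norm (h (x k \<omega>) s))\<^sup>2 \<partial>D) \<partial>M) / real n"
    unfolding eq[symmetric]
    by (rule mom(2)) (use A xk c hi vi mega_rv mega_law in \<open>auto simp: inj_def\<close>)
  also have "(\<integral>\<omega>. of_bool (c \<omega>) * (\<integral>s. (norm (h (x k \<omega>) s))\<^sup>2 \<partial>D) \<partial>M) \<le> (\<integral>\<omega>. of_bool (c \<omega>) * \<sigma>\<^sup>2 \<partial>M)"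
    by (rule integral_mono) (use vi ci v in \<open>auto intro: mult_left_mono\<close>)
  finally show "(\<integral>\<omega>. of_bool (c \<omega>) * (norm (batch_mean n (\<lambda>j. FF (x k \<omega>) (mega k j \<omega>)) - F (x k \<omega>)))\<^sup>2 \<partial>M)
      \<le> (\<integral>\<omega>. of_bool (c \<omega>) \<partial>M) * (\<sigma>\<^sup>2 / real n)" by (simp add: divide_right_mono)
qed

lemma initial_error:
  "integrable M (\<lambda>\<omega>. (norm (err 0 \<omega>))\<^sup>2)" "(\<integral>\<omega>. (norm (err 0 \<omega>))\<^sup>2 \<partial>M) \<le> \<sigma>\<^sup>2 / real n"
proof -
  have "past 0 = {}" by (simp add: past_def)
  then have x0: "x 0 \<in> borel_measurable (gen {})" using x_adapted[of 0] by simp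
  note m = mega_moment[of "{}" 0 "\<lambda>_. True", simplified, OF x0]
  have eq: "(norm (err 0 \<omega>))\<^sup>2 = (norm (batch_mean n (\<lambda>j. FF (x 0 \<omega>) (mega 0 j \<omega>)) - F (x 0 \<omega>)))\<^sup>2"
    if "\<omega> \<in> space M" for \<omega> using that by (simp add: err_def Ft_0)
  show "integrable M (\<lambda>\<omega>. (norm (err 0 \<omega>))\<^sup>2)"
    by (subst Bochner_Integration.integrable_cong[OF refl eq]) (use m in auto)
  show "(\<integral>\<omega>. (norm (err 0 \<omega>))\<^sup>2 \<partial>M) \<le> \<sigma>\<^sup>2 / real n"
    by (subst Bochner_Integration.integral_cong[OF refl eq]) (use m(2) prob_space in auto)
qed

text \<open>With a mega-batch the old error is forgotten.  Otherwise the error changes by a batch average of centred increments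
that is independent of the past, so the second moments add up and each increment has variance at most \<open>sq_incr\<close>.
The coin is independent of both, hence the factors \<open>p\<close> and \<open>1 - p\<close>.\<close>
lemma error_recursion:
  assumes ek: "integrable M (\<lambda>\<omega>. (norm (err k \<omega>))\<^sup>2)"
    and Vk: "integrable M (\<lambda>\<omega>. sq_incr (x (Suc k) \<omega>) (x k \<omega>))"
  shows "integrable M (\<lambda>\<omega>. (norm (err (Suc k) \<omega>))\<^sup>2)"
    and "(\<integral>\<omega>. (norm (err (Suc k) \<omega>))\<^sup>2 \<partial>M) \<le> (1 - p (Suc k)) * ((\<integral>\<omega>. (norm (err k \<omega>))\<^sup>2 \<partial>M)
      + (\<integral>\<omega>. sq_incr (x (Suc k) \<omega>) (x k \<omega>) \<partial>M) / real b) + p (Suc k) * (\<sigma>\<^sup>2 / real n)"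
proof -
  let ?k = "Suc k"
  \<comment> \<open>the coin counts as part of the history when the batch is drawn\<close>
  define A where "A = insert (Coin ?k) (past ?k)"
  have A: "A \<subseteq> index" "\<And>j. Mega ?k j \<notin> A" "\<And>j. Mini ?k j \<notin> A" "past ?k \<subseteq> A" "Coin ?k \<notin> past ?k"
    using past_index by (auto simp: A_def past_def)
  have c: "coin ?k \<in> measurable (gen A) (count_space UNIV)" by (rule coin_gen) (auto simp: A_def)
  have xA: "x ?k \<in> borel_measurable (gen A)" and xkA: "x k \<in> borel_measurable (gen A)"
    and eA: "err k \<in> borel_measurable (gen A)"
    using gen_mono[OF A(4)] x_adapted err_adapted past_Suc by blast+
  have x1: "x k \<in> borel_measurable (gen (past ?k))" using past_Suc x_adapted by blast
  note [measurable] = x_adapted[of ?k] x1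
  have Vm: "(\<lambda>\<omega>. sq_incr (x ?k \<omega>) (x k \<omega>)) \<in> borel_measurable (gen (past ?k))" by measurable
  have em: "(\<lambda>\<omega>. (norm (err k \<omega>))\<^sup>2) \<in> borel_measurable (gen (past ?k))"
    using err_adapted[of k] by measurable
  have k1: "1 \<le> ?k" by simp
  have coinV: "integrable M (\<lambda>\<omega>. of_bool (\<not> coin ?k \<omega>) * sq_incr (x ?k \<omega>) (x k \<omega>))"
    "(\<integral>\<omega>. of_bool (\<not> coin ?k \<omega>) * sq_incr (x ?k \<omega>) (x k \<omega>) \<partial>M) = (1 - p ?k) * (\<integral>\<omega>. sq_incr (x ?k \<omega>) (x k \<omega>) \<partial>M)"
    using coin_factor[OF past_index k1 A(5) Vm Vk, of False] by simp_all
  have coine: "integrable M (\<lambda>\<omega>. of_bool (\<not> coin ?k \<omega>) * (norm (err k \<omega>))\<^sup>2)"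
    "(\<integral>\<omega>. of_bool (\<not> coin ?k \<omega>) * (norm (err k \<omega>))\<^sup>2 \<partial>M) = (1 - p ?k) * (\<integral>\<omega>. (norm (err k \<omega>))\<^sup>2 \<partial>M)"
    using coin_factor[OF past_index k1 A(5) em ek, of False] by simp_all
  define fresh where "fresh \<omega> = of_bool (coin ?k \<omega>) *
      (norm (batch_mean n (\<lambda>j. FF (x ?k \<omega>) (mega ?k j \<omega>)) - F (x ?k \<omega>)))\<^sup>2" for \<omega>
  have fresh: "integrable M fresh" "(\<integral>\<omega>. fresh \<omega> \<partial>M) \<le> p ?k * (\<sigma>\<^sup>2 / real n)"
  proof -
    have "(\<integral>\<omega>. of_bool (coin ?k \<omega>) \<partial>M) = p ?k" by (rule coin_mean[OF k1])
    then show "integrable M fresh" "(\<integral>\<omega>. fresh \<omega> \<partial>M) \<le> p ?k * (\<sigma>\<^sup>2 / real n)"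
      unfolding fresh_def[abs_def] using mega_moment[OF A(1) A(2) xA c] by simp_all
  qed
  define h where "h q s = (FF (fst q) s - FF (snd q) s) - (F (fst q) - F (snd q))" for q :: "'a \<times> 'a" and s
  define Y where "Y \<omega> = (x ?k \<omega>, x k \<omega>)" for \<omega>
  define B where "B = (borel :: 'a measure) \<Otimes>\<^sub>M (borel :: 'a measure)"
  have hm [measurable]: "case_prod h \<in> borel_measurable (B \<Otimes>\<^sub>M D)" unfolding h_def B_def by measurable
  have YA: "Y \<in> measurable (gen A) B" unfolding Y_def[abs_def] B_def using xA xkA by simp
  have [measurable]: "Y \<in> measurable M B" by (rule gen_rv[OF A(1) YA])
  have cM [measurable]: "coin ?k \<in> measurable M (count_space UNIV)" by (rule gen_rv[OF A(1) c])
  have nc: "(\<lambda>\<omega>. \<not> coin ?k \<omega>) \<in> measurable (gen A) (count_space UNIV)" using c by measurable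
  have hV: "(\<integral>s. (norm (h (Y \<omega>) s))\<^sup>2 \<partial>D) \<le> sq_incr (x ?k \<omega>) (x k \<omega>)" for \<omega>
    unfolding h_def Y_def using centered_diff_le by simp
  have hint: "integrable M (\<lambda>\<omega>. of_bool (\<not> coin ?k \<omega>) * (\<integral>s. (norm (h (Y \<omega>) s))\<^sup>2 \<partial>D))"
    by (rule Bochner_Integration.integrable_bound[OF Vk]) (use hV sq_incr_nonneg in \<open>auto simp: of_bool_def\<close>)
  have hq: "integrable D (h q)" "(\<integral>s. h q s \<partial>D) = 0" "integrable D (\<lambda>s. (norm (h q s))\<^sup>2)" for q
    unfolding h_def[abs_def] by (rule centered_diff)+
  define upd where "upd \<omega> = of_bool (\<not> coin ?k \<omega>) *
      (norm (err k \<omega> + batch_mean b (\<lambda>j. h (Y \<omega>) (mini ?k j \<omega>))))\<^sup>2" for \<omega>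
  note mom = batch_second_moment[where A = A and m = b and dr = "Mini ?k" and S = "mini ?k" and Y = Y
      and B = B and u = "err k" and c = "\<lambda>\<omega>. \<not> coin ?k \<omega>" and h = h]
  have upd_int: "integrable M upd"
    unfolding upd_def
    by (rule mom(1)) (use A YA eA nc hq hint hm coine(1) mini_rv mini_law in \<open>auto simp: inj_def\<close>)
  have "(\<integral>\<omega>. upd \<omega> \<partial>M) = (\<integral>\<omega>. of_bool (\<not> coin ?k \<omega>) * (norm (err k \<omega>))\<^sup>2 \<partial>M)
      + (\<integral>\<omega>. of_bool (\<not> coin ?k \<omega>) * (\<integral>s. (norm (h (Y \<omega>) s))\<^sup>2 \<partial>D) \<partial>M) / real b"
    unfolding upd_def
    by (rule mom(2)) (use A YA eA nc hq hint hm coine(1) mini_rv mini_law in \<open>auto simp: inj_def\<close>)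
  also have "(\<integral>\<omega>. of_bool (\<not> coin ?k \<omega>) * (\<integral>s. (norm (h (Y \<omega>) s))\<^sup>2 \<partial>D) \<partial>M)
      \<le> (\<integral>\<omega>. of_bool (\<not> coin ?k \<omega>) * sq_incr (x ?k \<omega>) (x k \<omega>) \<partial>M)"
    by (rule integral_mono) (use hint coinV(1) hV in \<open>auto intro: mult_left_mono\<close>)
  also have "(\<integral>\<omega>. of_bool (\<not> coin ?k \<omega>) * (norm (err k \<omega>))\<^sup>2 \<partial>M)
      + (\<integral>\<omega>. of_bool (\<not> coin ?k \<omega>) * sq_incr (x ?k \<omega>) (x k \<omega>) \<partial>M) / real b
      = (1 - p ?k) * ((\<integral>\<omega>. (norm (err k \<omega>))\<^sup>2 \<partial>M) + (\<integral>\<omega>. sq_incr (x ?k \<omega>) (x k \<omega>) \<partial>M) / real b)"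
    using coinV(2) coine(2) by (simp add: distrib_left)
  finally have upd: "(\<integral>\<omega>. upd \<omega> \<partial>M) \<le> (1 - p ?k) * ((\<integral>\<omega>. (norm (err k \<omega>))\<^sup>2 \<partial>M)
      + (\<integral>\<omega>. sq_incr (x ?k \<omega>) (x k \<omega>) \<partial>M) / real b)" by (simp add: divide_right_mono)
  have eq: "(norm (err ?k \<omega>))\<^sup>2 = upd \<omega> + fresh \<omega>" if "\<omega> \<in> space M" for \<omega>
  proof (cases "coin ?k \<omega>")
    case True
    then show ?thesis using that by (simp add: upd_def fresh_def err_def Ft_Suc)
  next
    case False
    have "batch_mean b (\<lambda>j. h (Y \<omega>) (mini ?k j \<omega>))
        = batch_mean b (\<lambda>j. FF (x ?k \<omega>) (mini ?k j \<omega>) - FF (x k \<omega>) (mini ?k j \<omega>)) - (F (x ?k \<omega>) - F (x k \<omega>))"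
      unfolding h_def Y_def using batch_mean_diff[OF b1] by simp
    then have "err ?k \<omega> = err k \<omega> + batch_mean b (\<lambda>j. h (Y \<omega>) (mini ?k j \<omega>))"
      using that False by (simp add: err_def Ft_Suc)
    then show ?thesis using False by (simp add: upd_def fresh_def)
  qed
  show "integrable M (\<lambda>\<omega>. (norm (err ?k \<omega>))\<^sup>2)"
    by (subst Bochner_Integration.integrable_cong[OF refl eq]) (use upd_int fresh in auto)
  have "(\<integral>\<omega>. (norm (err ?k \<omega>))\<^sup>2 \<partial>M) = (\<integral>\<omega>. upd \<omega> \<partial>M) + (\<integral>\<omega>. fresh \<omega> \<partial>M)"
    by (subst Bochner_Integration.integral_cong[OF refl eq]) (use upd_int fresh in auto)
  with upd fresh(2) show "(\<integral>\<omega>. (norm (err ?k \<omega>))\<^sup>2 \<partial>M) \<le> (1 - p ?k) * ((\<integral>\<omega>. (norm (err k \<omega>))\<^sup>2 \<partial>M)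
      + (\<integral>\<omega>. sq_incr (x ?k \<omega>) (x k \<omega>) \<partial>M) / real b) + p ?k * (\<sigma>\<^sup>2 / real n)" by linarith
qed

lemma sq_incr_integrable:
  assumes "sq_integrable M (x k)" "sq_integrable M (x (Suc k))"
  shows "integrable M (\<lambda>\<omega>. sq_incr (x (Suc k) \<omega>) (x k \<omega>))"
proof (rule Bochner_Integration.integrable_bound)
  show "integrable M (\<lambda>\<omega>. L\<^sup>2 * (2 * (norm (x (Suc k) \<omega>))\<^sup>2 + 2 * (norm (x k \<omega>))\<^sup>2))"
    using assms unfolding sq_integrable_def by simp
  have "sq_incr (x (Suc k) \<omega>) (x k \<omega>) \<le> L\<^sup>2 * (2 * (norm (x (Suc k) \<omega>))\<^sup>2 + 2 * (norm (x k \<omega>))\<^sup>2)" for \<omega>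
    using sq_incr_le norm_diff_squared_le by (meson mult_left_mono order_trans zero_le_power2)
  then show "AE \<omega> in M. norm (sq_incr (x (Suc k) \<omega>) (x k \<omega>)) \<le> norm (L\<^sup>2 * (2 * (norm (x (Suc k) \<omega>))\<^sup>2 + 2 * (norm (x k \<omega>))\<^sup>2))"
    using sq_incr_nonneg by (intro AE_I2) (simp add: order_trans[OF _ abs_ge_self])
qed measurable

lemma sq_integrable_next:
  assumes x: "sq_integrable M (x k)" and z: "sq_integrable M (z k)" and err: "integrable M (\<lambda>\<omega>. (norm (err k \<omega>))\<^sup>2)"
  shows "sq_integrable M (x (Suc k))" "sq_integrable M (z (Suc k))"
proof -
  have e': "sq_integrable M (err k)" using err by (simp add: sq_integrable_def)
  have fm: "finite_measure M" by (rule finite_measure_axioms)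
  have [measurable]: "Gest k \<in> borel_measurable M" unfolding Gest_def[abs_def] by measurable
  have G: "sq_integrable M (Gest k)"
  proof (rule sq_integrable_bound[OF fm _ x e'])
    fix \<omega>
    have "norm (Gest k \<omega>) \<le> norm (fb_residual lam T (F (x k \<omega>)) (x k \<omega>)) + norm (err k \<omega>)"
      using residual_estimate[of "Ft k \<omega>" "x k \<omega>" "F (x k \<omega>)"] norm_triangle_sub[of "Gest k \<omega>"]
      unfolding Gest_def err_def by (meson add_left_mono order_trans)
    moreover have "norm (fb_residual lam T (F (x k \<omega>)) (x k \<omega>))
        \<le> norm (fb_residual lam T (F 0) 0) + ((2 / lam) * norm (x k \<omega>) + L * norm (x k \<omega>))"
      using residual_lipschitz[of "F (x k \<omega>)" "x k \<omega>" "F 0" 0] F_lipschitz[of "x k \<omega>" 0]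
        norm_triangle_sub[of "fb_residual lam T (F (x k \<omega>)) (x k \<omega>)" "fb_residual lam T (F 0) 0"]
      by simp
    ultimately show "norm (Gest k \<omega>) \<le> norm (fb_residual lam T (F 0) 0) + (2 / lam + L) * norm (x k \<omega>) + 1 * norm (err k \<omega>)"
      by (simp add: distrib_right)
  qed measurable
  define y where "y \<omega> = ((t k - 1) / t k) *\<^sub>R x k \<omega> + (1 / t k) *\<^sub>R z k \<omega>" for \<omega>
  have [measurable]: "y \<in> borel_measurable M" unfolding y_def by measurable
  have y: "sq_integrable M y"
  proof (rule sq_integrable_bound[OF fm _ x z])
    fix \<omega> show "norm (y \<omega>) \<le> 0 + \<bar>(t k - 1) / t k\<bar> * norm (x k \<omega>) + \<bar>1 / t k\<bar> * norm (z k \<omega>)"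
      unfolding y_def using norm_triangle_ineq[of "((t k - 1) / t k) *\<^sub>R x k \<omega>" "(1 / t k) *\<^sub>R z k \<omega>"] by simp
  qed measurable
  show "sq_integrable M (x (Suc k))"
  proof (rule sq_integrable_bound[OF fm _ y G])
    fix \<omega> assume "\<omega> \<in> space M"
    then show "norm (x (Suc k) \<omega>) \<le> 0 + 1 * norm (y \<omega>) + \<bar>\<eta> k\<bar> * norm (Gest k \<omega>)"
      using norm_triangle_ineq4[of "y \<omega>" "\<eta> k *\<^sub>R Gest k \<omega>"] by (simp add: x_Suc y_def)
  qed measurable
  show "sq_integrable M (z (Suc k))"
  proof (rule sq_integrable_bound[OF fm _ z G])
    fix \<omega> assume "\<omega> \<in> space M"
    then have "z (Suc k) \<omega> = z k \<omega> - (\<nu> * \<eta> k) *\<^sub>R Gest k \<omega>"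
      by (simp add: z_Suc x_Suc)
    then show "norm (z (Suc k) \<omega>) \<le> 0 + 1 * norm (z k \<omega>) + \<bar>\<nu> * \<eta> k\<bar> * norm (Gest k \<omega>)"
      using norm_triangle_ineq4[of "z k \<omega>" "(\<nu> * \<eta> k) *\<^sub>R Gest k \<omega>"] by simp
  qed measurable
qed

text \<open>The integrability of the error needs that of the increment \<open>sq_incr\<close> between the last two iterates, which in turn
needs the previous error; hence one joint induction.\<close>
lemma sq_integrable_run: "sq_integrable M (x k) \<and> sq_integrable M (z k) \<and> integrable M (\<lambda>\<omega>. (norm (err k \<omega>))\<^sup>2)"
proof (induction k)
  case 0
  have "integrable M (\<lambda>\<omega>. (norm (x 0 \<omega>))\<^sup>2)" "integrable M (\<lambda>\<omega>. (norm (z 0 \<omega>))\<^sup>2)"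
    by (subst Bochner_Integration.integrable_cong[of M M _ "\<lambda>_. (norm x0)\<^sup>2"]; simp add: x_0 z_0)+
  then show ?case using initial_error(1) by (simp add: sq_integrable_def)
next
  case (Suc k)
  then have n: "sq_integrable M (x (Suc k))" "sq_integrable M (z (Suc k))" using sq_integrable_next by blast+
  with Suc sq_incr_integrable have "integrable M (\<lambda>\<omega>. sq_incr (x (Suc k) \<omega>) (x k \<omega>))" by blast
  with Suc n error_recursion(1) show ?case by blast
qed

lemma err_sq_integrable: "integrable M (\<lambda>\<omega>. (norm (err k \<omega>))\<^sup>2)" using sq_integrable_run by blast

lemma sq_incr_run_integrable: "integrable M (\<lambda>\<omega>. sq_incr (x (Suc k) \<omega>) (x k \<omega>))" using sq_integrable_run sq_incr_integrable by blast

lemma residual_sq_integrable: "integrable M (\<lambda>\<omega>. (norm (G_op lam F T (x k \<omega>)))\<^sup>2)"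
proof -
  have "sq_integrable M (\<lambda>\<omega>. G_op lam F T (x k \<omega>))"
  proof (rule sq_integrable_bound)
    show "finite_measure M" by (rule finite_measure_axioms)
    fix \<omega>
    show "norm (G_op lam F T (x k \<omega>)) \<le> norm (G_op lam F T 0) + (2 / lam + L) * norm (x k \<omega>) + 0 * norm (x k \<omega>)"
      using residual_lipschitz[of "F (x k \<omega>)" "x k \<omega>" "F 0" 0] F_lipschitz[of "x k \<omega>" 0]
        norm_triangle_sub[of "G_op lam F T (x k \<omega>)" "G_op lam F T 0"]
      unfolding G_op_def by (simp add: distrib_right)
  qed (use sq_integrable_run in auto)
  then show ?thesis by (simp add: sq_integrable_def)
qed

end

section \<open>Descent, accuracy and cost\<close>

text \<open>Only the excess \<open>\<delta>\<close> of the error over its stationary level \<open>q\<close> can accumulate.  It is carried by the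
potential \<open>\<Lambda> * b * s j * \<delta> j\<close>: the decay \<open>1 - p\<close> of the error exceeds the growth of the weights by \<open>\<epsilon>\<close>, which
pays for one summand \<open>\<omega> * s j * \<delta> j\<close> in each step.\<close>
lemma weighted_error_sum:
  fixes \<Delta> W s p :: "nat \<Rightarrow> real"
  assumes \<Delta>0: "\<Delta> 0 \<le> q"
    and rec: "\<And>k. \<Delta> (Suc k) \<le> (1 - p (Suc k)) * (\<Delta> k + W k / b) + p (Suc k) * q"
    and p: "\<And>k. 0 \<le> p (Suc k)" "\<And>k. p (Suc k) \<le> 1"
    and W: "\<And>k. 0 \<le> W k" and s: "\<And>k. 0 \<le> s k" and b: "0 < b" and \<omega>: "0 \<le> \<omega>" and \<Lambda>: "0 < \<Lambda>"
    and weight: "\<And>k. (1 - p (Suc k)) * s (Suc k) \<le> s k - \<epsilon> * s (Suc k)"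
    and batch: "\<omega> \<le> \<Lambda> * b * \<epsilon>"
  shows "(\<Sum>k<K. \<omega> * s k * \<Delta> k) \<le> (\<Sum>k<K. \<omega> * s k * q) + \<Lambda> * (\<Sum>k<K. s k * W k)"
proof -
  define \<delta> where "\<delta> k = max 0 (\<Delta> k - q)" for k
  have \<delta>: "0 \<le> \<delta> k" "\<Delta> k \<le> q + \<delta> k" for k by (auto simp: \<delta>_def)
  have \<delta>_rec: "\<delta> (Suc k) \<le> (1 - p (Suc k)) * (\<delta> k + W k / b)" for k
  proof -
    have "\<Delta> (Suc k) - q \<le> (1 - p (Suc k)) * (\<Delta> k - q + W k / b)"
      using rec[of k] by (simp add: algebra_simps)
    also have "\<dots> \<le> (1 - p (Suc k)) * (\<delta> k + W k / b)"
      using p(2)[of k] \<delta>(2)[of k] by (intro mult_left_mono) auto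
    finally have "\<Delta> (Suc k) - q \<le> (1 - p (Suc k)) * (\<delta> k + W k / b)" .
    moreover have "0 \<le> (1 - p (Suc k)) * (\<delta> k + W k / b)"
      using p(2)[of k] \<delta>(1)[of k] W[of k] b by simp
    ultimately show ?thesis by (simp add: \<delta>_def)
  qed
  have invariant: "(\<Sum>k\<le>j. \<omega> * s k * \<delta> k) + \<Lambda> * b * s j * \<delta> j \<le> \<Lambda> * (\<Sum>k<j. s k * W k)" for j
  proof (induction j)
    case 0
    then show ?case using \<Delta>0 by (simp add: \<delta>_def)
  next
    case (Suc j)
    have coef: "(\<omega> + \<Lambda> * b) * s (Suc j) * (1 - p (Suc j)) \<le> \<Lambda> * b * s j"
    proof -
      have "\<omega> * s (Suc j) * (1 - p (Suc j)) \<le> \<omega> * s (Suc j)"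
        using p[of j] \<omega> s[of "Suc j"] by (intro mult_left_le) auto
      also have "\<dots> \<le> \<Lambda> * b * \<epsilon> * s (Suc j)" using batch s by (intro mult_right_mono) auto
      finally have "\<omega> * s (Suc j) * (1 - p (Suc j)) \<le> \<Lambda> * b * \<epsilon> * s (Suc j)" .
      moreover have "\<Lambda> * b * ((1 - p (Suc j)) * s (Suc j)) \<le> \<Lambda> * b * (s j - \<epsilon> * s (Suc j))"
        using weight[of j] \<Lambda> b by (intro mult_left_mono) auto
      ultimately show ?thesis by (simp add: algebra_simps)
    qed
    have "(\<omega> + \<Lambda> * b) * s (Suc j) * \<delta> (Suc j)
        \<le> (\<omega> + \<Lambda> * b) * s (Suc j) * ((1 - p (Suc j)) * (\<delta> j + W j / b))"
      using \<delta>_rec[of j] \<omega> \<Lambda> b s by (intro mult_left_mono) auto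
    also have "\<dots> = ((\<omega> + \<Lambda> * b) * s (Suc j) * (1 - p (Suc j))) * (\<delta> j + W j / b)" by simp
    also have "\<dots> \<le> (\<Lambda> * b * s j) * (\<delta> j + W j / b)"
      using coef \<delta>(1)[of j] W[of j] b by (intro mult_right_mono) auto
    also have "\<dots> = \<Lambda> * b * s j * \<delta> j + \<Lambda> * (s j * W j)"
      using b by (simp add: distrib_left)
    finally show ?case using Suc.IH by (simp add: algebra_simps)
  qed
  have "(\<Sum>k<K. \<omega> * s k * \<delta> k) \<le> \<Lambda> * (\<Sum>k<K. s k * W k)"
  proof (cases K)
    case (Suc j)
    have "0 \<le> \<Lambda> * b * s j * \<delta> j" "0 \<le> \<Lambda> * (s j * W j)" using \<Lambda> b s \<delta>(1) W by auto
    moreover have "\<Lambda> * (\<Sum>k<Suc j. s k * W k) = \<Lambda> * (\<Sum>k<j. s k * W k) + \<Lambda> * (s j * W j)"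
      by (simp add: distrib_left)
    moreover have "(\<Sum>k<Suc j. \<omega> * s k * \<delta> k) = (\<Sum>k\<le>j. \<omega> * s k * \<delta> k)"
      by (simp only: lessThan_Suc_atMost)
    ultimately show ?thesis unfolding Suc using invariant[of j] by linarith
  qed simp
  moreover have "(\<Sum>k<K. \<omega> * s k * \<Delta> k) \<le> (\<Sum>k<K. \<omega> * s k * q + \<omega> * s k * \<delta> k)"
    using \<delta>(2) \<omega> s by (intro sum_mono) (auto simp: distrib_left[symmetric] intro!: mult_left_mono)
  ultimately show ?thesis by (simp add: sum.distrib)
qed

locale vfosa_lsarah = vfosa_run \<rho> lam T D FF F \<sigma> L M b n p coin mini mega t \<eta> \<nu> x0 Ft x z
  for \<rho> lam and T :: "'a::euclidean_space \<Rightarrow> 'a set" and D :: "'s measure" and FF F \<sigma> L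
    and M :: "'w measure" and b n p coin mini mega t \<eta> \<nu> x0 Ft x z +
  fixes Lh \<mu> \<beta> \<beta>bar \<Lambda> r \<epsilon> \<Psi>0 :: real and xs :: 'a
  assumes eps: "0 < \<epsilon>" and Lh: "L < Lh" "\<rho> * Lh < 1"
    and mu: "0 < \<mu>" "3 * \<mu> < 2" and nu: "\<nu> = \<mu> / 2"
    and beta: "0 < \<beta>" "\<beta> * (2 + \<mu>) \<le> (2 - \<mu>) * \<beta>bar"
    and betabar: "\<beta>bar = (lam * (4 - Lh * lam) - 4 * \<rho>) / (4 * (1 - \<rho> * Lh))"
    and Lam: "\<Lambda> = (Lh - L) / (L * Lh)"
    and t_eq: "\<And>k. t k = \<mu> * (real k + r)"
    and eta_eq: "\<And>k. \<eta> k = 2 * \<beta> * (t k - 1) / (t k - \<nu>)"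
    and r: "3 + 1 / \<mu> < r"
    and p_eq: "\<And>k. p k = \<epsilon> + 2 * \<mu> / (\<mu> * (real k + r - 1) - 1)"
    and b_ge: "5 * \<beta> / (2 * \<mu>) \<le> \<Lambda> * real b * \<epsilon>"
    and n_ge: "12 * \<sigma>\<^sup>2 * \<Psi>0 \<le> real n * \<mu>\<^sup>2 * \<epsilon> ^ 3"
    and Psi0: "0 \<le> \<Psi>0" "\<Psi>0\<^sup>2 = \<mu>\<^sup>2 * r\<^sup>2 * (norm (G_op lam F T x0))\<^sup>2
      + (2 * r - 1) / (4 * \<beta>\<^sup>2 * (\<mu> * r - 1)) * (norm (x0 - xs))\<^sup>2"
    and xs: "xs \<in> zer (op_plus F T)"
begin

abbreviation "G \<equiv> G_op lam F T"

definition weight :: "nat \<Rightarrow> real" where "weight k = t k * (t k - 1)"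

lemma mu_r: "1 + 3 * \<mu> < \<mu> * r"
proof -
  have "\<mu> * (3 + 1 / \<mu>) < \<mu> * r" using r mu by (intro mult_strict_left_mono) auto
  then show ?thesis using mu by (simp add: algebra_simps)
qed

lemma t_ge: "1 + 3 * \<mu> < t k"
proof -
  have "0 \<le> \<mu> * real k" using mu by simp
  then show ?thesis using mu_r by (simp add: t_eq algebra_simps)
qed

lemma t_Suc: "t (Suc k) = t k + \<mu>"
  by (simp add: t_eq algebra_simps)

lemma weight_nonneg: "0 \<le> weight k"
  using t_ge[of k] mu by (simp add: weight_def)

lemma Lambda_pos: "0 < \<Lambda>"
  unfolding Lam using Lh L_pos by simp

lemma beta_le: "\<beta> \<le> \<beta>bar"
proof -
  have "(2 - \<mu>) * \<beta> \<le> \<beta> * (2 + \<mu>)" using mu beta by (simp add: algebra_simps)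
  also have "\<dots> \<le> (2 - \<mu>) * \<beta>bar" by (rule beta)
  finally show ?thesis using mu by (simp add: mult_le_cancel_left)
qed

lemma nu_conditions: "0 < \<nu>" "3 * \<nu> < 1" "1 + 6 * \<nu> \<le> t k" "\<beta> * (1 + \<nu>) \<le> \<beta>bar * (1 - \<nu>)"
  using mu nu t_ge[of k] beta(2) by (auto simp: algebra_simps)

lemma G_cocoercive: "\<beta>bar * (norm (G a - G c))\<^sup>2 + \<Lambda> * sq_incr a c \<le> (G a - G c) \<bullet> (a - c)"
  unfolding betabar Lam
  by (rule residual_cocoercive) (use L_pos Lh coco[of a c] F_diff_squared_le in \<open>auto simp: sq_incr_def\<close>)

lemma G_xs: "G xs = 0"
  by (rule residual_zero) (rule xs)

definition lyap :: "nat \<Rightarrow> 'w \<Rightarrow> real" where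
  "lyap k \<omega> = lyapunov \<beta> \<nu> (t k) (G (x k \<omega>)) (z k \<omega> - x k \<omega>) (z k \<omega> - xs)"

lemma G_solution: "\<beta>bar * (norm (G (x k \<omega>)))\<^sup>2 \<le> G (x k \<omega>) \<bullet> ((z k \<omega> - xs) - (z k \<omega> - x k \<omega>))"
proof -
  have "0 \<le> \<Lambda> * sq_incr (x k \<omega>) xs" using Lambda_pos sq_incr_nonneg by simp
  then show ?thesis using G_cocoercive[of "x k \<omega>" xs] unfolding G_xs by simp
qed

text \<open>The error of the residual is at most the error of the estimator, as the resolvent is nonexpansive.\<close>
lemma lyap_step:
  assumes \<omega>: "\<omega> \<in> space M"
  shows "lyap (Suc k) \<omega> \<le> lyap k \<omega> + 5 * \<beta> / (2 * \<mu>) * weight k * (norm (err k \<omega>))\<^sup>2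
    - \<Lambda> * (weight k * sq_incr (x (Suc k) \<omega>) (x k \<omega>))"
proof -
  define w where "w = Gest k \<omega> - G (x k \<omega>)"
  have Gest: "Gest k \<omega> = G (x k \<omega>) + w" by (simp add: w_def)
  have t0: "t k \<noteq> 0" "t k > 0" using t_ge[of k] mu by auto
  have c: "(t k - 1) / t k = 1 - 1 / t k" using t0 by (simp add: diff_divide_distrib)
  have z': "z (Suc k) \<omega> = z k \<omega> - (\<nu> * \<eta> k) *\<^sub>R Gest k \<omega>"
    using \<omega> by (simp add: z_Suc x_Suc)
  have x': "x (Suc k) \<omega> - x k \<omega> = (1 / t k) *\<^sub>R (z k \<omega> - x k \<omega>) - \<eta> k *\<^sub>R Gest k \<omega>"
    using \<omega> by (simp add: x_Suc c algebra_simps)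
  have v': "z (Suc k) \<omega> - x (Suc k) \<omega> = (1 - 1 / t k) *\<^sub>R (z k \<omega> - x k \<omega>) + ((1 - \<nu>) * \<eta> k) *\<^sub>R Gest k \<omega>"
    using \<omega> unfolding z' by (simp add: x_Suc c algebra_simps)
  have "lyapunov \<beta> \<nu> (t k + 2 * \<nu>) (G (x (Suc k) \<omega>)) (z (Suc k) \<omega> - x (Suc k) \<omega>) (z (Suc k) \<omega> - xs)
    \<le> lyapunov \<beta> \<nu> (t k) (G (x k \<omega>)) (z k \<omega> - x k \<omega>) (z k \<omega> - xs)
      + 5 * \<beta> / (4 * \<nu>) * (t k * (t k - 1)) * (norm w)\<^sup>2 - t k * (t k - 1) * (\<Lambda> * sq_incr (x (Suc k) \<omega>) (x k \<omega>))"
  proof (rule lyapunov_step[OF nu_conditions(1,2,3) beta(1) nu_conditions(4) eta_eq])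
    show "z (Suc k) \<omega> - x (Suc k) \<omega>
        = (1 - 1 / t k) *\<^sub>R (z k \<omega> - x k \<omega>) + ((1 - \<nu>) * \<eta> k) *\<^sub>R (G (x k \<omega>) + w)"
      unfolding v' Gest ..
    show "z (Suc k) \<omega> - xs = z k \<omega> - xs - (\<nu> * \<eta> k) *\<^sub>R (G (x k \<omega>) + w)"
      unfolding z' Gest by simp
    show "\<beta>bar * (norm (G (x (Suc k) \<omega>) - G (x k \<omega>)))\<^sup>2 + \<Lambda> * sq_incr (x (Suc k) \<omega>) (x k \<omega>)
        \<le> (G (x (Suc k) \<omega>) - G (x k \<omega>)) \<bullet> ((1 / t k) *\<^sub>R (z k \<omega> - x k \<omega>) - \<eta> k *\<^sub>R (G (x k \<omega>) + w))"
      using G_cocoercive unfolding x'[symmetric] Gest[symmetric] .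
  qed (rule G_solution)
  moreover have "5 * \<beta> / (4 * \<nu>) * (t k * (t k - 1)) * (norm w)\<^sup>2 \<le> 5 * \<beta> / (2 * \<mu>) * weight k * (norm (err k \<omega>))\<^sup>2"
  proof -
    have "norm w \<le> norm (err k \<omega>)"
      unfolding w_def Gest_def G_op_def err_def by (rule residual_estimate)
    then have "(norm w)\<^sup>2 \<le> (norm (err k \<omega>))\<^sup>2" by (intro power_mono) auto
    then have "5 * \<beta> / (2 * \<mu>) * weight k * (norm w)\<^sup>2 \<le> 5 * \<beta> / (2 * \<mu>) * weight k * (norm (err k \<omega>))\<^sup>2"
      using beta mu weight_nonneg by (intro mult_left_mono) auto
    then show ?thesis by (simp add: nu weight_def)
  qed
  moreover have "t k + 2 * \<nu> = t (Suc k)" by (simp add: t_Suc nu)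
  ultimately show ?thesis unfolding lyap_def weight_def by (simp add: mult_ac)
qed

text \<open>The coefficient of \<open>|x0 - xs|\<^sup>2\<close> agrees exactly with the one in \<open>\<Psi>0\<^sup>2\<close>, and \<open>v = 0\<close> at the start.\<close>
lemma lyap_initial:
  assumes \<omega>: "\<omega> \<in> space M" shows "lyap 0 \<omega> \<le> \<beta> * \<Psi>0\<^sup>2"
proof -
  have t0: "t 0 = \<mu> * r" by (simp add: t_eq)
  have pos: "\<mu> * r - 1 > 0" using mu_r mu by linarith
  have "\<beta> * (t 0 - 2 * \<nu>) * (t 0 - 2 * \<nu> - 1) * (norm (G x0))\<^sup>2 \<le> \<beta> * (\<mu>\<^sup>2 * r\<^sup>2 * (norm (G x0))\<^sup>2)"
  proof -
    have "(t 0 - 2 * \<nu>) * (t 0 - 2 * \<nu> - 1) \<le> (\<mu> * r) * (\<mu> * r)"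
      unfolding t0 nu using mu_r mu by (intro mult_mono) auto
    then have "\<beta> * (((t 0 - 2 * \<nu>) * (t 0 - 2 * \<nu> - 1)) * (norm (G x0))\<^sup>2) \<le> \<beta> * ((\<mu> * r) * (\<mu> * r) * (norm (G x0))\<^sup>2)"
      using beta by (intro mult_left_mono mult_right_mono) auto
    then show ?thesis by (simp add: power2_eq_square mult_ac)
  qed
  moreover have "(t 0 - \<nu>) / (4 * \<beta> * \<nu> * (t 0 - 1)) * (norm (x0 - xs))\<^sup>2
      = \<beta> * ((2 * r - 1) / (4 * \<beta>\<^sup>2 * (\<mu> * r - 1)) * (norm (x0 - xs))\<^sup>2)"
  proof -
    have "(t 0 - \<nu>) / (4 * \<beta> * \<nu> * (t 0 - 1)) = \<beta> * ((2 * r - 1) / (4 * \<beta>\<^sup>2 * (\<mu> * r - 1)))"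
      unfolding t0 nu using pos mu beta by (simp add: divide_simps power2_eq_square) (simp add: algebra_simps)
    then show ?thesis by simp
  qed
  ultimately show ?thesis
    unfolding lyap_def lyapunov_def Psi0(2) using \<omega> by (simp add: x_0 z_0 distrib_left)
qed

lemma lyap_telescope:
  assumes \<omega>: "\<omega> \<in> space M"
  shows "lyap K \<omega> \<le> \<beta> * \<Psi>0\<^sup>2 + (\<Sum>k<K. 5 * \<beta> / (2 * \<mu>) * weight k * (norm (err k \<omega>))\<^sup>2)
    - \<Lambda> * (\<Sum>k<K. weight k * sq_incr (x (Suc k) \<omega>) (x k \<omega>))"
proof (induction K)
  case 0
  then show ?case using lyap_initial[OF \<omega>] by simp
next
  case (Suc K)
  then show ?case using lyap_step[OF \<omega>, of K] by (simp add: distrib_left)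
qed

text \<open>The summand \<open>2 \<mu> / (t k - 1)\<close> of the probability outweighs the relative growth of
\<open>t (t - 1)\<close>, which is about \<open>2 \<mu> / t\<close>.\<close>
lemma weight_decay: "(1 - p (Suc k)) * weight (Suc k) \<le> weight k - \<epsilon> * weight (Suc k)"
proof -
  define a where "a = t k - 1"
  have a: "a > 3 * \<mu>" using t_ge[of k] by (simp add: a_def)
  have a0: "a > 0" using a mu by simp
  have p: "p (Suc k) = \<epsilon> + 2 * \<mu> / a" by (simp add: p_eq a_def t_eq)
  have "(1 - 2 * \<mu> / a) * weight (Suc k) \<le> weight k"
  proof -
    have "(a - 2 * \<mu>) * ((a + 1 + \<mu>) * (a + \<mu>)) \<le> a * ((a + 1) * a)"
    proof -
      have "a * ((a + 1) * a) - (a - 2 * \<mu>) * ((a + 1 + \<mu>) * (a + \<mu>)) = (\<mu> + 3 * \<mu>\<^sup>2) * a + 2 * \<mu>\<^sup>2 * (1 + \<mu>)"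
        by (simp add: power2_eq_square algebra_simps)
      moreover have "0 \<le> (\<mu> + 3 * \<mu>\<^sup>2) * a + 2 * \<mu>\<^sup>2 * (1 + \<mu>)" using mu a0 by simp
      ultimately show ?thesis by linarith
    qed
    then have "(a - 2 * \<mu>) * ((a + 1 + \<mu>) * (a + \<mu>)) / a \<le> (a + 1) * a"
      using a0 by (simp add: pos_divide_le_eq mult_ac)
    moreover have "(1 - 2 * \<mu> / a) = (a - 2 * \<mu>) / a" using a0 by (simp add: diff_divide_distrib)
    moreover have "weight (Suc k) = (a + 1 + \<mu>) * (a + \<mu>)" "weight k = (a + 1) * a"
      by (simp_all add: weight_def t_Suc a_def)
    ultimately show ?thesis by simp
  qed
  then show ?thesis unfolding p by (simp add: algebra_simps)
qed

text \<open>The primitive \<open>(t - \<mu>)\<^sup>3 / (3 \<mu>)\<close> grows by at least \<open>t (t - 1)\<close> when \<open>t\<close> increases by \<open>\<mu>\<close>.\<close>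
lemma sum_weight_le: "(\<Sum>k<K. weight k) \<le> (t K - \<mu>) ^ 3 / (3 * \<mu>)"
proof (induction K)
  case 0
  then show ?case using t_ge[of 0] mu by simp
next
  case (Suc K)
  have "weight K \<le> (t K ^ 3 - (t K - \<mu>) ^ 3) / (3 * \<mu>)"
  proof -
    have "(t K ^ 3 - (t K - \<mu>) ^ 3) / (3 * \<mu>) = (t K)\<^sup>2 - \<mu> * t K + \<mu>\<^sup>2 / 3"
      using mu by (simp add: field_simps power2_eq_square power3_eq_cube)
    moreover have "\<mu> * t K \<le> 1 * t K" using mu t_ge[of K] by (intro mult_right_mono) auto
    moreover have "0 \<le> \<mu>\<^sup>2 / 3" by simp
    moreover have "weight K = (t K)\<^sup>2 - t K" by (simp add: weight_def power2_eq_square algebra_simps)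
    ultimately show ?thesis by linarith
  qed
  with Suc show ?case by (simp add: t_Suc diff_divide_distrib)
qed

lemma residual_moment_bound:
  "2 / 3 * (t K - \<mu>)\<^sup>2 * (\<integral>\<omega>. (norm (G (x K \<omega>)))\<^sup>2 \<partial>M)
    \<le> \<Psi>0\<^sup>2 + 5 / (2 * \<mu>) * (\<sigma>\<^sup>2 / real n) * (\<Sum>k<K. weight k)"
proof -
  let ?c = "5 * \<beta> / (2 * \<mu>)"
  define \<Delta> W where "\<Delta> k = (\<integral>\<omega>. (norm (err k \<omega>))\<^sup>2 \<partial>M)" and "W k = (\<integral>\<omega>. sq_incr (x (Suc k) \<omega>) (x k \<omega>) \<partial>M)" for k
  have "2 / 3 * \<beta> * (t K - \<mu>)\<^sup>2 * (\<integral>\<omega>. (norm (G (x K \<omega>)))\<^sup>2 \<partial>M)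
      = (\<integral>\<omega>. 2 / 3 * \<beta> * (t K - \<mu>)\<^sup>2 * (norm (G (x K \<omega>)))\<^sup>2 \<partial>M)" by simp
  also have "\<dots> \<le> (\<integral>\<omega>. \<beta> * \<Psi>0\<^sup>2 + (\<Sum>k<K. ?c * weight k * (norm (err k \<omega>))\<^sup>2)
      - \<Lambda> * (\<Sum>k<K. weight k * sq_incr (x (Suc k) \<omega>) (x k \<omega>)) \<partial>M)"
  proof (rule integral_mono)
    show "integrable M (\<lambda>\<omega>. 2 / 3 * \<beta> * (t K - \<mu>)\<^sup>2 * (norm (G (x K \<omega>)))\<^sup>2)"
      using residual_sq_integrable[of K] by simp
    show "integrable M (\<lambda>\<omega>. \<beta> * \<Psi>0\<^sup>2 + (\<Sum>k<K. ?c * weight k * (norm (err k \<omega>))\<^sup>2)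
      - \<Lambda> * (\<Sum>k<K. weight k * sq_incr (x (Suc k) \<omega>) (x k \<omega>)))"
      using err_sq_integrable sq_incr_run_integrable by (intro Bochner_Integration.integrable_diff Bochner_Integration.integrable_add
        integrable_mult_right Bochner_Integration.integrable_sum integrable_const) auto
    fix \<omega> assume \<omega>: "\<omega> \<in> space M"
    have "2 / 3 * \<beta> * (t K - 2 * \<nu>)\<^sup>2 * (norm (G (x K \<omega>)))\<^sup>2 \<le> lyap K \<omega>"
      unfolding lyap_def
      by (rule lyapunov_lower_bound[OF nu_conditions(1,2,3) beta(1) beta_le G_solution])
    also note lyap_telescope[OF \<omega>]
    finally show "2 / 3 * \<beta> * (t K - \<mu>)\<^sup>2 * (norm (G (x K \<omega>)))\<^sup>2
      \<le> \<beta> * \<Psi>0\<^sup>2 + (\<Sum>k<K. ?c * weight k * (norm (err k \<omega>))\<^sup>2)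
        - \<Lambda> * (\<Sum>k<K. weight k * sq_incr (x (Suc k) \<omega>) (x k \<omega>))" by (simp add: nu)
  qed
  also have "\<dots> = \<beta> * \<Psi>0\<^sup>2 + (\<Sum>k<K. ?c * weight k * \<Delta> k) - \<Lambda> * (\<Sum>k<K. weight k * W k)"
    unfolding \<Delta>_def W_def using err_sq_integrable sq_incr_run_integrable
    by (subst Bochner_Integration.integral_diff Bochner_Integration.integral_add;
        simp add: Bochner_Integration.integral_sum prob_space)+
  also have "\<dots> \<le> \<beta> * \<Psi>0\<^sup>2 + (\<Sum>k<K. ?c * weight k * (\<sigma>\<^sup>2 / real n))"
  proof -
    have "(\<Sum>k<K. ?c * weight k * \<Delta> k) \<le> (\<Sum>k<K. ?c * weight k * (\<sigma>\<^sup>2 / real n)) + \<Lambda> * (\<Sum>k<K. weight k * W k)"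
    proof (rule weighted_error_sum[where b = "real b" and p = p and \<epsilon> = \<epsilon>])
      show "\<Delta> 0 \<le> \<sigma>\<^sup>2 / real n" unfolding \<Delta>_def by (rule initial_error)
      show "\<Delta> (Suc k) \<le> (1 - p (Suc k)) * (\<Delta> k + W k / real b) + p (Suc k) * (\<sigma>\<^sup>2 / real n)" for k
        unfolding \<Delta>_def W_def by (rule error_recursion(2)[OF err_sq_integrable sq_incr_run_integrable])
      show "0 \<le> W k" for k unfolding W_def by (intro Bochner_Integration.integral_nonneg) (rule sq_incr_nonneg)
    qed (use p_bounds weight_nonneg b1 beta mu Lambda_pos weight_decay b_ge in auto)
    then show ?thesis by linarith
  qed
  also have "\<dots> = \<beta> * (\<Psi>0\<^sup>2 + 5 / (2 * \<mu>) * (\<sigma>\<^sup>2 / real n) * (\<Sum>k<K. weight k))"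
  proof -
    have sum: "(\<Sum>k<K. c * weight k * q) = c * q * (\<Sum>k<K. weight k)" for c q
      unfolding sum_distrib_left by (rule sum.cong) (simp_all only: mult_ac)
    have "\<beta> * \<Psi>0\<^sup>2 + 5 * \<beta> / (2 * \<mu>) * q * S = \<beta> * (\<Psi>0\<^sup>2 + 5 / (2 * \<mu>) * q * S)" for q S
      by (simp add: distrib_left)
    then show ?thesis unfolding sum .
  qed
  finally have "\<beta> * (2 / 3 * (t K - \<mu>)\<^sup>2 * (\<integral>\<omega>. (norm (G (x K \<omega>)))\<^sup>2 \<partial>M))
      \<le> \<beta> * (\<Psi>0\<^sup>2 + 5 / (2 * \<mu>) * (\<sigma>\<^sup>2 / real n) * (\<Sum>k<K. weight k))" by (simp add: mult_ac)
  then show ?thesis using beta by (simp only: mult_le_cancel_left_pos)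
qed

text \<open>\<open>K\<close> is the first index at which \<open>\<tau> = t K - \<mu>\<close> reaches \<open>2 \<Psi>0 / \<epsilon>\<close>.  Then the initial term is at most
\<open>\<epsilon>\<^sup>2 / 4\<close>.  If \<open>K > 0\<close>, then \<open>\<tau>\<close> overshoots by at most a factor 2, and the lower bound on \<open>n\<close> makes the
variance term at most \<open>5 \<epsilon>\<^sup>2 / 18\<close>; for \<open>K = 0\<close> that term is an empty sum.\<close>
lemma epsilon_solution:
  "\<exists>K. (\<integral>\<omega>. (norm (G (x K \<omega>)))\<^sup>2 \<partial>M) \<le> \<epsilon>\<^sup>2 \<and> real K \<le> 2 * \<Psi>0 / \<mu> / \<epsilon>"
proof -
  define \<tau> where "\<tau> k = t k - \<mu>" for k
  have \<tau>: "\<tau> k = \<mu> * (real k + r - 1)" for k by (simp add: \<tau>_def t_eq algebra_simps)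
  have \<tau>_pos: "\<tau> k > \<mu>" "\<tau> k > 0" for k using t_ge[of k] mu by (auto simp: \<tau>_def)
  have \<tau>_Suc: "\<tau> (Suc k) = \<tau> k + \<mu>" for k by (simp add: \<tau> algebra_simps)
  define Q where "Q K \<longleftrightarrow> 2 * \<Psi>0 / \<epsilon> \<le> \<tau> K" for K
  have "\<exists>K. Q K"
  proof -
    obtain K :: nat where "2 * \<Psi>0 / \<epsilon> / \<mu> - r + 1 \<le> real K" using real_arch_simple by blast
    then have "\<mu> * (2 * \<Psi>0 / \<epsilon> / \<mu>) \<le> \<tau> K" unfolding \<tau> using mu by (intro mult_left_mono) auto
    then show ?thesis using mu by (auto simp: Q_def)
  qed
  define K where "K = (LEAST K. Q K)"
  have QK: "Q K" unfolding K_def by (rule LeastI_ex) fact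
  have before: "\<not> Q j" if "K = Suc j" for j
    using not_less_Least[of j Q] that by (simp add: K_def)
  define I where "I = (\<integral>\<omega>. (norm (G (x K \<omega>)))\<^sup>2 \<partial>M)"
  have main: "2 / 3 * (\<tau> K)\<^sup>2 * I \<le> \<Psi>0\<^sup>2 + 5 / (2 * \<mu>) * (\<sigma>\<^sup>2 / real n) * (\<Sum>k<K. weight k)"
    unfolding I_def \<tau>_def by (rule residual_moment_bound)
  have first: "\<Psi>0\<^sup>2 \<le> \<epsilon>\<^sup>2 / 4 * (\<tau> K)\<^sup>2"
  proof -
    have "\<Psi>0 \<le> \<epsilon> / 2 * \<tau> K" using QK eps by (simp add: Q_def field_simps)
    then have "\<Psi>0\<^sup>2 \<le> (\<epsilon> / 2 * \<tau> K)\<^sup>2" using Psi0 by (intro power_mono) auto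
    then show ?thesis by (simp add: power_mult_distrib power_divide)
  qed
  have second: "5 / (2 * \<mu>) * (\<sigma>\<^sup>2 / real n) * (\<Sum>k<K. weight k) \<le> 5 * \<epsilon>\<^sup>2 / 18 * (\<tau> K)\<^sup>2"
  proof (cases K)
    case 0
    then show ?thesis by simp
  next
    case (Suc j)
    have "\<tau> j < 2 * \<Psi>0 / \<epsilon>" using before[OF Suc] by (simp add: Q_def)
    then have "\<tau> K \<le> 4 * \<Psi>0 / \<epsilon>" using \<tau>_Suc[of j] \<tau>_pos(1)[of j] by (simp add: Suc)
    then have "\<sigma>\<^sup>2 * \<tau> K \<le> \<sigma>\<^sup>2 * (4 * \<Psi>0 / \<epsilon>)" by (intro mult_left_mono) auto
    also have "\<dots> = (12 * \<sigma>\<^sup>2 * \<Psi>0) / (3 * \<epsilon>)" using eps by (simp add: field_simps)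
    also have "\<dots> \<le> (real n * \<mu>\<^sup>2 * \<epsilon> ^ 3) / (3 * \<epsilon>)"
      using n_ge eps by (intro divide_right_mono) auto
    also have "\<dots> = real n * \<mu>\<^sup>2 * \<epsilon>\<^sup>2 / 3" using eps by (simp add: power2_eq_square power3_eq_cube)
    finally have "\<sigma>\<^sup>2 * \<tau> K / real n \<le> (real n * \<mu>\<^sup>2 * \<epsilon>\<^sup>2 / 3) / real n" by (rule divide_right_mono) simp
    also have "\<dots> = \<mu>\<^sup>2 * \<epsilon>\<^sup>2 / 3" using n1 by simp
    finally have q\<tau>: "(\<sigma>\<^sup>2 / real n) * \<tau> K \<le> \<mu>\<^sup>2 * \<epsilon>\<^sup>2 / 3" by simp
    have "5 / (2 * \<mu>) * (\<sigma>\<^sup>2 / real n) * (\<Sum>k<K. weight k) \<le> 5 / (2 * \<mu>) * (\<sigma>\<^sup>2 / real n) * ((\<tau> K) ^ 3 / (3 * \<mu>))"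
      unfolding \<tau>_def using mu by (intro mult_left_mono sum_weight_le) auto
    also have "\<dots> = 5 / (6 * \<mu>\<^sup>2) * ((\<sigma>\<^sup>2 / real n) * \<tau> K) * (\<tau> K)\<^sup>2"
    proof -
      define q c where "q = \<sigma>\<^sup>2 / real n" and "c = \<tau> K"
      have "X * q * (c ^ 3 / d) = (X * (1 / d)) * (q * c ^ 3)" for X d :: real by simp
      then have "5 / (2 * \<mu>) * q * (c ^ 3 / (3 * \<mu>)) = (5 / (2 * \<mu>) * (1 / (3 * \<mu>))) * (q * c ^ 3)" .
      also have "5 / (2 * \<mu>) * (1 / (3 * \<mu>)) = 5 / (6 * \<mu>\<^sup>2)" by (simp add: power2_eq_square)
      also have "5 / (6 * \<mu>\<^sup>2) * (q * c ^ 3) = 5 / (6 * \<mu>\<^sup>2) * (q * c) * c\<^sup>2"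
        by (simp only: power2_eq_square power3_eq_cube mult.assoc)
      finally show ?thesis unfolding q_def c_def .
    qed
    also have "\<dots> \<le> 5 / (6 * \<mu>\<^sup>2) * (\<mu>\<^sup>2 * \<epsilon>\<^sup>2 / 3) * (\<tau> K)\<^sup>2"
      using q\<tau> mu by (intro mult_right_mono mult_left_mono) auto
    also have "\<dots> = 5 * \<epsilon>\<^sup>2 / 18 * (\<tau> K)\<^sup>2" using mu by simp
    finally show ?thesis .
  qed
  have "(\<tau> K)\<^sup>2 * (2 / 3 * I) \<le> (\<tau> K)\<^sup>2 * (\<epsilon>\<^sup>2 / 4 + 5 * \<epsilon>\<^sup>2 / 18)"
  proof -
    have "(\<tau> K)\<^sup>2 * (2 / 3 * I) = 2 / 3 * (\<tau> K)\<^sup>2 * I" by simp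
    moreover have "(\<tau> K)\<^sup>2 * (\<epsilon>\<^sup>2 / 4 + 5 * \<epsilon>\<^sup>2 / 18) = \<epsilon>\<^sup>2 / 4 * (\<tau> K)\<^sup>2 + 5 * \<epsilon>\<^sup>2 / 18 * (\<tau> K)\<^sup>2"
      by (simp only: distrib_left mult.commute)
    ultimately show ?thesis using main first second by linarith
  qed
  then have "2 / 3 * I \<le> \<epsilon>\<^sup>2 / 4 + 5 * \<epsilon>\<^sup>2 / 18"
    using \<tau>_pos(2)[of K] by (simp only: mult_le_cancel_left_pos zero_less_power)
  then have "I \<le> \<epsilon>\<^sup>2" using zero_le_power2[of \<epsilon>] by linarith
  moreover have "real K \<le> 2 * \<Psi>0 / \<mu> / \<epsilon>"
  proof (cases K)
    case 0
    then show ?thesis using Psi0 mu eps by simp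
  next
    case (Suc j)
    have "\<mu> * (real j + r - 1) < 2 * \<Psi>0 / \<epsilon>" using before[OF Suc] by (simp add: Q_def \<tau>)
    moreover have "\<mu> * real K \<le> \<mu> * (real j + r - 1)"
    proof (rule mult_left_mono)
      have "0 < 1 / \<mu>" using mu by simp
      with r have "3 < r" by linarith
      then show "real K \<le> real j + r - 1" by (simp add: Suc)
    qed (use mu in simp)
    ultimately have "\<mu> * real K \<le> 2 * \<Psi>0 / \<epsilon>" by linarith
    then have "real K \<le> 2 * \<Psi>0 / \<epsilon> / \<mu>"
      unfolding pos_le_divide_eq[OF mu(1)] by (simp only: mult.commute)
    moreover have "2 * \<Psi>0 / \<epsilon> / \<mu> = 2 * \<Psi>0 / \<mu> / \<epsilon>" by (simp add: mult.commute)
    ultimately show ?thesis by (simp only:)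
  qed
  ultimately show ?thesis unfolding I_def by blast
qed

lemma p_le: "p k \<le> \<epsilon> + 2 / (real k + 2)"
proof -
  have le: "\<mu> * (real k + 2) \<le> \<mu> * (real k + r - 1) - 1"
    using mu_r mu by (simp add: algebra_simps)
  have pos: "0 < \<mu> * (real k + 2)" using mu by simp
  have "2 * \<mu> / (\<mu> * (real k + r - 1) - 1) \<le> 2 * \<mu> / (\<mu> * (real k + 2))"
    by (rule divide_left_mono[OF le]) (use mu in simp, rule mult_pos_pos[OF less_le_trans[OF pos le] pos])
  also have "\<dots> = 2 / (real k + 2)" using mu by simp
  finally show ?thesis by (simp add: p_eq)
qed

end

lemma sum_inverse_le_ln: "(\<Sum>k<K. 1 / (real k + 2)) \<le> ln (real K + 1)"
proof (induction K)
  case (Suc K)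
  have "ln ((real K + 1) / (real K + 2)) \<le> (real K + 1) / (real K + 2) - 1"
    by (rule ln_le_minus_one) simp
  also have "\<dots> = - (1 / (real K + 2))" by (simp add: field_simps)
  finally have "1 / (real K + 2) \<le> ln (real K + 2) - ln (real K + 1)" by (simp add: ln_div)
  with Suc show ?case by (simp add: add.commute)
qed simp

lemma nat_floor_bounds:
  fixes y :: real assumes "m = nat \<lfloor>y\<rfloor>" "1 \<le> m"
  shows "y / 2 \<le> real m" "real m \<le> y"
proof -
  have "int m = \<lfloor>y\<rfloor>" using assms by linarith
  then have "real m = real_of_int \<lfloor>y\<rfloor>" by (metis of_int_of_nat_eq)
  moreover have "1 \<le> real m" using assms(2) by simp
  moreover have "real_of_int \<lfloor>y\<rfloor> \<le> y" "y < real_of_int \<lfloor>y\<rfloor> + 1" by linarith+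
  ultimately show "y / 2 \<le> real m" "real m \<le> y" by linarith+
qed

theorem corollary23:
  fixes F :: "real ^ 'p \<Rightarrow> real ^ 'p"
    and T :: "real ^ 'p \<Rightarrow> (real ^ 'p) set"
    and FF :: "real ^ 'p \<Rightarrow> 's \<Rightarrow> real ^ 'p"
    and D :: "'s measure"
    and \<sigma> \<rho> L Lh lam \<mu> \<nu> \<beta> \<beta>bar \<Lambda> r \<Psi>0 cb cn :: real
    and t \<eta> :: "nat \<Rightarrow> real"
    and x0 xs :: "real ^ 'p"
  assumes D: "prob_space D"
    and FF_meas: "(\<lambda>(x, s). FF x s) \<in> borel_measurable (borel \<Otimes>\<^sub>M D)"
    and FF_int: "\<And>x. integrable D (FF x)"
    and F_def: "\<And>x. F x = (\<integral>s. FF x s \<partial>D)"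
    and \<sigma>: "\<sigma> \<ge> 0"
    and var_int: "\<And>x. integrable D (\<lambda>s. (norm (FF x s - F x))\<^sup>2)"
    and var: "\<And>x. (\<integral>s. (norm (FF x s - F x))\<^sup>2 \<partial>D) \<le> \<sigma>\<^sup>2"
    and \<rho>: "\<rho> \<ge> 0"
    and T: "maximally_cohypomonotone \<rho> T"
    and L: "L > 0"
    and cocoercive: "\<And>x y. (F x - F y) \<bullet> (x - y) \<ge>
            1 / L * (\<integral>s. (norm (FF x s - FF y s))\<^sup>2 \<partial>D)"
    and L\<rho>: "L * \<rho> < 1"
    and Lh: "Lh > L" "Lh * \<rho> < 1"
    and \<beta>bar: "\<beta>bar = (lam * (4 - Lh * lam) - 4 * \<rho>) / (4 * (1 - \<rho> * Lh))"
    and \<Lambda>: "\<Lambda> = (Lh - L) / (L * Lh)"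
    and lam: "lam > 0" "2 * \<rho> \<le> lam" "lam < 2 * (1 + sqrt (1 - Lh * \<rho>)) / Lh"
    and \<mu>: "0 < \<mu>" "\<mu> < 2 / 3"
    and \<nu>: "\<nu> = \<mu> / 2"
    and \<beta>: "0 < \<beta>" "\<beta> \<le> (2 - \<mu>) * \<beta>bar / (2 + \<mu>)"
    and t: "\<And>k. t k = \<mu> * (real k + r)"
    and \<eta>: "\<And>k. \<eta> k = 2 * \<beta> * (t k - 1) / (t k - \<nu>)"
    and r: "r > 3 + 1 / \<mu>"
    and x0: "x0 \<in> op_dom (op_plus F T)"
    and xs: "xs \<in> zer (op_plus F T)"
    and \<Psi>0: "\<Psi>0 = sqrt (\<mu>\<^sup>2 * r\<^sup>2 * (norm (G_op lam F T x0))\<^sup>2 +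
                  (2 * r - 1) / (4 * \<beta>\<^sup>2 * (\<mu> * r - 1)) * (norm (x0 - xs))\<^sup>2)"
    and cb: "cb = 5 * \<beta> / (\<mu> * \<Lambda>)"
    and cn: "cn = 24 * \<sigma>\<^sup>2 * max (sqrt 2 * \<Psi>0 / \<mu>\<^sup>2) (1 / (\<mu> * \<beta>))"
  shows "\<exists>C. \<forall>\<epsilon> b n p.
           0 < \<epsilon> \<and> \<epsilon> \<le> (\<mu> * (r - 3) - 1) / (\<mu> * (r - 1) - 1) \<and>
           b = nat \<lfloor>cb / \<epsilon>\<rfloor> \<and> n = nat \<lfloor>cn / \<epsilon> ^ 3\<rfloor> \<and> 1 \<le> b \<and> 1 \<le> n \<and>
           (\<forall>k. p k = \<epsilon> + 2 * \<mu> / (\<mu> * (real k + r - 1) - 1)) \<longrightarrow>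
           (\<forall>(M :: 'w measure) coin mini mega Ft x z.
              lsarah_sampling M D (\<lambda>_. b) (\<lambda>_. n) p coin mini mega \<and>
              lsarah_estimator M FF (\<lambda>_. b) (\<lambda>_. n) coin mini mega x Ft \<and>
              vfosa_plus_iteration M lam T t \<eta> \<nu> x0 Ft x z \<longrightarrow>
              (\<exists>K. integrable M (\<lambda>\<omega>. (norm (G_op lam F T (x K \<omega>)))\<^sup>2) \<and>
                   (\<integral>\<omega>. (norm (G_op lam F T (x K \<omega>)))\<^sup>2 \<partial>M) \<le> \<epsilon>\<^sup>2 \<and>
                   expected_total_cost M (\<lambda>_. b) (\<lambda>_. n) coin K
                     \<le> C * (1 / \<epsilon>\<^sup>2 + 1 / \<epsilon> ^ 3 + ln (1 / \<epsilon>) / \<epsilon> ^ 3)))"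
proof -
  have mu_r: "1 + 3 * \<mu> < \<mu> * r"
  proof -
    have "\<mu> * (3 + 1 / \<mu>) < \<mu> * r" using r \<mu> by (intro mult_strict_left_mono) auto
    then show ?thesis using \<mu> by (simp add: algebra_simps)
  qed
  have Lam_pos: "0 < \<Lambda>" unfolding \<Lambda> using Lh L by simp
  have Psi0_rad: "0 \<le> \<mu>\<^sup>2 * r\<^sup>2 * (norm (G_op lam F T x0))\<^sup>2 +
      (2 * r - 1) / (4 * \<beta>\<^sup>2 * (\<mu> * r - 1)) * (norm (x0 - xs))\<^sup>2"
  proof -
    have "0 \<le> 1 / \<mu>" using \<mu> by simp
    then have "0 \<le> 2 * r - 1" using r by linarith
    moreover have "0 \<le> \<mu> * r - 1" using mu_r \<mu> by linarith
    ultimately show ?thesis by simp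
  qed
  have Psi0_nonneg: "0 \<le> \<Psi>0" unfolding \<Psi>0 using Psi0_rad by simp
  have Psi0_sq: "\<Psi>0\<^sup>2 = \<mu>\<^sup>2 * r\<^sup>2 * (norm (G_op lam F T x0))\<^sup>2 +
      (2 * r - 1) / (4 * \<beta>\<^sup>2 * (\<mu> * r - 1)) * (norm (x0 - xs))\<^sup>2"
    unfolding \<Psi>0 using Psi0_rad by simp
  \<comment> \<open>at most \<open>k / \<epsilon>\<close> iterations are needed\<close>
  define k where "k = 2 * \<Psi>0 / \<mu>"
  have k: "0 \<le> k" using Psi0_nonneg \<mu> by (simp add: k_def)
  have cb_pos: "0 < cb" unfolding cb using \<beta> \<mu> Lam_pos by simp
  have cn_ge: "24 * \<sigma>\<^sup>2 * \<Psi>0 / \<mu>\<^sup>2 \<le> cn"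
  proof -
    have "1 * \<Psi>0 / \<mu>\<^sup>2 \<le> sqrt 2 * \<Psi>0 / \<mu>\<^sup>2"
      using Psi0_nonneg by (intro divide_right_mono mult_right_mono) auto
    then have "\<Psi>0 / \<mu>\<^sup>2 \<le> max (sqrt 2 * \<Psi>0 / \<mu>\<^sup>2) (1 / (\<mu> * \<beta>))" by (simp add: le_max_iff_disj)
    then have "24 * \<sigma>\<^sup>2 * (\<Psi>0 / \<mu>\<^sup>2) \<le> cn" unfolding cn by (intro mult_left_mono) auto
    then show ?thesis by simp
  qed
  have "0 \<le> 24 * \<sigma>\<^sup>2 * \<Psi>0 / \<mu>\<^sup>2" using Psi0_nonneg by simp
  with cn_ge have cn_nonneg: "0 \<le> cn" by linarith
  \<comment> \<open>one summand for each of the rates \<open>\<epsilon>\<^sup>-\<^sup>3\<close>, \<open>\<epsilon>\<^sup>-\<^sup>3 ln (1/\<epsilon>)\<close> and \<open>\<epsilon>\<^sup>-\<^sup>2\<close>\<close>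
  define C where "C = cn * (1 + k + 2 * ln (k + 1)) + 2 * cn + (2 * cb + 1) * k"
  show ?thesis
  proof (rule exI[of _ C], intro allI impI, elim conjE)
    fix \<epsilon> :: real and b n :: nat and p :: "nat \<Rightarrow> real" and M :: "'w measure"
      and coin mini mega Ft x z
    assume eps: "0 < \<epsilon>" "\<epsilon> \<le> (\<mu> * (r - 3) - 1) / (\<mu> * (r - 1) - 1)"
      and b: "b = nat \<lfloor>cb / \<epsilon>\<rfloor>" "1 \<le> b" and n: "n = nat \<lfloor>cn / \<epsilon> ^ 3\<rfloor>" "1 \<le> n"
      and p: "\<forall>k. p k = \<epsilon> + 2 * \<mu> / (\<mu> * (real k + r - 1) - 1)"
      and samp: "lsarah_sampling M D (\<lambda>_. b) (\<lambda>_. n) p coin mini mega"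
      and est: "lsarah_estimator M FF (\<lambda>_. b) (\<lambda>_. n) coin mini mega x Ft"
      and iter: "vfosa_plus_iteration M lam T t \<eta> \<nu> x0 Ft x z"
    note bb = nat_floor_bounds[OF b] and nb = nat_floor_bounds[OF n]
    have "(\<mu> * (r - 3) - 1) / (\<mu> * (r - 1) - 1) \<le> 1"
      using mu_r \<mu> by (simp add: pos_divide_le_eq algebra_simps)
    with eps have eps1: "\<epsilon> \<le> 1" by linarith
    interpret prob_space M using samp by (simp add: lsarah_sampling_def)
    have resolv: "resolvent_setting \<rho> lam T"
      by (intro resolvent_setting.intro T \<rho> lam)
    have incl: "stochastic_inclusion \<rho> lam T D FF F \<sigma> L"
      by (intro stochastic_inclusion.intro resolv D stochastic_inclusion_axioms.intro)
        (fact FF_meas FF_int F_def var_int var L cocoercive)+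
    have draws: "lsarah_draws M D (\<lambda>_. b) (\<lambda>_. n) p coin mini mega"
      by (intro lsarah_draws.intro lsarah_draws_axioms.intro prob_space_axioms D samp)
    have run: "vfosa_run \<rho> lam T D FF F \<sigma> L M b n p coin mini mega t \<eta> \<nu> x0 Ft x z"
      by (intro vfosa_run.intro vfosa_run_axioms.intro incl draws b(2) n(2) est iter)
    have b_ge: "5 * \<beta> / (2 * \<mu>) \<le> \<Lambda> * real b * \<epsilon>"
    proof -
      have "cb \<le> 2 * (real b * \<epsilon>)" using bb(1) eps by (simp add: pos_divide_le_eq)
      then have "\<Lambda> * cb \<le> \<Lambda> * (2 * (real b * \<epsilon>))" using Lam_pos by (intro mult_left_mono) auto
      moreover have "\<Lambda> * cb = 5 * \<beta> / \<mu>" using Lam_pos by (simp add: cb)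
      moreover have "5 * \<beta> / (2 * \<mu>) = 5 * \<beta> / \<mu> / 2" by simp
      ultimately show ?thesis by simp
    qed
    have n_ge: "12 * \<sigma>\<^sup>2 * \<Psi>0 \<le> real n * \<mu>\<^sup>2 * \<epsilon> ^ 3"
    proof -
      have "cn \<le> 2 * (real n * \<epsilon> ^ 3)" using nb(1) eps by (simp add: pos_divide_le_eq)
      then have "cn * \<mu>\<^sup>2 \<le> 2 * (real n * \<epsilon> ^ 3) * \<mu>\<^sup>2" by (intro mult_right_mono) auto
      moreover have "24 * \<sigma>\<^sup>2 * \<Psi>0 \<le> cn * \<mu>\<^sup>2" using cn_ge \<mu> by (simp add: pos_divide_le_eq)
      ultimately have "24 * \<sigma>\<^sup>2 * \<Psi>0 \<le> 2 * (real n * \<epsilon> ^ 3) * \<mu>\<^sup>2" by (rule order_trans[rotated])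
      then show ?thesis by (simp add: mult_ac)
    qed
    interpret vfosa_lsarah \<rho> lam T D FF F \<sigma> L M b n p coin mini mega t \<eta> \<nu> x0 Ft x z
        Lh \<mu> \<beta> \<beta>bar \<Lambda> r \<epsilon> \<Psi>0 xs
    proof (intro vfosa_lsarah.intro vfosa_lsarah_axioms.intro)
      show "\<beta> * (2 + \<mu>) \<le> (2 - \<mu>) * \<beta>bar" using \<beta>(2) \<mu> by (simp add: pos_le_divide_eq)
      show "\<rho> * Lh < 1" using Lh(2) by (simp add: mult.commute)
      show "3 * \<mu> < 2" using \<mu>(2) by simp
      show "p k = \<epsilon> + 2 * \<mu> / (\<mu> * (real k + r - 1) - 1)" for k using p by blast
    qed (fact run eps(1) Lh(1) \<mu>(1) \<nu> \<beta>(1) \<beta>bar \<Lambda> t \<eta> r b_ge n_ge Psi0_nonneg Psi0_sq xs)+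
    obtain K where K: "(\<integral>\<omega>. (norm (G_op lam F T (x K \<omega>)))\<^sup>2 \<partial>M) \<le> \<epsilon>\<^sup>2" "real K \<le> k / \<epsilon>"
      using epsilon_solution unfolding k_def[symmetric] by (elim exE conjE)
    have cost: "expected_total_cost M (\<lambda>_. b) (\<lambda>_. n) coin K
        \<le> C * (1 / \<epsilon>\<^sup>2 + 1 / \<epsilon> ^ 3 + ln (1 / \<epsilon>) / \<epsilon> ^ 3)"
    proof -
      define A where "A = 1 / \<epsilon>"
      have A: "1 \<le> A" using eps eps1 by (simp add: A_def)
      have KA: "real K \<le> k * A" using K(2) by (simp add: A_def)
      have ln_K: "ln (real K + 1) \<le> ln (k + 1) + ln A"
      proof -
        have "real K + 1 \<le> (k + 1) * A" using KA A by (simp add: algebra_simps)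
        then have "ln (real K + 1) \<le> ln ((k + 1) * A)" by simp
        also have "\<dots> = ln (k + 1) + ln A" using k A by (simp add: ln_mult)
        finally show ?thesis .
      qed
      have nA: "real n \<le> cn * A ^ 3" using nb(2) by (simp add: A_def power_one_over)
      have bA: "real b \<le> cb * A" using bb(2) by (simp add: A_def)
      have "expected_total_cost M (\<lambda>_. b) (\<lambda>_. n) coin K
          \<le> (\<Sum>j<K. (if j = 0 then real n else real n * p j + 2 * real b) + 1)"
        by (rule expected_total_cost_le)
      also have "\<dots> \<le> (\<Sum>j<K. (if j = 0 then real n else 0) + ((real n * \<epsilon> + 2 * real b + 1) + 2 * real n * (1 / (real j + 2))))"
      proof (rule sum_mono)
        fix j :: nat
        have if_le: "(if j = 0 then a else c) + 1 \<le> (if j = 0 then a else 0) + X"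
          if "1 \<le> X" "c + 1 \<le> X" for a c X :: real using that by auto
        \<comment> \<open>summing these bounds turns the decaying part of the probabilities into a logarithm\<close>
        have "real n * p j \<le> real n * (\<epsilon> + 2 / (real j + 2))" by (intro mult_left_mono p_le) auto
        moreover have "real n * (\<epsilon> + 2 / (real j + 2)) = real n * \<epsilon> + 2 * real n * (1 / (real j + 2))"
          by (simp add: distrib_left)
        moreover have "0 \<le> real n * \<epsilon>" "0 \<le> 2 * real n * (1 / (real j + 2))" using eps by simp_all
        ultimately show "(if j = 0 then real n else real n * p j + 2 * real b) + 1
            \<le> (if j = 0 then real n else 0) + ((real n * \<epsilon> + 2 * real b + 1) + 2 * real n * (1 / (real j + 2)))"
          by (intro if_le) linarith+
      qed
      also have "\<dots> = (\<Sum>j<K. if j = 0 then real n else 0)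
          + (real K * (real n * \<epsilon> + 2 * real b + 1) + 2 * real n * (\<Sum>j<K. 1 / (real j + 2)))"
      proof -
        have "(\<Sum>j<K. f j + (c + d * g j)) = (\<Sum>j<K. f j) + (real K * c + d * (\<Sum>j<K. g j))"
          for f g :: "nat \<Rightarrow> real" and c d by (simp add: sum.distrib sum_distrib_left)
        then show ?thesis by this
      qed
      also have "\<dots> \<le> real n + (k * A * (real n * \<epsilon> + 2 * real b + 1) + 2 * real n * ln (real K + 1))"
      proof (intro add_mono mult_left_mono mult_right_mono KA sum_inverse_le_ln)
        have "(\<Sum>j<K. if j = 0 then real n else 0) = (if 0 < K then real n else 0)"
          by (subst sum.delta) auto
        then show "(\<Sum>j<K. if j = 0 then real n else 0) \<le> real n" by simp
      qed (use eps in auto)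
      also have "\<dots> \<le> real n + (k * A * (real n * \<epsilon> + 2 * real b + 1) + 2 * real n * (ln (k + 1) + ln A))"
        using ln_K by (intro add_left_mono mult_left_mono) auto
      also have "real n + (k * A * (real n * \<epsilon> + 2 * real b + 1) + 2 * real n * (ln (k + 1) + ln A))
          = real n * (1 + k + 2 * ln (k + 1) + 2 * ln A) + (2 * real b + 1) * (k * A)"
      proof -
        have "A * \<epsilon> = 1" using eps by (simp add: A_def)
        moreover have "c + (k * A * (c * \<epsilon> + d + 1) + 2 * c * (l + m))
            = c + k * c * (A * \<epsilon>) + 2 * c * l + 2 * c * m + (d + 1) * (k * A)" for c d l m :: real
          by (simp add: algebra_simps)
        moreover have "c * (1 + k + 2 * l + 2 * m) = c + k * c * 1 + 2 * c * l + 2 * c * m" for c l m :: real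
          by (simp add: algebra_simps)
        ultimately show ?thesis by (simp only:)
      qed
      also have "\<dots> \<le> cn * A ^ 3 * (1 + k + 2 * ln (k + 1) + 2 * ln A) + (2 * (cb * A) + 1 * A) * (k * A)"
        using nA bA A k by (intro add_mono mult_right_mono mult_left_mono add_nonneg_nonneg mult_nonneg_nonneg) auto
      also have "\<dots> = (cn * (1 + k + 2 * ln (k + 1))) * A ^ 3 + (2 * cn) * (A ^ 3 * ln A) + ((2 * cb + 1) * k) * A\<^sup>2"
      proof -
        have "cn * a * (m + 2 * l) + (2 * (cb * A) + 1 * A) * (k * A)
            = (cn * m) * a + (2 * cn) * (a * l) + ((2 * cb + 1) * k) * A\<^sup>2" for a m l :: real
          by (simp add: algebra_simps power2_eq_square)
        then show ?thesis by this
      qed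
      also have "\<dots> \<le> C * A ^ 3 + C * (A ^ 3 * ln A) + C * A\<^sup>2"
      proof -
        have "0 \<le> cn * (1 + k + 2 * ln (k + 1))" "0 \<le> 2 * cn" "0 \<le> (2 * cb + 1) * k"
          using cn_nonneg k cb_pos by auto
        then have "cn * (1 + k + 2 * ln (k + 1)) \<le> C" "2 * cn \<le> C" "(2 * cb + 1) * k \<le> C"
          unfolding C_def by linarith+
        then show ?thesis using A by (intro add_mono mult_right_mono) auto
      qed
      also have "\<dots> = C * (1 / \<epsilon>\<^sup>2 + 1 / \<epsilon> ^ 3 + ln (1 / \<epsilon>) / \<epsilon> ^ 3)"
      proof -
        have "C * A ^ 3 + C * (A ^ 3 * l) + C * A\<^sup>2 = C * (A\<^sup>2 + A ^ 3 + l * A ^ 3)" for l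
          by (simp add: algebra_simps)
        then have "C * A ^ 3 + C * (A ^ 3 * ln A) + C * A\<^sup>2 = C * (A\<^sup>2 + A ^ 3 + ln A * A ^ 3)" by this
        also have "\<dots> = C * (1 / \<epsilon>\<^sup>2 + 1 / \<epsilon> ^ 3 + ln (1 / \<epsilon>) / \<epsilon> ^ 3)"
          by (simp add: A_def power_one_over)
        finally show ?thesis .
      qed
      finally show ?thesis .
    qed
    show "\<exists>K. integrable M (\<lambda>\<omega>. (norm (G_op lam F T (x K \<omega>)))\<^sup>2) \<and>
        (\<integral>\<omega>. (norm (G_op lam F T (x K \<omega>)))\<^sup>2 \<partial>M) \<le> \<epsilon>\<^sup>2 \<and>
        expected_total_cost M (\<lambda>_. b) (\<lambda>_. n) coin K
          \<le> C * (1 / \<epsilon>\<^sup>2 + 1 / \<epsilon> ^ 3 + ln (1 / \<epsilon>) / \<epsilon> ^ 3)"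
      by (intro exI[of _ K] conjI residual_sq_integrable K(1) cost)
  qed
qed

end
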